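(* Let $k$ be a field with $\mathrm{char}(k)=0$, $V$ a $k$-vector space and $A=T(V)/(R)$ a quadratic algebra with $R\subseteq V\otimes V$. Then $HK^{hi}_0(A)\cong k$. If $A$ is Koszul, then for any $p>0$, $$HK^{hi}_p(A)\cong 0 .$$
   Context: $W_0=k$, $W_1=V$, $W_p=\bigcap_{i+2+j=p}V^{\otimes i}\otimes R\otimes V^{\otimes j}\subseteq V^{\otimes p}$ for $p\ge2$. Elements of $W_p$ are written $x_1\ldots x_p$ (a sum of such tensors, $x_i\in V$), with the same notation when $W_p$ is viewed inside $V\otimes W_{p-1}$ or $W_{p-1}\otimes V$. Koszul homology $HK_\bullet(A)$ is the homology of $(A\otimes W_\bullet,b_K)$ with $b_K(a\otimes x_1\ldots x_p)=ax_1\otimes x_2\ldots x_p+(-1)^px_pa\otimes x_1\ldots x_{p-1}$ (and $0$ for $p=0$). Let $e_A:V\to A$, $e_A(x)=x$. The left Koszul cap product with $e_A$ is $e_A\frown_K(a\otimes x_1\ldots x_p)=(-1)^{p-1}x_pa\otimes x_1\ldots x_{p-1}$ ($0$ for $p=0$). It induces a differential $\partial_\frown:HK_p(A)\to HK_{p-1}(A)$ (on the class of a cycle $a\otimes x_1\ldots x_p$ it is the class of $ax_1\otimes x_2\ldots x_p$). The higher Koszul homology $HK^{hi}_\bullet(A)$ is the homology of $(HK_\bullet(A),\partial_\frown)$. $A$ is Koszul if the bimodule complex $K(A)$, with $K(A)_p=A\otimes W_p\otimes A$ and $d(a\otimes x_1\ldots x_p\otimes a')=ax_1\otimes x_2\ldots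 x_p\otimes a'+(-1)^pa\otimes x_1\ldots x_{p-1}\otimes x_pa'$, has zero homology in every positive degree. *)

theory Defs
  imports
    "HOL-Algebra.Algebraic_Closure_Type"
    "HOL-Library.Poly_Mapping"
begin

section \<open>Linear algebra on carriers\<close>

text \<open>
  The ground field is a type of class field. A vector space over it is given by a record of
  type \<^typ>\<open>('k, 'a) module\<close>; a \<open>k\<close>-algebra is such a record whose fields \<open>mult\<close> and \<open>one\<close>
  are meaningful. For plain vector spaces those two fields carry no information.
\<close>

abbreviation scalars :: "'k::field ring" where
  "scalars \<equiv> ring_of_type_algebra"

definition base_space :: "('k::field, 'k) module" where
  "base_space = ring.extend scalars (module.fields (*))"

definition zero_space :: "('k::field, 'k) module" where
  "zero_space = base_space\<lparr>carrier := {0}\<rparr>"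

definition linear_maps :: "('k::field, 'a) module \<Rightarrow> ('k, 'b) module \<Rightarrow> ('a \<Rightarrow> 'b) set" where
  "linear_maps M N = {f \<in> carrier M \<rightarrow>\<^sub>E carrier N.
     (\<forall>x\<in>carrier M. \<forall>y\<in>carrier M. f (x \<oplus>\<^bsub>M\<^esub> y) = f x \<oplus>\<^bsub>N\<^esub> f y) \<and>
     (\<forall>c. \<forall>x\<in>carrier M. f (c \<odot>\<^bsub>M\<^esub> x) = c \<odot>\<^bsub>N\<^esub> f x)}"

definition linearly_isomorphic :: "('k::field, 'a) module \<Rightarrow> ('k, 'b) module \<Rightarrow> bool" where
  "linearly_isomorphic M N \<longleftrightarrow> (\<exists>f\<in>linear_maps M N. bij_betw f (carrier M) (carrier N))"

definition linear_span :: "('k::field, 'a) module \<Rightarrow> 'a set \<Rightarrow> 'a set" where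
  "linear_span M S = \<Inter>{H. submodule H scalars M \<and> S \<subseteq> H}"

text \<open>
  The quotient of a vector space by a subspace, or of an algebra by a two-sided ideal: the
  library's factor ring, equipped with the induced scalar multiplication.
\<close>

definition quotient :: "('k::field, 'a) module \<Rightarrow> 'a set \<Rightarrow> ('k, 'a set) module" where
  "quotient M N =
     ring.extend (M Quot N) (module.fields (\<lambda>c C. \<Union>x\<in>C. N +>\<^bsub>M\<^esub> (c \<odot>\<^bsub>M\<^esub> x)))"

definition free_space :: "'x set \<Rightarrow> ('k::field, 'x \<Rightarrow>\<^sub>0 'k) module" where
  "free_space B =
     \<lparr>carrier = {p. Poly_Mapping.keys p \<subseteq> B}, monoid.mult = (\<lambda>_ _. 0), one = 0, ring.zero = 0, add = (+),
      module.smult = (\<lambda>c. Poly_Mapping.map ((*) c))\<rparr>"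

definition tensor_relations ::
    "('k::field, 'a) module \<Rightarrow> ('k, 'b) module \<Rightarrow> ('a \<times> 'b \<Rightarrow>\<^sub>0 'k) set" where
  "tensor_relations M N =
     {Poly_Mapping.single (x \<oplus>\<^bsub>M\<^esub> x', y) 1 - Poly_Mapping.single (x, y) 1
        - Poly_Mapping.single (x', y) 1 | x x' y.
        x \<in> carrier M \<and> x' \<in> carrier M \<and> y \<in> carrier N} \<union>
     {Poly_Mapping.single (x, y \<oplus>\<^bsub>N\<^esub> y') 1 - Poly_Mapping.single (x, y) 1
        - Poly_Mapping.single (x, y') 1 | x y y'.
        x \<in> carrier M \<and> y \<in> carrier N \<and> y' \<in> carrier N} \<union>
     {Poly_Mapping.single (c \<odot>\<^bsub>M\<^esub> x, y) 1 - Poly_Mapping.single (x, y) c | c x y.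
        x \<in> carrier M \<and> y \<in> carrier N} \<union>
     {Poly_Mapping.single (x, c \<odot>\<^bsub>N\<^esub> y) 1 - Poly_Mapping.single (x, y) c | c x y.
        x \<in> carrier M \<and> y \<in> carrier N}"

definition tensor_null ::
    "('k::field, 'a) module \<Rightarrow> ('k, 'b) module \<Rightarrow> ('a \<times> 'b \<Rightarrow>\<^sub>0 'k) set" where
  "tensor_null M N = linear_span (free_space (carrier M \<times> carrier N)) (tensor_relations M N)"

definition tensor_product ::
    "('k::field, 'a) module \<Rightarrow> ('k, 'b) module \<Rightarrow> ('k, ('a \<times> 'b \<Rightarrow>\<^sub>0 'k) set) module" where
  "tensor_product M N = quotient (free_space (carrier M \<times> carrier N)) (tensor_null M N)"

definition pure_tensor ::
    "('k::field, 'a) module \<Rightarrow> ('k, 'b) module \<Rightarrow> 'a \<Rightarrow> 'b \<Rightarrow> ('a \<times> 'b \<Rightarrow>\<^sub>0 'k) set" where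
  "pure_tensor M N x y =
     tensor_null M N +>\<^bsub>free_space (carrier M \<times> carrier N)\<^esub> Poly_Mapping.single (x, y) 1"

text \<open>
  Homology in degree \<open>p\<close> of a complex \<open>C\<close> with differentials \<open>d p : C p \<rightarrow> C (p - 1)\<close>.
  Complexes are indexed by the natural numbers and \<open>d 0\<close> is always the zero map; since
  \<open>0 - 1 = 0\<close>, it is rendered as a zero map from \<open>C 0\<close> to itself.
\<close>

definition homology ::
    "(nat \<Rightarrow> ('k::field, 'a) module) \<Rightarrow> (nat \<Rightarrow> 'a \<Rightarrow> 'a) \<Rightarrow> nat \<Rightarrow> ('k, 'a set) module" where
  "homology C d p =
     quotient ((C p)\<lparr>carrier := {z \<in> carrier (C p). d p z = \<zero>\<^bsub>C (p - 1)\<^esub>}\<rparr>)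
       (d (Suc p) ` carrier (C (Suc p)))"


section \<open>Quadratic algebras\<close>

text \<open>
  The vector space \<open>V\<close> is the type \<open>'v\<close> with scalar multiplication \<open>sc\<close>. Its tensor algebra
  is the free associative algebra on the set \<open>V\<close> (with words over \<open>V\<close> as linear basis) modulo
  the two-sided ideal that makes the inclusion of \<open>V\<close> linear.
\<close>

type_synonym ('k, 'v) tens = "('v list \<Rightarrow>\<^sub>0 'k) set"
type_synonym ('k, 'v) qalg = "('k, 'v) tens set"
type_synonym ('k, 'v) kchain = "(('k, 'v) qalg \<times> ('k, 'v) tens \<Rightarrow>\<^sub>0 'k) set"
type_synonym ('k, 'v) bichain = "(('k, 'v) kchain \<times> ('k, 'v) qalg \<Rightarrow>\<^sub>0 'k) set"

definition word_algebra :: "('k::field, 'v list \<Rightarrow>\<^sub>0 'k) module" where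
  "word_algebra = (free_space UNIV)
     \<lparr>monoid.mult := (\<lambda>p q. \<Sum>u\<in>Poly_Mapping.keys p. \<Sum>v\<in>Poly_Mapping.keys q.
        Poly_Mapping.single (u @ v) (Poly_Mapping.lookup p u * Poly_Mapping.lookup q v)),
      one := Poly_Mapping.single [] 1\<rparr>"

definition linearity_ideal ::
    "('k::field \<Rightarrow> 'v::ab_group_add \<Rightarrow> 'v) \<Rightarrow> ('v list \<Rightarrow>\<^sub>0 'k) set" where
  "linearity_ideal sc = Idl\<^bsub>word_algebra\<^esub>
     (range (\<lambda>(x, y). Poly_Mapping.single [x + y] 1 - Poly_Mapping.single [x] 1
                       - Poly_Mapping.single [y] 1) \<union>
      range (\<lambda>(c, x). Poly_Mapping.single [sc c x] 1 - Poly_Mapping.single [x] c))"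

definition tensor_algebra ::
    "('k::field \<Rightarrow> 'v::ab_group_add \<Rightarrow> 'v) \<Rightarrow> ('k, ('k, 'v) tens) module" where
  "tensor_algebra sc = quotient word_algebra (linearity_ideal sc)"

text \<open>\<open>tensor_word sc [x\<^sub>1, \<dots>, x\<^sub>n]\<close> is \<open>x\<^sub>1 \<otimes> \<dots> \<otimes> x\<^sub>n\<close>.\<close>

definition tensor_word ::
    "('k::field \<Rightarrow> 'v::ab_group_add \<Rightarrow> 'v) \<Rightarrow> 'v list \<Rightarrow> ('k, 'v) tens" where
  "tensor_word sc xs = linearity_ideal sc +>\<^bsub>word_algebra\<^esub> Poly_Mapping.single xs 1"

text \<open>\<open>V\<^sup>\<otimes>\<^sup>n\<close>, as a subspace of the tensor algebra.\<close>

definition tensor_power ::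
    "('k::field \<Rightarrow> 'v::ab_group_add \<Rightarrow> 'v) \<Rightarrow> nat \<Rightarrow> ('k, 'v) tens set" where
  "tensor_power sc n = linear_span (tensor_algebra sc) (tensor_word sc ` {xs. length xs = n})"

text \<open>A space of quadratic relations: a subspace of \<open>V \<otimes> V\<close>.\<close>

definition quadratic_relations ::
    "('k::field \<Rightarrow> 'v::ab_group_add \<Rightarrow> 'v) \<Rightarrow> ('k, 'v) tens set \<Rightarrow> bool" where
  "quadratic_relations sc R \<longleftrightarrow>
     submodule R scalars (tensor_algebra sc) \<and> R \<subseteq> tensor_power sc 2"

definition quadratic_algebra ::
    "('k::field \<Rightarrow> 'v::ab_group_add \<Rightarrow> 'v) \<Rightarrow> ('k, 'v) tens set \<Rightarrow> ('k, ('k, 'v) qalg) module" where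
  "quadratic_algebra sc R = quotient (tensor_algebra sc) (Idl\<^bsub>tensor_algebra sc\<^esub> R)"

definition e_A ::
    "('k::field \<Rightarrow> 'v::ab_group_add \<Rightarrow> 'v) \<Rightarrow> ('k, 'v) tens set \<Rightarrow> 'v \<Rightarrow> ('k, 'v) qalg" where
  "e_A sc R x = Idl\<^bsub>tensor_algebra sc\<^esub> R +>\<^bsub>tensor_algebra sc\<^esub> tensor_word sc [x]"

text \<open>
  Inside the tensor algebra, \<open>V\<^sup>\<otimes>\<^sup>i \<otimes> R \<otimes> V\<^sup>\<otimes>\<^sup>j\<close> is the span of the products \<open>u r v\<close>. For
  \<open>p < 2\<close> there is no pair \<open>(i, j)\<close>, which gives \<open>W\<^sub>0 = k\<close> and \<open>W\<^sub>1 = V\<close>.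
\<close>

definition W_space ::
    "('k::field \<Rightarrow> 'v::ab_group_add \<Rightarrow> 'v) \<Rightarrow> ('k, 'v) tens set \<Rightarrow> nat \<Rightarrow> ('k, 'v) tens set" where
  "W_space sc R p = {w \<in> tensor_power sc p. \<forall>i j. i + 2 + j = p \<longrightarrow>
     w \<in> linear_span (tensor_algebra sc)
       {u \<otimes>\<^bsub>tensor_algebra sc\<^esub> r \<otimes>\<^bsub>tensor_algebra sc\<^esub> v | u r v.
          u \<in> tensor_power sc i \<and> r \<in> R \<and> v \<in> tensor_power sc j}}"


section \<open>Koszul homology\<close>

text \<open>
  Over a field, \<open>A \<otimes> W\<^sub>p\<close> is the subspace of \<open>A \<otimes> T(V)\<close> spanned by the \<open>a \<otimes> w\<close> with \<open>w \<in> W\<^sub>p\<close>,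
  and \<open>A \<otimes> W\<^sub>p \<otimes> A\<close> likewise sits in \<open>(A \<otimes> T(V)) \<otimes> A\<close>. The structure maps are the restrictions of
  linear maps on these ambient spaces, which are determined by their values on
  \<open>a \<otimes> x\<^sub>1\<dots>x\<^sub>p\<close> resp. \<open>a \<otimes> x\<^sub>1\<dots>x\<^sub>p \<otimes> a'\<close> with \<open>x\<^sub>i \<in> V\<close>.
\<close>

abbreviation chain_space ::
    "('k::field \<Rightarrow> 'v::ab_group_add \<Rightarrow> 'v) \<Rightarrow> ('k, 'v) tens set \<Rightarrow> ('k, ('k, 'v) kchain) module" where
  "chain_space sc R \<equiv> tensor_product (quadratic_algebra sc R) (tensor_algebra sc)"

abbreviation chain_tensor ::
    "('k::field \<Rightarrow> 'v::ab_group_add \<Rightarrow> 'v) \<Rightarrow> ('k, 'v) tens set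
      \<Rightarrow> ('k, 'v) qalg \<Rightarrow> ('k, 'v) tens \<Rightarrow> ('k, 'v) kchain" where
  "chain_tensor sc R \<equiv> pure_tensor (quadratic_algebra sc R) (tensor_algebra sc)"

definition koszul_chains ::
    "('k::field \<Rightarrow> 'v::ab_group_add \<Rightarrow> 'v) \<Rightarrow> ('k, 'v) tens set \<Rightarrow> nat
      \<Rightarrow> ('k, ('k, 'v) kchain) module" where
  "koszul_chains sc R p = (chain_space sc R)\<lparr>carrier := linear_span (chain_space sc R)
     {chain_tensor sc R a w | a w. a \<in> carrier (quadratic_algebra sc R) \<and> w \<in> W_space sc R p}\<rparr>"

definition koszul_b ::
    "('k::field \<Rightarrow> 'v::ab_group_add \<Rightarrow> 'v) \<Rightarrow> ('k, 'v) tens set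
      \<Rightarrow> ('k, 'v) kchain \<Rightarrow> ('k, 'v) kchain" where
  "koszul_b sc R = (THE f. f \<in> linear_maps (chain_space sc R) (chain_space sc R) \<and>
     (\<forall>a\<in>carrier (quadratic_algebra sc R). \<forall>xs.
        f (chain_tensor sc R a (tensor_word sc xs)) =
          (if xs = [] then \<zero>\<^bsub>chain_space sc R\<^esub>
           else chain_tensor sc R (a \<otimes>\<^bsub>quadratic_algebra sc R\<^esub> e_A sc R (hd xs)) (tensor_word sc (tl xs))
             \<oplus>\<^bsub>chain_space sc R\<^esub> (- 1) ^ length xs \<odot>\<^bsub>chain_space sc R\<^esub>
               chain_tensor sc R (e_A sc R (last xs) \<otimes>\<^bsub>quadratic_algebra sc R\<^esub> a)
                 (tensor_word sc (butlast xs)))))"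

definition koszul_homology ::
    "('k::field \<Rightarrow> 'v::ab_group_add \<Rightarrow> 'v) \<Rightarrow> ('k, 'v) tens set \<Rightarrow> nat
      \<Rightarrow> ('k, ('k, 'v) kchain set) module" where
  "koszul_homology sc R = homology (koszul_chains sc R) (\<lambda>_. koszul_b sc R)"

text \<open>The left Koszul cap product with \<open>e\<^sub>A\<close>, on chains.\<close>

definition cap_e_A ::
    "('k::field \<Rightarrow> 'v::ab_group_add \<Rightarrow> 'v) \<Rightarrow> ('k, 'v) tens set
      \<Rightarrow> ('k, 'v) kchain \<Rightarrow> ('k, 'v) kchain" where
  "cap_e_A sc R = (THE f. f \<in> linear_maps (chain_space sc R) (chain_space sc R) \<and>
     (\<forall>a\<in>carrier (quadratic_algebra sc R). \<forall>xs.
        f (chain_tensor sc R a (tensor_word sc xs)) =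
          (if xs = [] then \<zero>\<^bsub>chain_space sc R\<^esub>
           else (- 1) ^ (length xs - 1) \<odot>\<^bsub>chain_space sc R\<^esub>
             chain_tensor sc R (e_A sc R (last xs) \<otimes>\<^bsub>quadratic_algebra sc R\<^esub> a)
               (tensor_word sc (butlast xs)))))"

text \<open>
  The induced map on homology classes; the zero of \<open>HK\<^sub>p\<^sub>-\<^sub>1(A)\<close> is the space of boundaries, so
  the class of \<open>z\<close> is its coset. In degree \<open>0\<close> this is the zero map of \<open>HK\<^sub>0(A)\<close>.
\<close>

definition cap_differential ::
    "('k::field \<Rightarrow> 'v::ab_group_add \<Rightarrow> 'v) \<Rightarrow> ('k, 'v) tens set \<Rightarrow> nat
      \<Rightarrow> ('k, 'v) kchain set \<Rightarrow> ('k, 'v) kchain set" where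
  "cap_differential sc R p C =
     (\<Union>z\<in>C. \<zero>\<^bsub>koszul_homology sc R (p - 1)\<^esub> +>\<^bsub>chain_space sc R\<^esub> cap_e_A sc R z)"

definition higher_koszul_homology ::
    "('k::field \<Rightarrow> 'v::ab_group_add \<Rightarrow> 'v) \<Rightarrow> ('k, 'v) tens set \<Rightarrow> nat
      \<Rightarrow> ('k, ('k, 'v) kchain set set) module" where
  "higher_koszul_homology sc R = homology (koszul_homology sc R) (cap_differential sc R)"


section \<open>Koszul algebras\<close>

abbreviation bichain_space ::
    "('k::field \<Rightarrow> 'v::ab_group_add \<Rightarrow> 'v) \<Rightarrow> ('k, 'v) tens set \<Rightarrow> ('k, ('k, 'v) bichain) module" where
  "bichain_space sc R \<equiv> tensor_product (chain_space sc R) (quadratic_algebra sc R)"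

abbreviation bichain_tensor ::
    "('k::field \<Rightarrow> 'v::ab_group_add \<Rightarrow> 'v) \<Rightarrow> ('k, 'v) tens set
      \<Rightarrow> ('k, 'v) qalg \<Rightarrow> ('k, 'v) tens \<Rightarrow> ('k, 'v) qalg \<Rightarrow> ('k, 'v) bichain" where
  "bichain_tensor sc R a w a' \<equiv> pure_tensor (chain_space sc R) (quadratic_algebra sc R) (chain_tensor sc R a w) a'"

definition bimodule_complex ::
    "('k::field \<Rightarrow> 'v::ab_group_add \<Rightarrow> 'v) \<Rightarrow> ('k, 'v) tens set \<Rightarrow> nat
      \<Rightarrow> ('k, ('k, 'v) bichain) module" where
  "bimodule_complex sc R p = (bichain_space sc R)\<lparr>carrier := linear_span (bichain_space sc R)
     {bichain_tensor sc R a w a' | a w a'. a \<in> carrier (quadratic_algebra sc R) \<and> w \<in> W_space sc R p \<and>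
        a' \<in> carrier (quadratic_algebra sc R)}\<rparr>"

definition bimodule_d ::
    "('k::field \<Rightarrow> 'v::ab_group_add \<Rightarrow> 'v) \<Rightarrow> ('k, 'v) tens set
      \<Rightarrow> ('k, 'v) bichain \<Rightarrow> ('k, 'v) bichain" where
  "bimodule_d sc R = (THE f. f \<in> linear_maps (bichain_space sc R) (bichain_space sc R) \<and>
     (\<forall>a\<in>carrier (quadratic_algebra sc R). \<forall>a'\<in>carrier (quadratic_algebra sc R). \<forall>xs.
        f (bichain_tensor sc R a (tensor_word sc xs) a') =
          (if xs = [] then \<zero>\<^bsub>bichain_space sc R\<^esub>
           else bichain_tensor sc R (a \<otimes>\<^bsub>quadratic_algebra sc R\<^esub> e_A sc R (hd xs)) (tensor_word sc (tl xs)) a'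
             \<oplus>\<^bsub>bichain_space sc R\<^esub> (- 1) ^ length xs \<odot>\<^bsub>bichain_space sc R\<^esub>
               bichain_tensor sc R a (tensor_word sc (butlast xs))
                 (e_A sc R (last xs) \<otimes>\<^bsub>quadratic_algebra sc R\<^esub> a'))))"

definition koszul ::
    "('k::field \<Rightarrow> 'v::ab_group_add \<Rightarrow> 'v) \<Rightarrow> ('k, 'v) tens set \<Rightarrow> bool" where
  "koszul sc R \<longleftrightarrow> (\<forall>p>0. linearly_isomorphic
     (homology (bimodule_complex sc R) (\<lambda>_. bimodule_d sc R) p) (zero_space :: ('k, 'k) module))"

end

theory Submission
  imports Defs
begin

text \<open>For a scalar \<open>\<lambda>\<close>, twist the differential of \<open>A \<otimes> W\<close> by the automorphism of \<open>A\<close> that scales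
  weight \<open>n\<close> by \<open>\<lambda>\<^sup>n\<close>: this is \<open>b\<^sub>K\<close> plus \<open>\<lambda> - 1\<close> times minus the cap product with \<open>e\<^sub>A\<close>. Closing up
  the bimodule complex \<open>K(A) \<otimes>\<^sub>A K(A)\<close> gives a cyclic complex \<open>A \<otimes> W \<otimes> A \<otimes> W\<close> with two projections onto
  \<open>A \<otimes> W\<close>, both split by the coproduct of \<open>W\<close>. If \<open>A\<close> is Koszul, both are quasi-isomorphisms, so
  they induce the same map on homology; as a rotation exchanges them and its square is \<open>\<lambda>\<^sup>n\<close> in weight
  \<open>n\<close>, the twisted homology is killed by \<open>\<lambda>\<^sup>n - 1\<close>. Over the dual numbers \<open>\<lambda> = 1 + t\<close> this says that a cycle
  \<open>z\<close> whose class is killed by \<open>\<partial>\<^sub>\<frown>\<close> satisfies \<open>n z = b u + e v\<close> with \<open>b v = 0\<close>, and in characteristic 0 we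
  divide by \<open>n\<close>. In degree 0 the sum of all rotations of a word gives such \<open>u\<close> and \<open>v\<close> without
  Koszulness. All computations are made with words in a basis of \<open>V\<close>.\<close>

section \<open>Finitely supported functions as vector spaces\<close>

text \<open>Only the first-order part of the twist matters, hence dual numbers. If e z = b y, then z
  - t y is a cycle for b + t e; since \<lambda>^n - 1 = n t kills homology, n t z is the boundary of
  some v + t u, and comparing coefficients gives b v = 0 and n z = b u + e v. No type of dual
  numbers appears: an operator over them is a pair of operators over k, and an identity is read off
  from its t-coefficient. Rotation and identity, applied after the coproduct, agree under the first
  projection; Koszulness serves to make their difference a boundary. Filtering by the length of the
  last word reduces this to lifting along the bimodule differential. The obstacle is that all spaces
  are given as cosets of cosets. They are replaced by finitely supported functions on words, and
  equality in a quotient by equality after an idempotent normal form map. The compatibility of the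
  projection, the coproduct and the rotation with the differentials then holds exactly; the
  relations enter when the differentials are squared.\<close>

abbreviation (input) keys :: "('a \<Rightarrow>\<^sub>0 'b::zero) \<Rightarrow> 'a set" where
  "keys \<equiv> Poly_Mapping.keys"

abbreviation (input) single :: "'a \<Rightarrow> 'b \<Rightarrow> ('a \<Rightarrow>\<^sub>0 'b::zero)" where
  "single \<equiv> Poly_Mapping.single"

abbreviation (input) lookup :: "('a \<Rightarrow>\<^sub>0 'b::zero) \<Rightarrow> 'a \<Rightarrow> 'b" where
  "lookup \<equiv> Poly_Mapping.lookup"

text \<open>The scalar multiplication of \<open>free_space\<close> as a constant of its own, so that
  the type-based theory of vector spaces can be instantiated with it.\<close>

definition scl :: "'k::field \<Rightarrow> ('a \<Rightarrow>\<^sub>0 'k) \<Rightarrow> ('a \<Rightarrow>\<^sub>0 'k)" where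
  "scl c = Poly_Mapping.map ((*) c)"

lemma lookup_scl [simp]: "lookup (scl c p) x = c * lookup p x"
  by (simp add: scl_def Poly_Mapping.map.rep_eq when_def)

interpretation pm: vector_space "scl :: 'k::field \<Rightarrow> ('a \<Rightarrow>\<^sub>0 'k) \<Rightarrow> _"
  by unfold_locales (auto intro!: poly_mapping_eqI simp: lookup_add algebra_simps)

interpretation pmp: vector_space_pair
    "scl :: 'k::field \<Rightarrow> ('a \<Rightarrow>\<^sub>0 'k) \<Rightarrow> _" "scl :: 'k::field \<Rightarrow> ('b \<Rightarrow>\<^sub>0 'k) \<Rightarrow> _"
  by unfold_locales

abbreviation plin :: "(('a \<Rightarrow>\<^sub>0 'k::field) \<Rightarrow> ('b \<Rightarrow>\<^sub>0 'k)) \<Rightarrow> bool" where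
  "plin f \<equiv> Vector_Spaces.linear scl scl f"

lemma plinI:
  assumes "\<And>p q. f (p + q) = f p + f q" "\<And>c p. f (scl c p) = scl c (f p)"
  shows "plin f"
  using assms by unfold_locales auto

lemma
  assumes "plin f"
  shows plin_add: "f (p + q) = f p + f q"
    and plin_scl: "f (scl c p) = scl c (f p)"
    and plin_zero: "f 0 = 0"
    and plin_diff: "f (p - q) = f p - f q"
    and plin_uminus: "f (- p) = - f p"
    and plin_sum: "f (sum h S) = (\<Sum>s\<in>S. f (h s))"
proof -
  interpret Vector_Spaces.linear scl scl f by fact
  show "f (p + q) = f p + f q" "f (scl c p) = scl c (f p)" "f 0 = 0" "f (p - q) = f p - f q"
    "f (- p) = - f p" "f (sum h S) = (\<Sum>s\<in>S. f (h s))"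
    by (rule add scale zero diff neg sum)+
qed

lemma plin_comp: "plin f \<Longrightarrow> plin g \<Longrightarrow> plin (\<lambda>p. g (f p))"
  by (rule plinI) (simp_all add: plin_add plin_scl)

lemma plin_plus: "plin f \<Longrightarrow> plin g \<Longrightarrow> plin (\<lambda>p. f p + g p)"
  by (rule plinI) (simp_all add: plin_add plin_scl pm.scale_right_distrib)

lemma plin_minus: "plin f \<Longrightarrow> plin g \<Longrightarrow> plin (\<lambda>p. f p - g p)"
  by (rule plinI) (simp_all add: plin_add plin_scl pm.scale_right_diff_distrib)

lemma plin_scl_fun: "plin f \<Longrightarrow> plin (\<lambda>p. scl c (f p))"
  by (rule plinI) (simp_all add: plin_add plin_scl pm.scale_right_distrib mult.commute)

lemma plin_ident: "plin (\<lambda>p. p)"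
  by (rule plinI) simp_all

lemma scl_single [simp]: "scl c (single x d) = single x (c * d)"
  by (rule poly_mapping_eqI) (simp add: lookup_single when_def)

lemma keys_scl: "keys (scl c p) \<subseteq> keys p"
  by (auto simp: in_keys_iff)

abbreviation (input) delta :: "'a \<Rightarrow> ('a \<Rightarrow>\<^sub>0 'k::field)" where
  "delta x \<equiv> single x 1"

text \<open>Linear extension from the basis of keys. The operators on words are given in this form,
  so that identities between them reduce to single words.\<close>

definition lin :: "('a \<Rightarrow> 'b \<Rightarrow>\<^sub>0 'k) \<Rightarrow> ('a \<Rightarrow>\<^sub>0 'k::field) \<Rightarrow> ('b \<Rightarrow>\<^sub>0 'k)" where
  "lin g p = (\<Sum>x\<in>keys p. scl (lookup p x) (g x))"

lemma lin_superset:
  assumes "finite S" "keys p \<subseteq> S"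
  shows "lin g p = (\<Sum>x\<in>S. scl (lookup p x) (g x))"
  unfolding lin_def using assms
  by (intro sum.mono_neutral_left) (auto simp: in_keys_iff)

lemma plin_lin:
  fixes g :: "'a \<Rightarrow> 'b \<Rightarrow>\<^sub>0 'k::field"
  shows "plin (lin g)"
proof (rule plinI)
  fix p q :: "'a \<Rightarrow>\<^sub>0 'k"
  let ?S = "keys p \<union> keys q"
  have "keys (p + q) \<subseteq> ?S" by (rule keys_add)
  then show "lin g (p + q) = lin g p + lin g q"
    by (simp add: lin_superset[of ?S] lookup_add pm.scale_left_distrib sum.distrib)
next
  fix c and p :: "'a \<Rightarrow>\<^sub>0 'k"
  show "lin g (scl c p) = scl c (lin g p)"
    by (simp add: lin_superset[OF finite_keys keys_scl, of g c p]
        lin_superset[OF finite_keys subset_refl, of g p] pm.scale_sum_right)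
qed

lemmas lin_add = plin_add[OF plin_lin] and lin_scl = plin_scl[OF plin_lin]
  and lin_zero [simp] = plin_zero[OF plin_lin] and lin_diff = plin_diff[OF plin_lin]
  and lin_uminus = plin_uminus[OF plin_lin] and lin_sum = plin_sum[OF plin_lin]

lemma lin_single [simp]: "lin g (single x c) = scl c (g x)"
  by (simp add: lin_superset[of "{x}"])

lemma plin_lin_eq: "plin f \<Longrightarrow> f (lin g p) = lin (\<lambda>x. f (g x)) p"
  by (simp add: lin_def plin_sum plin_scl)

lemmas lin_lin = plin_lin_eq[OF plin_lin]

lemma lin_cong: "(\<And>x. x \<in> keys p \<Longrightarrow> g x = h x) \<Longrightarrow> lin g p = lin h p"
  by (simp add: lin_def)

lemma lin_delta [simp]: "lin delta p = p"
proof (rule poly_mapping_eqI)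
  fix k
  have "lookup (lin delta p) k = (\<Sum>x\<in>keys p. if x = k then lookup p x else 0)"
    by (simp add: lin_def lookup_sum lookup_single when_def)
  also have "\<dots> = lookup p k" by (auto simp: in_keys_iff)
  finally show "lookup (lin delta p) k = lookup p k" .
qed

lemma lin_scl_fun: "lin (\<lambda>x. scl c (g x)) p = scl c (lin g p)"
  by (simp add: lin_def pm.scale_sum_right mult.commute)

lemma plin_eq_lin: "plin f \<Longrightarrow> f p = lin (\<lambda>x. f (delta x)) p"
  by (metis lin_delta plin_lin_eq)

lemma plin_eqI:
  assumes "plin f" "plin g" "\<And>x. x \<in> keys p \<Longrightarrow> f (delta x) = g (delta x)"
  shows "f p = g p"
  using assms by (metis (mono_tags, lifting) lin_cong plin_eq_lin)

lemma lin_eqI: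
  assumes "plin f" "\<And>x. x \<in> keys p \<Longrightarrow> f (delta x) = g x"
  shows "f p = lin g p"
  using assms by (metis (mono_tags, lifting) lin_cong plin_eq_lin)

lemma subspace_plin_vimage: "plin f \<Longrightarrow> pm.subspace S \<Longrightarrow> pm.subspace {p. f p \<in> S}"
  by (auto simp: pm.subspace_def plin_zero plin_add plin_scl)

lemma plin_span_subset:
  assumes "plin f" "p \<in> pm.span G" "\<And>g. g \<in> G \<Longrightarrow> f g \<in> pm.span H"
  shows "f p \<in> pm.span H"
proof -
  have "pm.span G \<subseteq> {p. f p \<in> pm.span H}"
    using assms by (intro pm.span_minimal subspace_plin_vimage) auto
  then show ?thesis using assms by auto
qed

lemma plin_span_eqI:
  assumes "plin f" "plin g" "p \<in> pm.span G" "\<And>x. x \<in> G \<Longrightarrow> f x = g x"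
  shows "f p = g p"
  using pmp.linear_eq_on assms by blast

lemma lin_in_subspace:
  assumes "pm.subspace S" "\<And>x. x \<in> keys p \<Longrightarrow> g x \<in> S"
  shows "lin g p \<in> S"
  unfolding lin_def using assms by (intro pm.subspace_sum pm.subspace_scale) auto

lemma subspace_keys: "pm.subspace {p. keys p \<subseteq> S}"
proof (rule pm.subspaceI)
  show "p + q \<in> {p. keys p \<subseteq> S}" if "p \<in> {p. keys p \<subseteq> S}" "q \<in> {p. keys p \<subseteq> S}" for p q
    using keys_add[of p q] that by auto
  show "scl c p \<in> {p. keys p \<subseteq> S}" if "p \<in> {p. keys p \<subseteq> S}" for c p
    using keys_scl[of c p] that by auto
qed auto

lemma keys_lin: "keys (lin g p) \<subseteq> (\<Union>x\<in>keys p. keys (g x))"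
proof -
  have "lin g p \<in> {q. keys q \<subseteq> (\<Union>x\<in>keys p. keys (g x))}"
    by (rule lin_in_subspace[OF subspace_keys]) auto
  then show ?thesis by simp
qed

text \<open>A linear right inverse of the identity on \<open>S\<close> is a projection onto
  \<open>S\<close>. Both the normal form of A and the intersection of tensor subspaces rest on this
  choice.\<close>

lemma obtain_linear_projection:
  assumes "pm.subspace (S :: ('a \<Rightarrow>\<^sub>0 'k::field) set)"
  obtains f where "plin f" "\<And>p. f p \<in> S" "\<And>p. p \<in> S \<Longrightarrow> f p = p"
proof -
  have "\<exists>g. g ` UNIV \<subseteq> S \<and> plin g \<and> (\<forall>v\<in>(\<lambda>x. x) ` S. g v = v)"
    using pmp.linear_exists_right_inverse_on[OF pm.linear_ident assms] .
  then show ?thesis using that by (metis image_ident range_subsetD)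
qed

section \<open>Tensors of finitely supported functions\<close>

definition tens :: "('a \<Rightarrow>\<^sub>0 'k::field) \<Rightarrow> ('b \<Rightarrow>\<^sub>0 'k) \<Rightarrow> ('a \<times> 'b \<Rightarrow>\<^sub>0 'k)" where
  "tens p q = lin (\<lambda>x. lin (\<lambda>y. delta (x, y)) q) p"

lemma lookup_tens: "lookup (tens p q) (x, y) = lookup p x * lookup q y"
proof -
  have q: "lin (\<lambda>y. delta (u, y)) q = (\<Sum>v\<in>keys q. single (u, v) (lookup q v))" for u
    by (simp add: lin_def)
  have *: "lookup (lin (\<lambda>y. delta (u, y)) q) (x, y) = (if u = x then lookup q y else 0)" for u
    unfolding q by (auto simp: lookup_sum lookup_single when_def in_keys_iff cong: if_cong)
  show ?thesis
    unfolding tens_def lin_def[of _ p]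
    by (auto simp: lookup_sum * in_keys_iff if_distrib[of "\<lambda>z. _ * z"] cong: if_cong)
qed

lemma tens_single [simp]:
  "tens (single x c) (single y d) = single (x, y) (c * d)"
  by (simp add: tens_def)

lemma tens_add_left: "tens (p + q) r = tens p r + tens q r"
  and tens_add_right: "tens r (p + q) = tens r p + tens r q"
  and tens_scl_left: "tens (scl c p) r = scl c (tens p r)"
  and tens_scl_right: "tens r (scl c p) = scl c (tens r p)"
  by (auto intro!: poly_mapping_eqI simp: lookup_tens lookup_add lookup_minus algebra_simps)

lemma plin_tens_left: "plin (\<lambda>p. tens p q)"
  and plin_tens_right: "plin (\<lambda>p. tens q p)"
  by (rule plinI; simp add: tens_add_left tens_add_right tens_scl_left tens_scl_right)+

lemmas tens_zero_left [simp] = plin_zero[OF plin_tens_left]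
  and tens_zero_right [simp] = plin_zero[OF plin_tens_right]

lemma keys_tens: "keys (tens p q) \<subseteq> keys p \<times> keys q"
  by (auto simp: in_keys_iff lookup_tens)

text \<open>The tensor product of two linear maps. Only values on basis elements enter, which is why
  \<open>tmap_tens\<close> asks for linear \<open>f\<close> and \<open>g\<close>.\<close>

definition tmap :: "(('a \<Rightarrow>\<^sub>0 'k::field) \<Rightarrow> ('c \<Rightarrow>\<^sub>0 'k)) \<Rightarrow> (('b \<Rightarrow>\<^sub>0 'k) \<Rightarrow> ('d \<Rightarrow>\<^sub>0 'k))
    \<Rightarrow> ('a \<times> 'b \<Rightarrow>\<^sub>0 'k) \<Rightarrow> ('c \<times> 'd \<Rightarrow>\<^sub>0 'k)" where
  "tmap f g = lin (\<lambda>(x, y). tens (f (delta x)) (g (delta y)))"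

lemma plin_tmap: "plin (tmap f g)"
  unfolding tmap_def by (rule plin_lin)

lemma tmap_single [simp]:
  "tmap f g (single (x, y) c) = scl c (tens (f (delta x)) (g (delta y)))"
  by (simp add: tmap_def)

lemma bilinear_eqI:
  assumes "\<And>q. plin (\<lambda>p. f p q)" "\<And>p. plin (\<lambda>q. f p q)" "\<And>q. plin (\<lambda>p. g p q)" "\<And>p. plin (\<lambda>q. g p q)"
    and "\<And>x y. x \<in> keys p \<Longrightarrow> y \<in> keys q \<Longrightarrow> f (delta x) (delta y) = g (delta x) (delta y)"
  shows "f p q = g p q"
  by (rule plin_eqI[where f = "\<lambda>p. f p q" and g = "\<lambda>p. g p q", OF assms(1,3)],
      rule plin_eqI[where f = "\<lambda>q. f _ q", OF assms(2,4)], rule assms(5))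

lemma tmap_tens: "plin f \<Longrightarrow> plin g \<Longrightarrow> tmap f g (tens p q) = tens (f p) (g q)"
  by (rule bilinear_eqI[where f = "\<lambda>p q. tmap f g (tens p q)" and g = "\<lambda>p q. tens (f p) (g q)"])
    (auto intro: plin_comp[OF plin_tens_left plin_tmap] plin_comp[OF plin_tens_right plin_tmap]
       plin_comp[OF _ plin_tens_left] plin_comp[OF _ plin_tens_right])

lemma tmap_comp:
  assumes "plin f" "plin g" "plin f'" "plin g'"
  shows "tmap f g (tmap f' g' p) = tmap (\<lambda>p. f (f' p)) (\<lambda>p. g (g' p)) p"
  by (rule plin_eqI[OF plin_comp[OF plin_tmap plin_tmap] plin_tmap])
    (auto simp: tmap_tens assms)

text \<open>A tensor is read as a matrix: \<open>row x\<close> and \<open>col y\<close> contract one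
  factor with a coordinate functional.\<close>

definition row :: "'a \<Rightarrow> ('a \<times> 'b \<Rightarrow>\<^sub>0 'k::field) \<Rightarrow> ('b \<Rightarrow>\<^sub>0 'k)" where
  "row x = lin (\<lambda>(u, v). if u = x then delta v else 0)"

definition col :: "'b \<Rightarrow> ('a \<times> 'b \<Rightarrow>\<^sub>0 'k::field) \<Rightarrow> ('a \<Rightarrow>\<^sub>0 'k)" where
  "col y = lin (\<lambda>(u, v). if v = y then delta u else 0)"

lemma plin_row: "plin (row x)" and plin_col: "plin (col y)"
  unfolding row_def col_def by (rule plin_lin)+

lemma row_single [simp]: "row x (single (u, v) c) = (if u = x then single v c else 0)"
  and col_single [simp]: "col y (single (u, v) c) = (if v = y then single u c else 0)"
  by (simp_all add: row_def col_def)

lemmas plin_intros = plin_ident plin_plus plin_minus plin_scl_fun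
  plin_comp[OF _ plin_lin] plin_comp[OF _ plin_tens_left] plin_comp[OF _ plin_tens_right]
  plin_comp[OF _ plin_tmap] plin_comp[OF _ plin_row] plin_comp[OF _ plin_col]

lemma plin_scl_lookup: "plin (\<lambda>p. scl (lookup p x) q)"
  by (rule plinI) (simp_all add: lookup_add pm.scale_left_distrib)

lemma row_tens:
  fixes q :: "'b \<Rightarrow>\<^sub>0 'c::field"
  shows "row x (tens p q) = scl (lookup p x) q"
proof (rule bilinear_eqI[where f = "\<lambda>p q. row x (tens p q)" and g = "\<lambda>p q. scl (lookup p x) q"])
  show "row x (tens (delta u) (delta v)) = scl (lookup (delta u) x) (delta v :: 'b \<Rightarrow>\<^sub>0 'c)" for u v
    by (simp add: lookup_single when_def)
qed (intro plin_intros plin_scl_lookup)+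

lemma col_tens:
  fixes p :: "'a \<Rightarrow>\<^sub>0 'c::field"
  shows "col y (tens p q) = scl (lookup q y) p"
proof (rule bilinear_eqI[where f = "\<lambda>p q. col y (tens p q)" and g = "\<lambda>p q. scl (lookup q y) p"])
  show "col y (tens (delta u) (delta v)) = scl (lookup (delta v) y) (delta u :: 'a \<Rightarrow>\<^sub>0 'c)" for u v
    by (simp add: lookup_single when_def)
qed (intro plin_intros plin_scl_lookup)+

lemma row_tmap:  "plin g \<Longrightarrow> row x (tmap (\<lambda>p. p) g m) = g (row x m)"
  by (rule plin_eqI[OF plin_comp[OF plin_tmap plin_row] plin_comp[OF plin_row]])
    (auto simp: row_tens lookup_single when_def plin_zero)

lemma col_tmap: "plin f \<Longrightarrow> col y (tmap f (\<lambda>p. p) m) = f (col y m)"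
  by (rule plin_eqI[OF plin_comp[OF plin_tmap plin_col] plin_comp[OF plin_col]])
    (auto simp: col_tens lookup_single when_def plin_zero)

lemma sum_tens_col:
  assumes "finite S" "snd ` keys m \<subseteq> S"
  shows "m = (\<Sum>y\<in>S. tens (col y m) (delta y))"
proof (rule plin_eqI[where f = "\<lambda>m. m" and g = "\<lambda>m. \<Sum>y\<in>S. tens (col y m) (delta y)"])
  show "plin (\<lambda>m. \<Sum>y\<in>S. tens (col y m) (delta y))"
    by (intro pmp.linear_compose_sum ballI plin_comp[OF plin_col plin_tens_left])
  fix k assume "k \<in> keys m"
  then have "snd k \<in> S" using assms by auto
  then show "delta k = (\<Sum>y\<in>S. tens (col y (delta k)) (delta y))"
    using assms(1) by (cases k) (simp add: if_distrib[of "\<lambda>p. tens p _"] cong: if_cong)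
qed (rule plin_ident)

lemma sum_tens_row:
  assumes "finite S" "fst ` keys m \<subseteq> S"
  shows "m = (\<Sum>x\<in>S. tens (delta x) (row x m))"
proof (rule plin_eqI[where f = "\<lambda>m. m" and g = "\<lambda>m. \<Sum>x\<in>S. tens (delta x) (row x m)"])
  show "plin (\<lambda>m. \<Sum>x\<in>S. tens (delta x) (row x m))"
    by (intro pmp.linear_compose_sum ballI plin_comp[OF plin_row plin_tens_right])
  fix k assume "k \<in> keys m"
  then have "fst k \<in> S" using assms by auto
  then show "delta k = (\<Sum>x\<in>S. tens (delta x) (row x (delta k)))"
    using assms(1) by (cases k) (simp add: if_distrib[of "\<lambda>p. tens _ p"] cong: if_cong)
qed (rule plin_ident)

text \<open>Over a field, \<open>(U \<otimes> G) \<inter> (F \<otimes> U') = U \<otimes> U'\<close>: apply projections onto \<open>U\<close> and \<open>U'\<close>.\<close>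

lemma in_span_tens:
  assumes "pm.subspace U" "pm.subspace U'" "\<And>y. col y m \<in> U" "\<And>x. row x m \<in> U'"
  shows "m \<in> pm.span {tens p q | p q. p \<in> U \<and> q \<in> U'}"
proof -
  obtain f where f: "plin f" "\<And>p. f p \<in> U" "\<And>p. p \<in> U \<Longrightarrow> f p = p"
    using obtain_linear_projection[OF assms(1)] by blast
  obtain g where g: "plin g" "\<And>p. g p \<in> U'" "\<And>p. p \<in> U' \<Longrightarrow> g p = p"
    using obtain_linear_projection[OF assms(2)] by blast
  let ?S = "snd ` (keys m \<union> keys (tmap f (\<lambda>p. p) m))"
  have "tmap f (\<lambda>p. p) m = (\<Sum>y\<in>?S. tens (col y (tmap f (\<lambda>p. p) m)) (delta y))"
    by (rule sum_tens_col) auto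
  also have "\<dots> = (\<Sum>y\<in>?S. tens (col y m) (delta y))"
    by (simp add: col_tmap f assms)
  also have "\<dots> = m"
    by (rule sum_tens_col[symmetric]) auto
  finally have m1: "tmap f (\<lambda>p. p) m = m" .
  let ?S = "fst ` (keys m \<union> keys (tmap (\<lambda>p. p) g m))"
  have "tmap (\<lambda>p. p) g m = (\<Sum>x\<in>?S. tens (delta x) (row x (tmap (\<lambda>p. p) g m)))"
    by (rule sum_tens_row) auto
  also have "\<dots> = (\<Sum>x\<in>?S. tens (delta x) (row x m))"
    by (simp add: row_tmap g assms)
  also have "\<dots> = m"
    by (rule sum_tens_row[symmetric]) auto
  finally have m2: "tmap (\<lambda>p. p) g m = m" .
  have "m = tmap f g m"
    using tmap_comp[OF f(1) plin_ident plin_ident g(1), of m] by (simp add: m1 m2)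
  also have "\<dots> \<in> pm.span {tens p q | p q. p \<in> U \<and> q \<in> U'}"
    unfolding tmap_def using f(2) g(2)
    by (intro lin_in_subspace pm.subspace_span) (auto intro!: pm.span_base)
  finally show ?thesis .
qed

section \<open>Concatenation of words\<close>

definition mul :: "('v list \<Rightarrow>\<^sub>0 'k::field) \<Rightarrow> ('v list \<Rightarrow>\<^sub>0 'k) \<Rightarrow> ('v list \<Rightarrow>\<^sub>0 'k)" where
  "mul p q = lin (\<lambda>(u, v). delta (u @ v)) (tens p q)"

lemma mul_single [simp]:
  "mul (single u c) (single v d) = single (u @ v) (c * d)"
  by (simp add: mul_def)

lemma plin_mul_left: "plin (\<lambda>p. mul p q)" and plin_mul_right: "plin (\<lambda>p. mul q p)"
  unfolding mul_def by (intro plin_intros)+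

lemmas plin_intros2 = plin_intros plin_comp[OF _ plin_mul_left] plin_comp[OF _ plin_mul_right]

lemma mul_lin_left: "mul (lin g p) q = lin (\<lambda>x. mul (g x) q) p"
  and mul_lin_right: "mul q (lin g p) = lin (\<lambda>x. mul q (g x)) p"
  using plin_lin_eq[OF plin_mul_left] plin_lin_eq[OF plin_mul_right] by fast+

lemma mul_Nil_left [simp]: "mul (delta []) p = p"
  by (rule plin_eqI[where g = "\<lambda>p. p"], (intro plin_intros2)+) simp

lemma mul_Nil_right [simp]: "mul p (delta []) = p"
  by (rule plin_eqI[where g = "\<lambda>p. p"], (intro plin_intros2)+) simp

lemma mul_assoc: "mul (mul p q) r = mul p (mul q r)"
proof (rule plin_eqI[where f = "\<lambda>p. mul (mul p q) r"])
  show "mul (mul (delta x) q) r = mul (delta x) (mul q r)" for x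
    by (rule bilinear_eqI[where f = "\<lambda>q r. mul (mul (delta x) q) r"
          and g = "\<lambda>q r. mul (delta x) (mul q r)"], (intro plin_intros2)+) simp
qed (intro plin_intros2)+

lemma keys_mul:
  fixes p :: "'v list \<Rightarrow>\<^sub>0 'k::field"
  shows "keys (mul p q) \<subseteq> {u @ v | u v. u \<in> keys p \<and> v \<in> keys q}"
proof -
  have "keys (mul p q) \<subseteq> (\<Union>x\<in>keys (tens p q). keys ((case x of (u, v) \<Rightarrow> delta (u @ v)) :: 'v list \<Rightarrow>\<^sub>0 'k))"
    unfolding mul_def by (rule keys_lin)
  also have "\<dots> \<subseteq> {u @ v | u v. u \<in> keys p \<and> v \<in> keys q}"
    using keys_tens[of p q] by (fastforce split: if_splits)
  finally show ?thesis .
qed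

definition words :: "'v set \<Rightarrow> nat \<Rightarrow> 'v list set" where
  "words E n = {xs. set xs \<subseteq> E \<and> length xs = n}"

text \<open>For a basis \<open>E\<close> of V this models the n-th tensor power of V, and
  \<open>FL E\<close> models the tensor algebra, both with unique coordinates.\<close>

definition FE :: "'v set \<Rightarrow> nat \<Rightarrow> ('v list \<Rightarrow>\<^sub>0 'k::field) set" where
  "FE E n = {p. keys p \<subseteq> words E n}"

definition FL :: "'v set \<Rightarrow> ('v list \<Rightarrow>\<^sub>0 'k::field) set" where
  "FL E = {p. keys p \<subseteq> lists E}"

lemma subspace_FE: "pm.subspace (FE E n)" and subspace_FL: "pm.subspace (FL E)"
  unfolding FE_def FL_def by (rule subspace_keys)+

lemma FE_subset_FL: "FE E n \<subseteq> FL E"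
  by (auto simp: FE_def FL_def words_def)

lemma delta_FE: "delta xs \<in> FE E n \<longleftrightarrow> set xs \<subseteq> E \<and> length xs = n"
  by (auto simp: FE_def words_def)

lemma delta_FL: "delta xs \<in> FL E \<longleftrightarrow> set xs \<subseteq> E"
  by (auto simp: FL_def)

lemma mul_FE: "p \<in> FE E m \<Longrightarrow> q \<in> FE E n \<Longrightarrow> mul p q \<in> FE E (m + n)"
  using keys_mul[of p q] by (fastforce simp: FE_def words_def)

lemma mul_FL: "p \<in> FL E \<Longrightarrow> q \<in> FL E \<Longrightarrow> mul p q \<in> FL E"
  using keys_mul[of p q] by (fastforce simp: FL_def)

text \<open>The coefficient of \<open>u\<close> on the left and \<open>v\<close> on the right: outer
  letters are contracted with the coordinate functionals of \<open>u\<close> and \<open>v\<close>.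
  The map on words is injective, as \<open>map_key\<close> requires.\<close>

definition sl :: "'v list \<Rightarrow> 'v list \<Rightarrow> ('v list \<Rightarrow>\<^sub>0 'k::field) \<Rightarrow> ('v list \<Rightarrow>\<^sub>0 'k)" where
  "sl u v p = Poly_Mapping.map_key (\<lambda>y. u @ y @ v) p"

lemma lookup_sl [simp]: "lookup (sl u v p) y = lookup p (u @ y @ v)"
  by (simp add: sl_def map_key.rep_eq inj_def)

lemma plin_sl: "plin (sl u v)"
  by (rule plinI) (auto intro!: poly_mapping_eqI simp: lookup_add)

lemma sl_sl: "sl u' v' (sl u v p) = sl (u @ u') (v' @ v) p"
  by (rule poly_mapping_eqI) simp

lemma keys_sl: "keys (sl u v p) = {y. u @ y @ v \<in> keys p}"
  by (auto simp: in_keys_iff)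

lemma sl_FE:
  assumes "p \<in> FE E (length u + n + length v)"
  shows "sl u v p \<in> FE E n"
proof -
  have "y \<in> words E n" if "u @ y @ v \<in> keys p" for y
    using subsetD[OF assms[unfolded FE_def, THEN CollectD] that] by (simp add: words_def)
  then show ?thesis by (auto simp: FE_def keys_sl)
qed

lemma sl_mul_mul:
  assumes "q \<in> FE E n" "length u = length u'" "length v = length v'"
  shows "sl u v (mul (delta u') (mul q (delta v'))) = (if u = u' \<and> v = v' then q else 0)"
proof -
  have "lookup (mul (delta u') (mul q (delta v'))) (u @ y @ v) =
      lookup (if u = u' \<and> v = v' then q else 0) y" for y
  proof -
    have "mul (delta u') (mul q (delta v')) = lin (\<lambda>x. delta (u' @ x @ v')) q"
      by (rule lin_eqI, intro plin_intros2) simp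
    then have "lookup (mul (delta u') (mul q (delta v'))) (u @ y @ v) =
        (\<Sum>x\<in>keys q. if u' @ x @ v' = u @ y @ v then lookup q x else 0)"
      by (simp add: lin_def lookup_sum lookup_single when_def)
    also have "\<dots> = (\<Sum>x\<in>keys q. if u = u' \<and> v = v' \<and> x = y then lookup q x else 0)"
      using assms(2,3) by (intro sum.cong) (auto simp: append_eq_append_conv)
    also have "\<dots> = lookup (if u = u' \<and> v = v' then q else 0) y"
      by (auto simp: in_keys_iff)
    finally show ?thesis .
  qed
  then show ?thesis by (intro poly_mapping_eqI) simp
qed

text \<open>The words of \<open>w\<close> are grouped by their outer letters; the group with prefix
  \<open>u\<close> and suffix \<open>v\<close> is the slice \<open>sl u v w\<close> with
  \<open>u\<close> and \<open>v\<close> put back.\<close>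

lemma in_span_sl:
  assumes "w \<in> FE E (i + n + j)"
  shows "w \<in> pm.span {mul (delta u) (mul (sl u v w) (delta v)) | u v. u \<in> words E i \<and> v \<in> words E j}"
proof -
  \<comment> \<open>Summing only over the prefix-suffix pairs that occur in \<open>w\<close> keeps
    the sum finite.\<close>
  define c where "c = (\<lambda>xs :: 'a list. (take i xs, drop (i + n) xs))"
  have len: "length xs = i + n + j" "set xs \<subseteq> E" if "xs \<in> keys w" for xs
    using assms that by (auto simp: FE_def words_def)
  have "w = (\<Sum>(u, v)\<in>c ` keys w. mul (delta u) (mul (sl u v w) (delta v)))"
  proof (rule plin_eqI[where f = "\<lambda>w. w"
        and g = "\<lambda>p. \<Sum>(u, v)\<in>c ` keys w. mul (delta u) (mul (sl u v p) (delta v))", OF plin_ident])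
    show "plin (\<lambda>p. \<Sum>(u, v)\<in>c ` keys w. mul (delta u) (mul (sl u v p) (delta v)))"
      unfolding case_prod_beta
      by (intro pmp.linear_compose_sum ballI plin_intros2 plin_comp[OF plin_sl plin_mul_left] plin_comp[OF _ plin_mul_right])
    fix xs assume xs: "xs \<in> keys w"
    have "mul (delta u) (mul (sl u v (delta xs)) (delta v)) = (if (u, v) = c xs then delta xs else (0 :: 'a list \<Rightarrow>\<^sub>0 'b))"
      if "(u, v) \<in> c ` keys w" for u v
    proof -
      have uv: "length u = i" "length v = j" using that len by (auto simp: c_def)
      define r where "r = take i xs"
      define m where "m = take n (drop i xs)"
      define t where "t = drop (i + n) xs"
      have xs_eq: "xs = r @ m @ t"
        unfolding r_def m_def t_def by (metis append_take_drop_id drop_drop add.commute)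
      have m: "delta m \<in> FE E n" and rt: "length r = i" "length t = j"
        using len[OF xs] set_take_subset[of n "drop i xs"] set_drop_subset[of i xs]
        by (auto simp: delta_FE r_def m_def t_def)
      have c: "c xs = (r, t)" by (simp add: c_def r_def t_def)
      have "sl u v (delta xs) = (if (u, v) = (r, t) then delta m else (0 :: 'a list \<Rightarrow>\<^sub>0 'b))"
        using sl_mul_mul[OF m, of u r v t] uv rt by (simp add: xs_eq)
      then show ?thesis
        by (simp add: c) (simp add: xs_eq plin_zero[OF plin_mul_left] plin_zero[OF plin_mul_right])
    qed
    then have "(\<Sum>(u, v)\<in>c ` keys w. mul (delta u) (mul (sl u v (delta xs)) (delta v)))
        = (\<Sum>d\<in>c ` keys w. if d = c xs then delta xs else (0 :: 'a list \<Rightarrow>\<^sub>0 'b))"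
      by (intro sum.cong refl) (simp only: case_prod_beta prod.collapse)
    also have "\<dots> = delta xs" using xs by simp
    finally show "delta xs = (\<Sum>(u, v)\<in>c ` keys w. mul (delta u) (mul (sl u v (delta xs)) (delta v :: 'a list \<Rightarrow>\<^sub>0 'b)))" ..
  qed
  also have "\<dots> \<in> pm.span {mul (delta u) (mul (sl u v w) (delta v)) | u v. u \<in> words E i \<and> v \<in> words E j}"
    using len set_take_subset set_drop_subset
    by (intro pm.span_sum) (fastforce simp: c_def words_def intro!: pm.span_base)
  finally show ?thesis .
qed

section \<open>The cyclic complexes\<close>

text \<open>A key lists the words in consecutive tensor factors: \<open>(u, xs)\<close> in \<open>A \<otimes> W\<close>, \<open>((u, xs), v)\<close> in
  \<open>A \<otimes> W \<otimes> A\<close> and \<open>(((u, xs), v), ys)\<close> in \<open>A \<otimes> W \<otimes> A \<otimes> W\<close>, the last one closed up to a cycle. Here \<open>A\<close> is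
  still replaced by the tensor algebra, so that the differentials square to zero only up to relations.
  The operators \<open>bX\<close> and \<open>eX\<close> are \<open>b\<^sub>K\<close> and minus the cap product with \<open>e\<^sub>A\<close>, and \<open>De\<close> is the coproduct.
  The second projection \<open>A \<otimes> W \<otimes> A \<otimes> W \<rightarrow> A \<otimes> W\<close> is \<open>f1\<close> after the rotation.\<close>

type_synonym 'v key2 = "'v list \<times> 'v list"
type_synonym 'v key3 = "'v key2 \<times> 'v list"
type_synonym 'v key4 = "'v key3 \<times> 'v list"

definition dl :: "('v key2 \<Rightarrow>\<^sub>0 'k::field) \<Rightarrow> ('v key2 \<Rightarrow>\<^sub>0 'k)" where
  "dl = lin (\<lambda>(u, xs). if xs = [] then 0 else delta (u @ [hd xs], tl xs))"

definition eX :: "('v key2 \<Rightarrow>\<^sub>0 'k::field) \<Rightarrow> ('v key2 \<Rightarrow>\<^sub>0 'k)" where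
  "eX = lin (\<lambda>(u, xs). if xs = [] then 0
     else single (last xs # u, butlast xs) ((- 1) ^ length xs))"

definition bX :: "('v key2 \<Rightarrow>\<^sub>0 'k::field) \<Rightarrow> ('v key2 \<Rightarrow>\<^sub>0 'k)" where
  "bX z = dl z + eX z"

definition dK :: "('v key3 \<Rightarrow>\<^sub>0 'k::field) \<Rightarrow> ('v key3 \<Rightarrow>\<^sub>0 'k)" where
  "dK = lin (\<lambda>((u, xs), v). if xs = [] then 0 else delta ((u @ [hd xs], tl xs), v) +
     single ((u, butlast xs), last xs # v) ((- 1) ^ length xs))"

text \<open>\<open>D1\<close>, \<open>D2\<close>, \<open>D3\<close> and \<open>eY\<close> are the
  four ways in which a letter at an end of one of the two words in W can pass into the neighbouring
  factor A of the cycle. Signs come from the degrees passed over.\<close>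

definition D1 :: "('v key4 \<Rightarrow>\<^sub>0 'k::field) \<Rightarrow> ('v key4 \<Rightarrow>\<^sub>0 'k)" where
  "D1 = lin (\<lambda>(((u, xs), v), ys). if xs = [] then 0 else delta (((u @ [hd xs], tl xs), v), ys))"

definition D2 :: "('v key4 \<Rightarrow>\<^sub>0 'k::field) \<Rightarrow> ('v key4 \<Rightarrow>\<^sub>0 'k)" where
  "D2 = lin (\<lambda>(((u, xs), v), ys). if xs = [] then 0 else
     single (((u, butlast xs), last xs # v), ys) ((- 1) ^ length xs))"

definition D3 :: "('v key4 \<Rightarrow>\<^sub>0 'k::field) \<Rightarrow> ('v key4 \<Rightarrow>\<^sub>0 'k)" where
  "D3 = lin (\<lambda>(((u, xs), v), ys). if ys = [] then 0 else
     single (((u, xs), v @ [hd ys]), tl ys) ((- 1) ^ length xs))"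

text \<open>The one term that crosses the point where the cycle is closed, hence the one that the
  twist multiplies by \<lambda>.\<close>

definition eY :: "('v key4 \<Rightarrow>\<^sub>0 'k::field) \<Rightarrow> ('v key4 \<Rightarrow>\<^sub>0 'k)" where
  "eY = lin (\<lambda>(((u, xs), v), ys). if ys = [] then 0 else
     single (((last ys # u, xs), v), butlast ys) ((- 1) ^ (length xs + length ys)))"

definition bY :: "('v key4 \<Rightarrow>\<^sub>0 'k::field) \<Rightarrow> ('v key4 \<Rightarrow>\<^sub>0 'k)" where
  "bY y = D1 y + D2 y + D3 y + eY y"

definition swp :: "('v key4 \<Rightarrow>\<^sub>0 'k::field) \<Rightarrow> ('v key4 \<Rightarrow>\<^sub>0 'k)" where
  "swp = lin (\<lambda>(((u, xs), v), ys). single (((v, ys), u), xs) ((- 1) ^ (length xs * length ys)))"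

text \<open>The t-coefficient of the twisted rotation: \<open>v\<close> and \<open>ys\<close> pass
  the closing point and pick up \<lambda> to the power of their total length.\<close>

definition swp' :: "('v key4 \<Rightarrow>\<^sub>0 'k::field) \<Rightarrow> ('v key4 \<Rightarrow>\<^sub>0 'k)" where
  "swp' = lin (\<lambda>(((u, xs), v), ys). single (((v, ys), u), xs)
     ((- 1) ^ (length xs * length ys) * of_nat (length v + length ys)))"

text \<open>The augmentation of K(A) onto A applied to the first three factors.\<close>

definition f1 :: "('v key4 \<Rightarrow>\<^sub>0 'k::field) \<Rightarrow> ('v key2 \<Rightarrow>\<^sub>0 'k)" where
  "f1 = lin (\<lambda>(((u, xs), v), ys). if xs = [] then delta (u @ v, ys) else 0)"

definition De :: "('v key2 \<Rightarrow>\<^sub>0 'k::field) \<Rightarrow> ('v key4 \<Rightarrow>\<^sub>0 'k)" where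
  "De = lin (\<lambda>(u, xs). \<Sum>i\<le>length xs. delta (((u, take i xs), []), drop i xs))"

text \<open>The Euler operator, that is, the t-coefficient of \<lambda>^n in weight n.\<close>

definition NX :: "('v key2 \<Rightarrow>\<^sub>0 'k::field) \<Rightarrow> ('v key2 \<Rightarrow>\<^sub>0 'k)" where
  "NX = lin (\<lambda>(u, xs). single (u, xs) (of_nat (length u + length xs)))"

lemma plin_ops: "plin dl" "plin eX" "plin bX" "plin dK" "plin D1" "plin D2" "plin D3" "plin eY"
  "plin bY" "plin swp" "plin swp'" "plin f1" "plin De" "plin NX"
proof -
  show "plin dl" "plin eX" "plin dK" "plin D1" "plin D2" "plin D3" "plin eY"
    "plin swp" "plin swp'" "plin f1" "plin De" "plin NX"
    unfolding dl_def eX_def dK_def D1_def D2_def D3_def eY_def swp_def swp'_def f1_def De_def NX_def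
    by (rule plin_lin)+
  note * = this
  show "plin bX" unfolding bX_def[abs_def] by (intro plin_plus *)
  show "plin bY" unfolding bY_def[abs_def] by (intro plin_plus *)
qed

lemmas plin_ops_comp = plin_ops[THEN plin_comp[rotated]]

lemma dl_single [simp]: "dl (single (u, xs) c) =
    (if xs = [] then 0 else single (u @ [hd xs], tl xs) c)"
  by (simp add: dl_def)

lemma eX_single [simp]: "eX (single (u, xs) c) =
    (if xs = [] then 0 else single (last xs # u, butlast xs) (c * (- 1) ^ length xs))"
  by (simp add: eX_def)

lemma dK_single [simp]: "dK (single ((u, xs), v) c) =
    (if xs = [] then 0 else single ((u @ [hd xs], tl xs), v) c +
     single ((u, butlast xs), last xs # v) (c * (- 1) ^ length xs))"
  by (simp add: dK_def pm.scale_right_distrib)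

lemma D_single [simp]:
  "D1 (single (((u, xs), v), ys) c) =
    (if xs = [] then 0 else single (((u @ [hd xs], tl xs), v), ys) c)"
  "D2 (single (((u, xs), v), ys) c) =
    (if xs = [] then 0 else single (((u, butlast xs), last xs # v), ys) (c * (- 1) ^ length xs))"
  "D3 (single (((u, xs), v), ys) c) =
    (if ys = [] then 0 else single (((u, xs), v @ [hd ys]), tl ys) (c * (- 1) ^ length xs))"
  "eY (single (((u, xs), v), ys) c) =
    (if ys = [] then 0 else single (((last ys # u, xs), v), butlast ys)
       (c * (- 1) ^ (length xs + length ys)))"
  by (simp_all add: D1_def D2_def D3_def eY_def)

lemma swp_single [simp]:
  "swp (single (((u, xs), v), ys) c) =
     single (((v, ys), u), xs) (c * (- 1) ^ (length xs * length ys))"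
  "swp' (single (((u, xs), v), ys) c) =
     single (((v, ys), u), xs) (c * ((- 1) ^ (length xs * length ys) * of_nat (length v + length ys)))"
  "f1 (single (((u, xs), v), ys) c) = (if xs = [] then single (u @ v, ys) c else 0)"
  "NX (single (u, ws) c) = single (u, ws) (c * of_nat (length u + length ws))"
  by (simp_all add: swp_def swp'_def f1_def NX_def del: of_nat_add)

lemma De_single [simp]:
  "De (single (u, xs) c) = (\<Sum>i\<le>length xs. single (((u, take i xs), []), drop i xs) c)"
  by (simp add: De_def pm.scale_sum_right)

section \<open>Projections, coproduct and rotation as maps of complexes\<close>

lemmas op_simps = plin_ops(1-8,10-14)[THEN plin_add] plin_ops(1-8,10-14)[THEN plin_zero]
  plin_ops(1-8,10-14)[THEN plin_sum] bX_def bY_def plin_ops(1-8,10-14)[THEN plin_diff] plin_ops(1-8,10-14)[THEN plin_uminus]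

text \<open>The critical case is a single letter x in the first word: \<open>D1\<close> and
  \<open>D2\<close> both lead to the product u x v, with opposite signs.\<close>

lemma f1_bY: "f1 (bY y) = bX (f1 y)"
proof (rule plin_eqI[where f = "\<lambda>y. f1 (bY y)" and g = "\<lambda>y. bX (f1 y)"])
  fix k :: "'a key4"
  obtain u xs v ys where "k = (((u, xs), v), ys)" by (metis surj_pair)
  then show "f1 (bY (delta k)) = bX (f1 (delta k) :: _ \<Rightarrow>\<^sub>0 'b)"
    by (cases xs; cases "tl xs"; simp add: op_simps single_uminus)
qed (intro plin_ops_comp plin_plus plin_ident pmp.linear_zero)+

lemma f1_eY: "f1 (eY y) = eX (f1 y)"
proof (rule plin_eqI[where f = "\<lambda>y. f1 (eY y)" and g = "\<lambda>y. eX (f1 y)"])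
  fix k :: "'a key4"
  obtain u xs v ys where "k = (((u, xs), v), ys)" by (metis surj_pair)
  then show "f1 (eY (delta k)) = eX (f1 (delta k) :: _ \<Rightarrow>\<^sub>0 'b)"
    by (cases xs; simp add: op_simps)
qed (intro plin_ops_comp plin_plus plin_ident pmp.linear_zero)+

lemma eY_De: "eY (De y) = De (eX y)"
proof (rule plin_eqI[where f = "\<lambda>y. eY (De y)" and g = "\<lambda>y. De (eX y)"])
  fix k :: "'a key2"
  obtain u xs where k: "k = (u, xs)" by (metis surj_pair)
  show "eY (De (delta k)) = De (eX (delta k) :: _ \<Rightarrow>\<^sub>0 'b)"
  proof (cases xs rule: rev_cases)
    case (snoc ws x)
    have "(\<Sum>i\<le>length ws. eY (delta (((u, take i (ws @ [x])), []), drop i (ws @ [x])))) =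
      (\<Sum>i\<le>length ws. single (((x # u, take i ws), []), drop i ws) (- ((- 1 :: 'b) ^ length ws)))"
      by (intro sum.cong) (auto simp: butlast_append power_add[symmetric])
    moreover have "eY (delta (((u, xs), []), [])) = (0 :: _ \<Rightarrow>\<^sub>0 'b)" by simp
    ultimately show ?thesis unfolding k snoc by (simp add: op_simps del: D_single)
  qed (simp add: k op_simps)
qed (intro plin_ops_comp plin_plus plin_ident pmp.linear_zero)+

text \<open>The middle terms cancel in pairs: cutting after i + 1 letters and moving the last letter
  of the left part inwards gives the same word as cutting after i letters and moving the first
  letter of the right part, with opposite sign. The outer terms \<open>D1\<close> and
  \<open>eY\<close> reproduce \<open>dl\<close> and \<open>eX\<close>.\<close>

lemma bY_De: "bY (De y) = De (bX y)"
proof (rule plin_eqI[where f = "\<lambda>y. bY (De y)" and g = "\<lambda>y. De (bX y)"])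
  fix k :: "'a key2"
  obtain u xs where k: "k = (u, xs)" by (metis surj_pair)
  have D1: "D1 (De (delta (u, xs))) = De (dl (delta (u, xs)) :: _ \<Rightarrow>\<^sub>0 'b)"
  proof (cases xs)
    case (Cons x ws)
    show ?thesis unfolding Cons by (simp add: op_simps sum.atMost_Suc_shift del: sum.atMost_Suc)
  qed (simp add: op_simps)
  have D23: "D2 (De (delta (u, xs))) + D3 (De (delta (u, xs))) = (0 :: _ \<Rightarrow>\<^sub>0 'b)"
  proof (cases "length xs")
    case (Suc n)
    have "D2 (De (delta (u, xs))) = (\<Sum>i\<le>n. D2 (delta (((u, take (Suc i) xs), []), drop (Suc i) xs) :: _ \<Rightarrow>\<^sub>0 'b))"
      unfolding De_single Suc plin_ops(6)[THEN plin_sum]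
      by (subst sum.atMost_Suc_shift) simp
    also have "\<dots> = (\<Sum>i\<le>n. single (((u, take i xs), [xs ! i]), drop (Suc i) xs) (- ((- 1) ^ i)))"
      using Suc by (intro sum.cong) (auto simp: take_Suc_conv_app_nth)
    also have "\<dots> = - (\<Sum>i\<le>n. D3 (delta (((u, take i xs), []), drop i xs) :: _ \<Rightarrow>\<^sub>0 'b))"
      using Suc unfolding sum_negf[symmetric]
      by (intro sum.cong) (auto simp: hd_drop_conv_nth tl_drop drop_Suc single_uminus)
    also have "(\<Sum>i\<le>n. D3 (delta (((u, take i xs), []), drop i xs) :: _ \<Rightarrow>\<^sub>0 'b)) = D3 (De (delta (u, xs)))"
      unfolding De_single Suc plin_ops(7)[THEN plin_sum] using Suc by simp
    finally show ?thesis by simp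
  qed (simp add: op_simps)
  show "bY (De (delta k)) = De (bX (delta k) :: _ \<Rightarrow>\<^sub>0 'b)"
    using D1 D23 unfolding k bY_def bX_def plin_add[OF plin_ops(13)] eY_De
    by (metis (no_types, lifting) add.assoc add.right_neutral)
qed (intro plin_ops_comp plin_plus plin_ident pmp.linear_zero)+

lemma f1_De: "f1 (De z) = z"
proof (rule plin_eqI[where f = "\<lambda>z. f1 (De z)" and g = "\<lambda>z. z"])
  fix k :: "'a key2"
  obtain u xs where k: "k = (u, xs)" by (metis surj_pair)
  show "f1 (De (delta k)) = (delta k :: _ \<Rightarrow>\<^sub>0 'b)"
  proof (cases "length xs")
    case (Suc n)
    then show ?thesis
      unfolding k by (simp add: op_simps sum.atMost_Suc_shift del: sum.atMost_Suc) (auto intro!: sum.neutral)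
  qed (simp add: k op_simps)
qed (intro plin_ops_comp plin_plus plin_ident pmp.linear_zero)+

text \<open>After the rotation \<open>f1\<close> keeps the cut with empty right part, whereas
  \<open>f1_De\<close> kept the one with empty left part.\<close>

lemma f1_swp_De: "f1 (swp (De z)) = z"
proof (rule plin_eqI[where f = "\<lambda>z. f1 (swp (De z))" and g = "\<lambda>z. z"])
  fix k :: "'a key2"
  obtain u xs where k: "k = (u, xs)" by (metis surj_pair)
  have "f1 (swp (De (delta k))) = (\<Sum>i\<le>length xs. if i = length xs then delta k else (0 :: _ \<Rightarrow>\<^sub>0 'b))"
    unfolding k De_single plin_ops(10,12)[THEN plin_sum] by (intro sum.cong) auto
  then show "f1 (swp (De (delta k))) = (delta k :: _ \<Rightarrow>\<^sub>0 'b)" by simp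
qed (intro plin_ops_comp plin_plus plin_ident pmp.linear_zero)+

text \<open>The cut that survives has an empty right part and an empty middle factor, so nothing has
  passed the closing point and the weight is 0.\<close>

lemma f1_swp'_De: "f1 (swp' (De z)) = 0"
proof (rule plin_eqI[where f = "\<lambda>z. f1 (swp' (De z))" and g = "\<lambda>z. 0"])
  fix k :: "'a key2"
  obtain u xs where k: "k = (u, xs)" by (metis surj_pair)
  show "f1 (swp' (De (delta k))) = (0 :: _ \<Rightarrow>\<^sub>0 'b)"
    unfolding k De_single plin_ops(11,12)[THEN plin_sum] by (intro sum.neutral) auto
qed (intro plin_ops_comp plin_plus plin_ident pmp.linear_zero)+

text \<open>Half a turn exchanges \<open>D1\<close> with \<open>D3\<close> and \<open>D2\<close>
  with \<open>eY\<close>; the sign of the rotation absorbs the differences of sign.\<close>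

lemma swp_bY: "swp (bY y) = bY (swp y)"
proof (rule plin_eqI[where f = "\<lambda>y. swp (bY y)" and g = "\<lambda>y. bY (swp y)"])
  fix k :: "'a key4"
  obtain u xs v ys where "k = (((u, xs), v), ys)" by (metis surj_pair)
  then show "swp (bY (delta k)) = bY (swp (delta k) :: _ \<Rightarrow>\<^sub>0 'b)"
    by (cases "length xs"; cases "length ys")
      (auto simp: op_simps minus_one_power_iff add_ac)
qed (intro plin_ops_comp plin_plus plin_ident pmp.linear_zero)+

text \<open>The t-coefficient of the statement that the twisted rotation commutes with the twisted
  differential.\<close>

lemma swp'_bY: "swp' (bY y) + swp (eY y) = bY (swp' y) + eY (swp y)"
proof (rule plin_eqI[where f = "\<lambda>y. swp' (bY y) + swp (eY y)" and g = "\<lambda>y. bY (swp' y) + eY (swp y)"])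
  fix k :: "'a key4"
  obtain u xs v ys where k: "k = (((u, xs), v), ys)" by (metis surj_pair)
  show "swp' (bY (delta k)) + swp (eY (delta k)) = bY (swp' (delta k)) + eY (swp (delta k) :: _ \<Rightarrow>\<^sub>0 'b)"
    unfolding k
    by (cases "length xs"; cases "length ys")
      (auto intro!: poly_mapping_eqI simp: op_simps lookup_add lookup_single when_def minus_one_power_iff algebra_simps)
qed (intro plin_ops_comp plin_plus plin_ident pmp.linear_zero)+

text \<open>The t-coefficient of the statement that the square of the rotation is \<lambda>^n in
  weight n: each half turn contributes the weight of the half that crosses the closing
  point.\<close>

lemma f1_swp_swp': "f1 (swp (swp' y)) + f1 (swp' (swp y)) = NX (f1 y)"
proof (rule plin_eqI[where f = "\<lambda>y. f1 (swp (swp' y)) + f1 (swp' (swp y))" and g = "\<lambda>y. NX (f1 y)"])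
  fix k :: "'a key4"
  obtain u xs v ys where k: "k = (((u, xs), v), ys)" by (metis surj_pair)
  show "f1 (swp (swp' (delta k))) + f1 (swp' (swp (delta k))) = NX (f1 (delta k) :: _ \<Rightarrow>\<^sub>0 'b)"
    unfolding k by (auto simp: op_simps single_add single_uminus algebra_simps)
qed (intro plin_ops_comp plin_plus plin_ident pmp.linear_zero)+

section \<open>Squares and anticommutators of the differentials\<close>

lemma list_cases_ends:
  obtains "xs = []" | x where "xs = [x]" | x ws y where "xs = x # ws @ [y]"
proof (cases xs)
  case (Cons x ws)
  then show ?thesis using that(2,3) by (cases ws rule: rev_cases) auto
qed (rule that(1))

text \<open>The four operators take letters from four different ends and insert them at four
  different ends, so their order affects only the sign. If two of them compete for the same single
  letter, both composites vanish.\<close>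

lemma D_anticommute:
  "D1 (D2 y) + D2 (D1 y) = 0" "D1 (D3 y) + D3 (D1 y) = 0" "D1 (eY y) + eY (D1 y) = 0"
  "D2 (D3 y) + D3 (D2 y) = 0" "D2 (eY y) + eY (D2 y) = 0" "D3 (eY y) + eY (D3 y) = 0"
proof -
  have "D1 (D2 (delta k)) + D2 (D1 (delta k)) = (0 :: _ \<Rightarrow>\<^sub>0 'b)"
    "D1 (D3 (delta k)) + D3 (D1 (delta k)) = (0 :: _ \<Rightarrow>\<^sub>0 'b)"
    "D1 (eY (delta k)) + eY (D1 (delta k)) = (0 :: _ \<Rightarrow>\<^sub>0 'b)"
    "D2 (D3 (delta k)) + D3 (D2 (delta k)) = (0 :: _ \<Rightarrow>\<^sub>0 'b)"
    "D2 (eY (delta k)) + eY (D2 (delta k)) = (0 :: _ \<Rightarrow>\<^sub>0 'b)"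
    "D3 (eY (delta k)) + eY (D3 (delta k)) = (0 :: _ \<Rightarrow>\<^sub>0 'b)" for k :: "'a key4"
  proof -
    obtain u xs v ys where k: "k = (((u, xs), v), ys)" by (metis surj_pair)
    show "D1 (D2 (delta k)) + D2 (D1 (delta k)) = (0 :: _ \<Rightarrow>\<^sub>0 'b)"
      unfolding k by (cases xs rule: list_cases_ends; cases ys rule: list_cases_ends;
          simp add: op_simps butlast_append single_uminus power_add)
    show "D1 (D3 (delta k)) + D3 (D1 (delta k)) = (0 :: _ \<Rightarrow>\<^sub>0 'b)"
      unfolding k by (cases xs rule: list_cases_ends; cases ys rule: list_cases_ends;
          simp add: op_simps butlast_append single_uminus power_add)
    show "D1 (eY (delta k)) + eY (D1 (delta k)) = (0 :: _ \<Rightarrow>\<^sub>0 'b)"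
      unfolding k by (cases xs rule: list_cases_ends; cases ys rule: list_cases_ends;
          simp add: op_simps butlast_append single_uminus power_add)
    show "D2 (D3 (delta k)) + D3 (D2 (delta k)) = (0 :: _ \<Rightarrow>\<^sub>0 'b)"
      unfolding k by (cases xs rule: list_cases_ends; cases ys rule: list_cases_ends;
          simp add: op_simps butlast_append single_uminus power_add)
    show "D2 (eY (delta k)) + eY (D2 (delta k)) = (0 :: _ \<Rightarrow>\<^sub>0 'b)"
      unfolding k by (cases xs rule: list_cases_ends; cases ys rule: list_cases_ends;
          simp add: op_simps butlast_append single_uminus minus_one_power_iff)
    show "D3 (eY (delta k)) + eY (D3 (delta k)) = (0 :: _ \<Rightarrow>\<^sub>0 'b)"
      unfolding k by (cases xs rule: list_cases_ends; cases ys rule: list_cases_ends;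
          simp add: op_simps butlast_append single_uminus minus_one_power_iff)
  qed
  note * = this
  note intros = plin_ops_comp plin_plus plin_ident pmp.linear_zero
  show "D1 (D2 y) + D2 (D1 y) = 0"
    by (rule plin_eqI[where f = "\<lambda>y. D1 (D2 y) + D2 (D1 y)" and g = "\<lambda>y. 0", OF _ _ *(1)])
      (intro intros)+
  show "D1 (D3 y) + D3 (D1 y) = 0"
    by (rule plin_eqI[where f = "\<lambda>y. D1 (D3 y) + D3 (D1 y)" and g = "\<lambda>y. 0", OF _ _ *(2)])
      (intro intros)+
  show "D1 (eY y) + eY (D1 y) = 0"
    by (rule plin_eqI[where f = "\<lambda>y. D1 (eY y) + eY (D1 y)" and g = "\<lambda>y. 0", OF _ _ *(3)])
      (intro intros)+
  show "D2 (D3 y) + D3 (D2 y) = 0"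
    by (rule plin_eqI[where f = "\<lambda>y. D2 (D3 y) + D3 (D2 y)" and g = "\<lambda>y. 0", OF _ _ *(4)])
      (intro intros)+
  show "D2 (eY y) + eY (D2 y) = 0"
    by (rule plin_eqI[where f = "\<lambda>y. D2 (eY y) + eY (D2 y)" and g = "\<lambda>y. 0", OF _ _ *(5)])
      (intro intros)+
  show "D3 (eY y) + eY (D3 y) = 0"
    by (rule plin_eqI[where f = "\<lambda>y. D3 (eY y) + eY (D3 y)" and g = "\<lambda>y. 0", OF _ _ *(6)])
      (intro intros)+
qed

lemma bY_bY: "bY (bY y) = D1 (D1 y) + D2 (D2 y) + D3 (D3 y) + eY (eY y)"
proof -
  have "bY (bY y) = D1 (D1 y) + D2 (D2 y) + D3 (D3 y) + eY (eY y)
    + (D1 (D2 y) + D2 (D1 y)) + (D1 (D3 y) + D3 (D1 y)) + (D1 (eY y) + eY (D1 y))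
    + (D2 (D3 y) + D3 (D2 y)) + (D2 (eY y) + eY (D2 y)) + (D3 (eY y) + eY (D3 y))"
    by (simp add: op_simps add_ac)
  then show ?thesis by (simp only: D_anticommute add_0_right)
qed

lemma bY_eY: "bY (eY y) + eY (bY y) = eY (eY y) + eY (eY y)"
proof -
  have "bY (eY y) + eY (bY y) = eY (eY y) + eY (eY y) + (D1 (eY y) + eY (D1 y))
    + (D2 (eY y) + eY (D2 y)) + (D3 (eY y) + eY (D3 y))"
    by (simp add: op_simps add_ac)
  then show ?thesis by (simp only: D_anticommute add_0_right)
qed

lemma swp_D: "swp (D1 y) = D3 (swp y)" "swp (D2 y) = eY (swp y)" "swp (swp y) = y"
proof -
  have "swp (D1 (delta k)) = D3 (swp (delta k) :: _ \<Rightarrow>\<^sub>0 'b)"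
    "swp (D2 (delta k)) = eY (swp (delta k) :: _ \<Rightarrow>\<^sub>0 'b)"
    "swp (swp (delta k)) = (delta k :: _ \<Rightarrow>\<^sub>0 'b)" for k :: "'a key4"
  proof -
    obtain u xs v ys where k: "k = (((u, xs), v), ys)" by (metis surj_pair)
    show "swp (D1 (delta k)) = D3 (swp (delta k) :: _ \<Rightarrow>\<^sub>0 'b)"
      unfolding k by (cases "length xs") (auto simp: op_simps minus_one_power_iff)
    show "swp (D2 (delta k)) = eY (swp (delta k) :: _ \<Rightarrow>\<^sub>0 'b)"
      unfolding k by (cases "length xs") (auto simp: op_simps minus_one_power_iff)
    show "swp (swp (delta k)) = (delta k :: _ \<Rightarrow>\<^sub>0 'b)"
      unfolding k by (cases "length xs") (auto simp: op_simps minus_one_power_iff)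
  qed
  note * = this
  note intros = plin_ops_comp plin_plus plin_ident pmp.linear_zero
  show "swp (D1 y) = D3 (swp y)"
    by (rule plin_eqI[where f = "\<lambda>y. swp (D1 y)" and g = "\<lambda>y. D3 (swp y)", OF _ _ *(1)]) (intro intros)+
  show "swp (D2 y) = eY (swp y)"
    by (rule plin_eqI[where f = "\<lambda>y. swp (D2 y)" and g = "\<lambda>y. eY (swp y)", OF _ _ *(2)]) (intro intros)+
  show "swp (swp y) = y"
    by (rule plin_eqI[where f = "\<lambda>y. swp (swp y)" and g = "\<lambda>y. y", OF _ _ *(3)]) (intro intros)+
qed

text \<open>By conjugation with the rotation, range and square of \<open>D3\<close> and
  \<open>eY\<close> follow from those of \<open>D1\<close> and \<open>D2\<close>.\<close>

lemma D3_eq: "D3 y = swp (D1 (swp y))" and eY_eq: "eY y = swp (D2 (swp y))"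
  by (simp_all add: swp_D)

section \<open>The operators on pure tensors\<close>

lemma trilinear_eqI:
  assumes "\<And>q r. plin (\<lambda>p. f p q r)" "\<And>p r. plin (\<lambda>q. f p q r)" "\<And>p q. plin (\<lambda>r. f p q r)"
    "\<And>q r. plin (\<lambda>p. g p q r)" "\<And>p r. plin (\<lambda>q. g p q r)" "\<And>p q. plin (\<lambda>r. g p q r)"
    and "\<And>x y z. x \<in> keys p \<Longrightarrow> y \<in> keys q \<Longrightarrow> z \<in> keys r \<Longrightarrow>
      f (delta x) (delta y) (delta z) = g (delta x) (delta y) (delta z)"
  shows "f p q r = g p q r"
  by (rule plin_eqI[where f = "\<lambda>p. f p q r" and g = "\<lambda>p. g p q r", OF assms(1,4)],
      rule bilinear_eqI[where f = "\<lambda>q r. f _ q r" and g = "\<lambda>q r. g _ q r", OF assms(2,3,5,6)], rule assms(7))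

lemma quadrilinear_eqI:
  assumes "\<And>q r s. plin (\<lambda>p. f p q r s)" "\<And>p r s. plin (\<lambda>q. f p q r s)"
    "\<And>p q s. plin (\<lambda>r. f p q r s)" "\<And>p q r. plin (\<lambda>s. f p q r s)"
    "\<And>q r s. plin (\<lambda>p. g p q r s)" "\<And>p r s. plin (\<lambda>q. g p q r s)"
    "\<And>p q s. plin (\<lambda>r. g p q r s)" "\<And>p q r. plin (\<lambda>s. g p q r s)"
    and "\<And>x y z t. x \<in> keys p \<Longrightarrow> y \<in> keys q \<Longrightarrow> z \<in> keys r \<Longrightarrow> t \<in> keys s \<Longrightarrow>
      f (delta x) (delta y) (delta z) (delta t) = g (delta x) (delta y) (delta z) (delta t)"
  shows "f p q r s = g p q r s"
  by (rule plin_eqI[where f = "\<lambda>p. f p q r s" and g = "\<lambda>p. g p q r s", OF assms(1,5)],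
      rule trilinear_eqI[where f = "\<lambda>q r s. f _ q r s" and g = "\<lambda>q r s. g _ q r s", OF assms(2-4,6-8)],
      rule assms(9))

text \<open>The right half of the bimodule differential; the left half is \<open>dl\<close> tensored
  with the identity.\<close>

definition dm :: "('v key3 \<Rightarrow>\<^sub>0 'k::field) \<Rightarrow> ('v key3 \<Rightarrow>\<^sub>0 'k)" where
  "dm = lin (\<lambda>((u, xs), v). if xs = [] then 0 else
     single ((u, butlast xs), last xs # v) ((- 1) ^ length xs))"

lemma plin_dm: "plin dm"
  unfolding dm_def by (rule plin_lin)

lemma dm_single [simp]: "dm (single ((u, xs), v) c) = (if xs = [] then 0 else
     single ((u, butlast xs), last xs # v) (c * (- 1) ^ length xs))"
  by (simp add: dm_def)

lemmas plin_intros3 = plin_intros2 plin_ops_comp plin_comp[OF _ plin_dm] plin_scl_lookup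

lemma dK_eq: "dK k = tmap dl (\<lambda>p. p) k + dm k"
proof (rule plin_eqI[where f = dK and g = "\<lambda>k. tmap dl (\<lambda>p. p) k + dm k"])
  fix k :: "'a key3"
  obtain u xs v where k: "k = ((u, xs), v)" by (metis surj_pair)
  show "dK (delta k) = tmap dl (\<lambda>p. p) (delta k) + (dm (delta k) :: _ \<Rightarrow>\<^sub>0 'b)"
    unfolding k by simp
qed (intro plin_ops plin_intros3)+

lemma D1_eq: "D1 y = tmap (tmap dl (\<lambda>p. p)) (\<lambda>p. p) y"
proof (rule plin_eqI[where f = D1 and g = "\<lambda>y. tmap (tmap dl (\<lambda>p. p)) (\<lambda>p. p) y"])
  fix k :: "'a key4"
  obtain u xs v ys where k: "k = (((u, xs), v), ys)" by (metis surj_pair)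
  show "D1 (delta k) = (tmap (tmap dl (\<lambda>p. p)) (\<lambda>p. p) (delta k) :: _ \<Rightarrow>\<^sub>0 'b)"
    unfolding k by simp
qed (intro plin_ops plin_tmap)+

lemma D2_eq: "D2 y = tmap dm (\<lambda>p. p) y"
proof (rule plin_eqI[where f = D2 and g = "\<lambda>y. tmap dm (\<lambda>p. p) y"])
  fix k :: "'a key4"
  obtain u xs v ys where k: "k = (((u, xs), v), ys)" by (metis surj_pair)
  show "D2 (delta k) = (tmap dm (\<lambda>p. p) (delta k) :: _ \<Rightarrow>\<^sub>0 'b)"
    unfolding k by simp
qed (intro plin_ops plin_tmap)+

text \<open>The terms that leave the last word alone: K(A) with coefficients in the last factor.
  This is the vertical differential of the filtration used below.\<close>

lemma D12_eq: "D1 y + D2 y = tmap dK (\<lambda>p. p) y"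
  unfolding D1_eq D2_eq
  by (rule plin_eqI[where f = "\<lambda>y. tmap (tmap dl (\<lambda>p. p)) (\<lambda>p. p) y + tmap dm (\<lambda>p. p) y"
        and g = "\<lambda>y. tmap dK (\<lambda>p. p) y"])
    ((intro plin_intros3 plin_tmap)+, auto simp: dK_eq tens_add_left)

lemma dl_tens: "dl (tens a (mul (delta [x]) w)) = tens (mul a (delta [x])) w"
  by (rule bilinear_eqI[where f = "\<lambda>a w. dl (tens a (mul (delta [x]) w))" and g = "\<lambda>a w. tens (mul a (delta [x])) w"])
    ((intro plin_intros3)+, simp)

lemma dm_tens:
  assumes "w \<in> FE E n"
  shows "dm (tens (tens a (mul w (delta [x]))) b) = scl (- ((- 1) ^ n)) (tens (tens a w) (mul (delta [x]) b))"
  by (rule trilinear_eqI[where f = "\<lambda>a w b. dm (tens (tens a (mul w (delta [x]))) b)"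
        and g = "\<lambda>a w b. scl (- ((- 1) ^ n)) (tens (tens a w) (mul (delta [x]) b))"])
    ((intro plin_intros3)+, use assms in \<open>auto simp: FE_def words_def\<close>)

lemma swp_tens:
  assumes "w \<in> FE E m" "w' \<in> FE E n"
  shows "swp (tens (tens (tens a w) b) w') = scl ((- 1) ^ (m * n)) (tens (tens (tens b w') a) w)"
  by (rule quadrilinear_eqI[where f = "\<lambda>a w b w'. swp (tens (tens (tens a w) b) w')"
        and g = "\<lambda>a w b w'. scl ((- 1) ^ (m * n)) (tens (tens (tens b w') a) w)"])
    ((intro plin_intros3)+, use assms in \<open>auto simp: FE_def words_def dest!: subsetD\<close>)

lemma f1_tens: "f1 (tens (tens (tens a w) b) w') = scl (lookup w []) (tens (mul a b) w')"
  by (rule quadrilinear_eqI[where f = "\<lambda>a w b w'. f1 (tens (tens (tens a w) b) w')"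
        and g = "\<lambda>a w b w'. scl (lookup w []) (tens (mul a b) w')"])
    ((intro plin_intros3)+, auto simp: lookup_single)

lemma De_tens: "De (tens a (delta xs)) = (\<Sum>i\<le>length xs. tens (tens (tens a (delta (take i xs))) (delta [])) (delta (drop i xs)))"
  by (rule plin_eqI[where f = "\<lambda>a. De (tens a (delta xs))"
        and g = "\<lambda>a. \<Sum>i\<le>length xs. tens (tens (tens a (delta (take i xs))) (delta [])) (delta (drop i xs))"])
    ((intro plin_intros3 pmp.linear_compose_sum ballI)+, auto)

section \<open>Operators that scale by a function of the weight\<close>

definition lw :: "(nat \<Rightarrow> 'k) \<Rightarrow> ('v list \<Rightarrow>\<^sub>0 'k::field) \<Rightarrow> ('v list \<Rightarrow>\<^sub>0 'k)" where
  "lw h = lin (\<lambda>u. single u (h (length u)))"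

definition wt :: "(nat \<Rightarrow> 'k) \<Rightarrow> ('v key2 \<Rightarrow>\<^sub>0 'k::field) \<Rightarrow> ('v key2 \<Rightarrow>\<^sub>0 'k)" where
  "wt h = lin (\<lambda>(u, xs). single (u, xs) (h (length u + length xs)))"

definition wv :: "('v key4 \<Rightarrow>\<^sub>0 'k::field) \<Rightarrow> ('v key4 \<Rightarrow>\<^sub>0 'k)" where
  "wv = lin (\<lambda>(((u, xs), v), ys). single (((u, xs), v), ys) (of_nat (length v + length ys)))"

lemma plin_wt: "plin (lw h)" "plin (wt h)" "plin wv"
  unfolding lw_def wt_def wv_def by (rule plin_lin)+

lemmas plin_intros4 = plin_intros3 plin_wt[THEN plin_comp[rotated]]

lemma wt_single [simp]:
  "lw h (single u c) = single u (c * h (length u))"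
  "wt h (single (u, xs) c) = single (u, xs) (c * h (length u + length xs))"
  "wv (single (((u, xs), v), ys) c') = single (((u, xs), v), ys) (c' * of_nat (length v + length ys))"
  by (simp_all add: lw_def wt_def wv_def del: of_nat_add)

lemma swp'_eq: "swp' y = swp (wv y)"
proof (rule plin_eqI[where f = swp' and g = "\<lambda>y. swp (wv y)"])
  fix k :: "'a key4"
  obtain u xs v ys where k: "k = (((u, xs), v), ys)" by (metis surj_pair)
  show "swp' (delta k) = (swp (wv (delta k)) :: _ \<Rightarrow>\<^sub>0 'b)"
    unfolding k by (simp add: mult.commute)
qed (intro plin_ops plin_intros4 plin_wt)+

lemma NX_eq: "NX = wt of_nat"
  by (simp add: NX_def wt_def fun_eq_iff)

lemma wv_tens:
  assumes "w' \<in> FE E n"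
  shows "wv (tens (tens (tens a w) b) w') = tens (tens (tens a w) (lw (\<lambda>i. of_nat (i + n)) b)) w'"
  by (rule quadrilinear_eqI[where f = "\<lambda>a w b w'. wv (tens (tens (tens a w) b) w')"
        and g = "\<lambda>a w b w'. tens (tens (tens a w) (lw (\<lambda>i. of_nat (i + n)) b)) w'"])
    ((intro plin_intros4)+, use assms in \<open>auto simp: FE_def words_def simp del: of_nat_add dest!: subsetD\<close>)

lemma wt_tens:
  assumes "w \<in> FE E n"
  shows "wt h (tens a w) = tens (lw (\<lambda>i. h (i + n)) a) w"
  by (rule bilinear_eqI[where f = "\<lambda>a w. wt h (tens a w)" and g = "\<lambda>a w. tens (lw (\<lambda>i. h (i + n)) a) w"])
    ((intro plin_intros4)+, use assms in \<open>auto simp: FE_def words_def dest!: subsetD\<close>)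

lemma wt_wt: "wt h (wt h' z) = wt (\<lambda>i. h i * h' i) z"
proof (rule plin_eqI[where f = "\<lambda>z. wt h (wt h' z)" and g = "wt (\<lambda>i. h i * h' i)"])
  fix k :: "'a key2"
  obtain u xs where k: "k = (u, xs)" by (metis surj_pair)
  show "wt h (wt h' (delta k)) = wt (\<lambda>i. h i * h' i) (delta k)"
    unfolding k by (simp add: mult.commute)
qed (intro plin_intros4 plin_wt)+

lemma wt_eX: "wt h (eX z) = eX (wt h z)"
proof (rule plin_eqI[where f = "\<lambda>z. wt h (eX z)" and g = "\<lambda>z. eX (wt h z)"])
  fix k :: "'a key2"
  obtain u xs where k: "k = (u, xs)" by (metis surj_pair)
  show "wt h (eX (delta k)) = eX (wt h (delta k))"
    unfolding k by (cases "length xs") (auto simp: op_simps plin_zero[OF plin_wt(2)] mult.commute)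
qed (intro plin_intros4)+

lemma wt_bX: "wt h (bX z) = bX (wt h z)"
proof (rule plin_eqI[where f = "\<lambda>z. wt h (bX z)" and g = "\<lambda>z. bX (wt h z)"])
  fix k :: "'a key2"
  obtain u xs where k: "k = (u, xs)" by (metis surj_pair)
  show "wt h (bX (delta k)) = bX (wt h (delta k))"
    unfolding k bX_def plin_add[OF plin_wt(2)] wt_eX
    by (cases "length xs") (auto simp: op_simps plin_zero[OF plin_wt(2)] mult.commute)
qed (intro plin_intros4)+

text \<open>The algebra A is represented by an idempotent \<open>rA\<close> on words:
  \<open>rA p = rA q\<close> stands for equality in A. The multiplication axioms make its kernel a
  two-sided ideal, \<open>rA_keys\<close> makes it compatible with weights, and
  \<open>rA_Nil\<close> keeps the unit, which the coproduct inserts.\<close>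

locale koszul_model =
  fixes E :: "'v set" and Rm :: "('v list \<Rightarrow>\<^sub>0 'k::field_char_0) set"
    and rA :: "('v list \<Rightarrow>\<^sub>0 'k) \<Rightarrow> ('v list \<Rightarrow>\<^sub>0 'k)"
  assumes plin_rA: "plin rA"
    and rA_idem: "rA (rA p) = rA p"
    and rA_mul_left_0: "rA p = 0 \<Longrightarrow> rA (mul q p) = 0"
    and rA_mul_right_0: "rA p = 0 \<Longrightarrow> rA (mul p q) = 0"
    and rA_keys: "keys (rA (delta u)) \<subseteq> {v. length v = length u}"
    and rA_Nil: "rA (delta []) = delta []"
    and Rm_subspace: "pm.subspace Rm"
    and rA_Rm: "r \<in> Rm \<Longrightarrow> rA r = 0"
begin

text \<open>Membership in every space of relations padded by i letters on the left and j on the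
  right is tested on coordinates: each slice that leaves two adjacent letters must be a relation.
  \<open>relation_span\<close> and \<open>W_space_eq\<close> below connect this with
  \<open>W_space\<close>.\<close>

definition W :: "nat \<Rightarrow> ('v list \<Rightarrow>\<^sub>0 'k) set" where
  "W n = {w \<in> FE E n. \<forall>u v. length u + 2 + length v = n \<longrightarrow> sl u v w \<in> Rm}"

definition AW :: "nat \<Rightarrow> ('v key2 \<Rightarrow>\<^sub>0 'k) set" where
  "AW n = pm.span {tens a w | a w. a \<in> FL E \<and> w \<in> W n}"

definition AWA :: "nat \<Rightarrow> ('v key3 \<Rightarrow>\<^sub>0 'k) set" where
  "AWA n = pm.span {tens (tens a w) b | a w b. a \<in> FL E \<and> w \<in> W n \<and> b \<in> FL E}"

definition AWAW :: "nat \<Rightarrow> ('v key4 \<Rightarrow>\<^sub>0 'k) set" where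
  "AWAW n = pm.span {tens (tens (tens a w) b) w' | a w b w' p q.
     a \<in> FL E \<and> w \<in> W p \<and> b \<in> FL E \<and> w' \<in> W q \<and> p + q = n}"

text \<open>Normal forms are taken only in the factors A. The factors W consist of words over
  \<open>E\<close>, later a basis of V, and need none.\<close>

definition nX :: "('v key2 \<Rightarrow>\<^sub>0 'k) \<Rightarrow> ('v key2 \<Rightarrow>\<^sub>0 'k)" where
  "nX = tmap rA (\<lambda>p. p)"

definition nK :: "('v key3 \<Rightarrow>\<^sub>0 'k) \<Rightarrow> ('v key3 \<Rightarrow>\<^sub>0 'k)" where
  "nK = tmap nX rA"

definition nY :: "('v key4 \<Rightarrow>\<^sub>0 'k) \<Rightarrow> ('v key4 \<Rightarrow>\<^sub>0 'k)" where
  "nY = tmap nK (\<lambda>p. p)"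

lemma plin_n: "plin nX" "plin nK" "plin nY"
  unfolding nX_def nK_def nY_def by (rule plin_tmap)+

lemma n_tens:
  "nX (tens a w) = tens (rA a) w" "nK (tens t b) = tens (nX t) (rA b)" "nY (tens k w) = tens (nK k) w"
  unfolding nY_def nK_def nX_def by (simp_all add: tmap_tens plin_rA plin_ident plin_tmap)

lemmas plin_intros5 = plin_intros4 plin_n[THEN plin_comp[rotated]] plin_rA[THEN plin_comp[rotated]]

lemma n_idem: "nX (nX z) = nX z" "nK (nK k) = nK k" "nY (nY y) = nY y"
proof -
  show AW: "nX (nX z) = nX z" for z
    unfolding nX_def by (subst tmap_comp) (simp_all add: plin_rA plin_ident rA_idem)
  show AWA: "nK (nK k) = nK k" for k
    unfolding nK_def by (subst tmap_comp) (simp_all add: plin_rA plin_n rA_idem AW)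
  show "nY (nY y) = nY y"
    unfolding nY_def by (subst tmap_comp) (simp_all add: plin_ident plin_n AWA)
qed

section \<open>The subspaces built from W and their invariance\<close>

lemma subspaces: "pm.subspace (AW n)" "pm.subspace (AWA n)" "pm.subspace (AWAW n)"
  unfolding AW_def AWA_def AWAW_def by (rule pm.subspace_span)+

lemma W_subspace: "pm.subspace (W n)"
  using subspace_FE[of E n] Rm_subspace
  by (auto simp: W_def pm.subspace_def plin_zero[OF plin_sl] plin_add[OF plin_sl] plin_scl[OF plin_sl])

lemma W_FE: "w \<in> W n \<Longrightarrow> w \<in> FE E n"
  by (simp add: W_def)

lemma W_small: "n < 2 \<Longrightarrow> W n = FE E n"
  by (auto simp: W_def)

text \<open>Slices compose, so a slice of \<open>w\<close> is tested by longer slices of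
  \<open>w\<close>. This gives the inclusions of W into its products with tensor powers of
  V.\<close>

lemma sl_W:
  assumes "w \<in> W (length u + n + length v)"
  shows "sl u v w \<in> W n"
  using assms by (auto simp: W_def sl_FE sl_sl)

lemma W_left:
  assumes "w \<in> W (i + n)"
  shows "w \<in> pm.span {mul (delta u) w' | u w'. u \<in> words E i \<and> w' \<in> W n}"
proof -
  have "w \<in> pm.span {mul (delta u) (mul (sl u v w) (delta v)) | u v. u \<in> words E i \<and> v \<in> words E 0}"
    using in_span_sl[of w E i n 0] W_FE[OF assms] by simp
  also have "\<dots> \<subseteq> pm.span {mul (delta u) w' | u w'. u \<in> words E i \<and> w' \<in> W n}"
    by (rule pm.span_mono) (use sl_W[of w _ n "[]"] assms in \<open>force simp: words_def\<close>)
  finally show ?thesis .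
qed

lemma W_right:
  assumes "w \<in> W (n + j)"
  shows "w \<in> pm.span {mul w' (delta v) | v w'. v \<in> words E j \<and> w' \<in> W n}"
proof -
  have "w \<in> pm.span {mul (delta u) (mul (sl u v w) (delta v)) | u v. u \<in> words E 0 \<and> v \<in> words E j}"
    using in_span_sl[of w E 0 n j] W_FE[OF assms] by simp
  also have "\<dots> \<subseteq> pm.span {mul w' (delta v) | v w'. v \<in> words E j \<and> w' \<in> W n}"
    by (rule pm.span_mono) (use sl_W[of w "[]" n] assms in \<open>force simp: words_def\<close>)
  finally show ?thesis .
qed

lemma W2: "W 2 \<subseteq> Rm"
proof
  fix w assume "w \<in> W 2"
  then have "sl [] [] w \<in> Rm" by (auto simp: W_def)
  then show "w \<in> Rm" by (simp add: poly_mapping_eqI[of "sl [] [] w" w])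
qed

lemma tens_X: "a \<in> FL E \<Longrightarrow> w \<in> W n \<Longrightarrow> tens a w \<in> AW n"
  unfolding AW_def by (rule pm.span_base) auto

lemma tens_K: "t \<in> AW n \<Longrightarrow> b \<in> FL E \<Longrightarrow> tens t b \<in> AWA n"
  unfolding AW_def AWA_def by (erule plin_span_subset[OF plin_tens_left]) (auto intro!: pm.span_base)

lemma tens_Y: "k \<in> AWA p \<Longrightarrow> w \<in> W q \<Longrightarrow> tens k w \<in> AWAW (p + q)"
  unfolding AWA_def AWAW_def by (erule plin_span_subset[OF plin_tens_left]) (auto intro!: pm.span_base, blast)

lemma letter_FL: "u \<in> words E n \<Longrightarrow> delta u \<in> FL E"
  by (auto simp: delta_FL words_def)

lemma words_1: "u \<in> words E (Suc 0) \<Longrightarrow> \<exists>x. u = [x]"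
  by (auto simp: words_def length_Suc_conv)

lemma dl_X: "z \<in> AW (Suc n) \<Longrightarrow> dl z \<in> AW n"
  unfolding AW_def
proof (erule plin_span_subset[OF plin_ops(1)], clarify, fold AW_def)
  fix a w :: "'v list \<Rightarrow>\<^sub>0 'k" assume a: "a \<in> FL E" and w: "w \<in> W (Suc n)"
  have "dl (tens a w) \<in> pm.span (AW n)"
  proof (rule plin_span_subset[where f = "\<lambda>w. dl (tens a w)"])
    show "w \<in> pm.span {mul (delta u) w' | u w'. u \<in> words E 1 \<and> w' \<in> W n}"
      using W_left[of w 1 n] w by simp
    fix g assume "g \<in> {mul (delta u) w' | u w'. u \<in> words E 1 \<and> w' \<in> W n}"
    then obtain u w' where *: "u \<in> words E 1" "w' \<in> W n" "g = mul (delta u) w'" by auto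
    then obtain x where "u = [x]" using words_1[of u] by auto
    with * have "[x] \<in> words E 1" "w' \<in> W n" "g = mul (delta [x]) w'" by simp_all
    then show "dl (tens a g) \<in> pm.span (AW n)"
      by (auto simp: dl_tens intro!: pm.span_base tens_X mul_FL a letter_FL)
  qed (intro plin_intros5)
  then show "dl (tens a w) \<in> AW n"
    by (simp add: pm.span_eq_iff[THEN iffD2, OF subspaces(1)])
qed

lemma X0_keys: "z \<in> AW n \<Longrightarrow> (u, xs) \<in> keys z \<Longrightarrow> length xs = n"
proof -
  assume "z \<in> AW n"
  have "AW n \<subseteq> {z. keys z \<subseteq> {(u, xs). length xs = n}}"
    unfolding AW_def
  proof (rule pm.span_minimal[OF _ subspace_keys], clarify)
    fix a w :: "'v list \<Rightarrow>\<^sub>0 'k" and u xs assume "w \<in> W n" "(u, xs) \<in> keys (tens a w :: _ \<Rightarrow>\<^sub>0 'k)"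
    then show "length xs = n" using keys_tens[of a w] W_FE[of w n] by (auto simp: FE_def words_def)
  qed
  then show "(u, xs) \<in> keys z \<Longrightarrow> length xs = n" using \<open>z \<in> AW n\<close> by auto
qed

lemma dl_X0: "z \<in> AW 0 \<Longrightarrow> dl z = 0"
  by (rule plin_eqI[OF plin_ops(1) pmp.linear_zero]) (auto dest: X0_keys)

lemma dm_K: "k \<in> AWA (Suc n) \<Longrightarrow> dm k \<in> AWA n"
  unfolding AWA_def
proof (erule plin_span_subset[OF plin_dm], clarify, fold AWA_def)
  fix a w b :: "'v list \<Rightarrow>\<^sub>0 'k" assume a: "a \<in> FL E" and w: "w \<in> W (Suc n)" and b: "b \<in> FL E"
  have "dm (tens (tens a w) b) \<in> pm.span (AWA n)"
  proof (rule plin_span_subset[where f = "\<lambda>w. dm (tens (tens a w) b)"])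
    show "w \<in> pm.span {mul w' (delta u) | u w'. u \<in> words E 1 \<and> w' \<in> W n}"
      using W_right[of w n 1] w by simp
    fix g assume "g \<in> {mul w' (delta u) | u w'. u \<in> words E 1 \<and> w' \<in> W n}"
    then obtain u w' where *: "u \<in> words E 1" "w' \<in> W n" "g = mul w' (delta u)" by auto
    then obtain x where "u = [x]" using words_1[of u] by auto
    with * have "[x] \<in> words E 1" "w' \<in> W n" "g = mul w' (delta [x])" by simp_all
    then show "dm (tens (tens a g) b) \<in> pm.span (AWA n)"
      by (auto simp: dm_tens[OF W_FE[OF \<open>w' \<in> W n\<close>]] intro!: pm.span_base pm.subspace_scale[OF subspaces(2)] pm.subspace_neg[OF subspaces(2)]
          tens_X tens_K mul_FL a b letter_FL)
  qed (intro plin_intros5)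
  then show "dm (tens (tens a w) b) \<in> AWA n"
    by (simp add: pm.span_eq_iff[THEN iffD2, OF subspaces(2)])
qed

lemma dm_K0: "k \<in> AWA 0 \<Longrightarrow> dm k = 0"
  unfolding AWA_def
proof (erule plin_span_eqI[OF plin_dm pmp.linear_zero], clarify)
  fix a w b :: "'v list \<Rightarrow>\<^sub>0 'k" assume w: "w \<in> W 0"
  show "dm (tens (tens a w) b) = 0"
    by (rule trilinear_eqI[where f = "\<lambda>a w b. dm (tens (tens a w) b)" and g = "\<lambda>a w b. 0"])
      ((intro plin_intros5 pmp.linear_zero)+, use W_FE[OF w] in \<open>auto simp: FE_def words_def\<close>)
qed

lemma dl_K: "k \<in> AWA (Suc n) \<Longrightarrow> tmap dl (\<lambda>p. p) k \<in> AWA n"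
  unfolding AWA_def
  by (erule plin_span_subset[OF plin_tmap], fold AWA_def)
    (auto simp: tmap_tens plin_ops plin_ident intro!: pm.span_superset[THEN subsetD] tens_K dl_X tens_X)

lemma dl_K0: "k \<in> AWA 0 \<Longrightarrow> tmap dl (\<lambda>p. p) k = 0"
  unfolding AWA_def
  by (erule plin_span_eqI[OF plin_tmap pmp.linear_zero])
    (auto simp: tmap_tens plin_ops plin_ident dl_X0 tens_X)

lemma Y_induct:
  assumes "y \<in> AWAW n" "plin f" "pm.subspace S"
    and "\<And>k w' p q. k \<in> AWA p \<Longrightarrow> w' \<in> W q \<Longrightarrow> p + q = n \<Longrightarrow> f (tens k w') \<in> S"
  shows "f y \<in> S"
proof -
  have "f y \<in> pm.span S"
    using assms(1) unfolding AWAW_def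
    by (rule plin_span_subset[OF assms(2)]) (auto intro!: pm.span_base assms(4) tens_K tens_X)
  then show ?thesis by (simp add: pm.span_eq_iff[THEN iffD2, OF assms(3)])
qed

lemma Y_eqI:
  assumes "y \<in> AWAW n" "plin f" "plin g"
    and "\<And>k w' p q. k \<in> AWA p \<Longrightarrow> w' \<in> W q \<Longrightarrow> p + q = n \<Longrightarrow> f (tens k w') = g (tens k w')"
  shows "f y = g y"
  using assms(1) unfolding AWAW_def
  by (rule plin_span_eqI[OF assms(2,3)]) (auto intro!: assms(4) tens_K tens_X)

text \<open>A summand with p = 0 is sent to 0, so the truncated subtraction does no harm in degree
  0.\<close>

lemma D1_Y: "y \<in> AWAW n \<Longrightarrow> D1 y \<in> AWAW (n - 1)"
proof (erule Y_induct[OF _ plin_ops(5) subspaces(3)])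
  fix k w' p q assume *: "k \<in> AWA p" "w' \<in> W q" "p + q = n"
  show "D1 (tens k w') \<in> AWAW (n - 1)"
  proof (cases p)
    case 0
    then show ?thesis using * pm.subspace_0[OF subspaces(3)]
      by (simp add: D1_eq tmap_tens plin_tmap plin_ident dl_K0)
  next
    case (Suc p')
    then show ?thesis using * tens_Y[OF dl_K, of k p' w' q]
      by (auto simp: D1_eq tmap_tens plin_tmap plin_ident)
  qed
qed

lemma D2_Y: "y \<in> AWAW n \<Longrightarrow> D2 y \<in> AWAW (n - 1)"
proof (erule Y_induct[OF _ plin_ops(6) subspaces(3)])
  fix k w' p q assume *: "k \<in> AWA p" "w' \<in> W q" "p + q = n"
  show "D2 (tens k w') \<in> AWAW (n - 1)"
  proof (cases p)
    case 0
    then show ?thesis using * pm.subspace_0[OF subspaces(3)]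
      by (simp add: D2_eq tmap_tens plin_dm plin_ident dm_K0)
  next
    case (Suc p')
    then show ?thesis using * tens_Y[OF dm_K, of k p' w' q]
      by (auto simp: D2_eq tmap_tens plin_dm plin_ident)
  qed
qed

lemma swp_Y: "y \<in> AWAW n \<Longrightarrow> swp y \<in> AWAW n"
  unfolding AWAW_def
proof (erule plin_span_subset[OF plin_ops(10)], clarify)
  fix a w b w' :: "'v list \<Rightarrow>\<^sub>0 'k" and p q assume *: "a \<in> FL E" "w \<in> W p" "b \<in> FL E" "w' \<in> W q" "n = p + q"
  show "swp (tens (tens (tens a w) b) w') \<in> pm.span {tens (tens (tens a w) b) w' | a w b w' pa qa.
     a \<in> FL E \<and> w \<in> W pa \<and> b \<in> FL E \<and> w' \<in> W qa \<and> pa + qa = p + q}"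
    unfolding swp_tens[OF W_FE[OF *(2)] W_FE[OF *(4)]]
    by (intro pm.span_scale pm.span_base CollectI exI[of _ b] exI[of _ w'] exI[of _ a] exI[of _ w] exI[of _ q] exI[of _ p])
      (use * in auto)
qed

lemma bY_Y: "y \<in> AWAW n \<Longrightarrow> bY y \<in> AWAW (n - 1)" and eY_Y: "y \<in> AWAW n \<Longrightarrow> eY y \<in> AWAW (n - 1)"
proof -
  assume y: "y \<in> AWAW n"
  show "eY y \<in> AWAW (n - 1)" unfolding eY_eq by (intro swp_Y D2_Y y)
  then show "bY y \<in> AWAW (n - 1)" unfolding bY_def D3_eq
    by (intro pm.subspace_add[OF subspaces(3)] swp_Y D2_Y D1_Y y)
qed

lemma lw_FL: "a \<in> FL E \<Longrightarrow> lw h a \<in> FL E"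
  unfolding lw_def FL_def by (rule lin_in_subspace[OF subspace_keys], auto dest!: subsetD)

lemma wv_Y: "y \<in> AWAW n \<Longrightarrow> wv y \<in> AWAW n"
  unfolding AWAW_def
proof (erule plin_span_subset[OF plin_wt(3)], clarify)
  fix a w b w' :: "'v list \<Rightarrow>\<^sub>0 'k" and p q assume *: "a \<in> FL E" "w \<in> W p" "b \<in> FL E" "w' \<in> W q" "n = p + q"
  show "wv (tens (tens (tens a w) b) w') \<in> pm.span {tens (tens (tens a w) b) w' | a w b w' pa qa.
     a \<in> FL E \<and> w \<in> W pa \<and> b \<in> FL E \<and> w' \<in> W qa \<and> pa + qa = p + q}"
    unfolding wv_tens[OF W_FE[OF *(4)]]
    by (intro pm.span_base CollectI exI[of _ "lw (\<lambda>i. of_nat (i + q)) b"] exI[of _ w'] exI[of _ a] exI[of _ w] exI[of _ q] exI[of _ p])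
      (use * lw_FL in auto)
qed

lemma swp'_Y: "y \<in> AWAW n \<Longrightarrow> swp' y \<in> AWAW n"
  by (simp add: swp'_eq swp_Y wv_Y)

lemma wt_X: "z \<in> AW n \<Longrightarrow> wt h z \<in> AW n"
  unfolding AW_def
  by (erule plin_span_subset[OF plin_wt(2)], fold AW_def)
    (auto simp: wt_tens[OF W_FE] intro!: pm.span_superset[THEN subsetD] tens_X lw_FL)

lemma f1_X: "y \<in> AWAW n \<Longrightarrow> f1 y \<in> AW n"
  unfolding AWAW_def
proof (erule plin_span_subset[OF plin_ops(12), of _ _ "AW n", simplified pm.span_eq_iff[THEN iffD2, OF subspaces(1)]], clarify)
  fix a w b w' :: "'v list \<Rightarrow>\<^sub>0 'k" and p q assume *: "a \<in> FL E" "w \<in> W p" "b \<in> FL E" "w' \<in> W q" "n = p + q"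
  show "f1 (tens (tens (tens a w) b) w') \<in> AW (p + q)"
  proof (cases p)
    case 0
    then show ?thesis using * by (auto simp: f1_tens intro!: pm.subspace_scale[OF subspaces(1)] tens_X mul_FL)
  next
    case (Suc p')
    then have "lookup w [] = 0"
      using W_FE[OF *(2)] by (force simp: FE_def words_def in_keys_iff)
    then show ?thesis by (simp add: f1_tens pm.subspace_0[OF subspaces(1)])
  qed
qed

section \<open>The coproduct of W\<close>

definition dc :: "nat \<Rightarrow> ('v list \<Rightarrow>\<^sub>0 'k) \<Rightarrow> ('v key2 \<Rightarrow>\<^sub>0 'k)" where
  "dc i = lin (\<lambda>xs. delta (take i xs, drop i xs))"

text \<open>Columns and rows of the cut tensor are slices of \<open>w\<close>, hence lie in
  \<open>W i\<close> and \<open>W j\<close>. By \<open>in_span_tens\<close> this places the tensor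
  in the product of the two spaces, not only in each one-sided product.\<close>

lemma dc_W:
  assumes w: "w \<in> W (i + j)"
  shows "dc i w \<in> pm.span {tens p q | p q. p \<in> W i \<and> q \<in> W j}"
proof (rule in_span_tens[OF W_subspace W_subspace])
  have len: "length xs = i + j" if "xs \<in> keys w" for xs
    using W_FE[OF w] that by (auto simp: FE_def words_def)
  show "col y (dc i w) \<in> W i" for y
  proof -
    have "col y (dc i w) = (if length y = j then sl [] y w else 0)"
    proof (rule plin_eqI[where f = "\<lambda>w. col y (dc i w)" and g = "\<lambda>w. if length y = j then sl [] y w else 0"])
      fix xs assume xs: "xs \<in> keys w"
      have "xs = k @ y \<longleftrightarrow> take i xs = k \<and> drop i xs = y" if "length y = j" for k
        using len[OF xs] that by auto
      note * = this
      have c: "col y (dc i (delta xs)) = (if drop i xs = y then delta (take i xs) else (0 :: _ \<Rightarrow>\<^sub>0 'k))"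
        by (simp add: dc_def)
      show "col y (dc i (delta xs)) = (if length y = j then sl [] y (delta xs) else (0 :: _ \<Rightarrow>\<^sub>0 'k))"
      proof (cases "length y = j")
        case True
        show ?thesis
          unfolding c by (rule poly_mapping_eqI) (simp add: True lookup_single when_def *)
      next
        case False
        then have "drop i xs \<noteq> y" using len[OF xs] by auto
        with False show ?thesis by (simp add: c)
      qed
    next
      show "plin (\<lambda>w. if length y = j then sl [] y w else 0)"
        by (cases "length y = j") (simp_all add: plin_sl pmp.linear_zero)
    qed (unfold dc_def, intro plin_intros5)
    then show ?thesis using sl_W[of w "[]" i y] w pm.subspace_0[OF W_subspace] by auto
  qed
  show "row x (dc i w) \<in> W j" for x
  proof -
    have "row x (dc i w) = (if length x = i then sl x [] w else 0)"
    proof (rule plin_eqI[where f = "\<lambda>w. row x (dc i w)" and g = "\<lambda>w. if length x = i then sl x [] w else 0"])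
      fix xs assume xs: "xs \<in> keys w"
      have "xs = x @ k \<longleftrightarrow> take i xs = x \<and> drop i xs = k" if "length x = i" for k
        using that by (metis append_eq_conv_conj)
      note * = this
      have c: "row x (dc i (delta xs)) = (if take i xs = x then delta (drop i xs) else (0 :: _ \<Rightarrow>\<^sub>0 'k))"
        by (simp add: dc_def)
      show "row x (dc i (delta xs)) = (if length x = i then sl x [] (delta xs) else (0 :: _ \<Rightarrow>\<^sub>0 'k))"
      proof (cases "length x = i")
        case True
        show ?thesis
          unfolding c by (rule poly_mapping_eqI) (simp add: True lookup_single when_def *)
      next
        case False
        then have "take i xs \<noteq> x" using len[OF xs] by auto
        with False show ?thesis by (simp add: c)
      qed
    next
      show "plin (\<lambda>w. if length x = i then sl x [] w else 0)"
        by (cases "length x = i") (simp_all add: plin_sl pmp.linear_zero)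
    qed (unfold dc_def, intro plin_intros5)
    then show ?thesis using sl_W[of w x j "[]"] w pm.subspace_0[OF W_subspace] by auto
  qed
qed

lemma De_tens_dc:
  assumes "w \<in> FE E n"
  shows "De (tens a w) = (\<Sum>i\<le>n. lin (\<lambda>(x, y). tens (tens (tens a (delta x)) (delta [])) (delta y)) (dc i w))"
proof (rule plin_eqI[where f = "\<lambda>w. De (tens a w)" and
      g = "\<lambda>w. \<Sum>i\<le>n. lin (\<lambda>(x, y). tens (tens (tens a (delta x)) (delta [])) (delta y)) (dc i w)"])
  fix xs assume "xs \<in> keys w"
  then have "length xs = n" using assms by (auto simp: FE_def words_def)
  then show "De (tens a (delta xs)) = (\<Sum>i\<le>n. lin (\<lambda>(x, y). tens (tens (tens a (delta x)) (delta [])) (delta y)) (dc i (delta xs)))"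
    by (simp add: De_tens dc_def)
qed (auto simp: dc_def intro!: plin_intros5 pmp.linear_compose_sum)

lemma De_Y: "z \<in> AW n \<Longrightarrow> De z \<in> AWAW n"
  unfolding AW_def
proof (erule plin_span_subset[OF plin_ops(13), of _ _ "AWAW n", simplified pm.span_eq_iff[THEN iffD2, OF subspaces(3)]], clarify)
  fix a w :: "'v list \<Rightarrow>\<^sub>0 'k" assume a: "a \<in> FL E" and w: "w \<in> W n"
  have "lin (\<lambda>(x, y). tens (tens (tens a (delta x)) (delta [])) (delta y)) (dc i w) \<in> pm.span (AWAW n)" if i: "i \<le> n" for i
  proof (rule plin_span_subset[OF plin_lin])
    show "dc i w \<in> pm.span {tens p q | p q. p \<in> W i \<and> q \<in> W (n - i)}"
      using dc_W[of w i "n - i"] w i by simp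
    fix g :: "'v key2 \<Rightarrow>\<^sub>0 'k" assume "g \<in> {tens p q | p q. p \<in> W i \<and> q \<in> W (n - i)}"
    then obtain p q where g: "g = tens p q" "p \<in> W i" "q \<in> W (n - i)" by auto
    have eq: "lin (\<lambda>(x, y). tens (tens (tens a (delta x)) (delta [])) (delta y)) g = tens (tens (tens a p) (delta [])) q"
      unfolding g(1) by (rule bilinear_eqI[where f = "\<lambda>p q. lin (\<lambda>(x, y). tens (tens (tens a (delta x)) (delta [])) (delta y)) (tens p q)"
            and g = "\<lambda>p q. tens (tens (tens a p) (delta [])) q"]) ((intro plin_intros5)+, simp)
    have "tens (tens (tens a p) (delta [])) q \<in> AWAW n"
      using tens_Y[OF tens_K[OF tens_X[OF a g(2)], of "delta []"] g(3)] i by (simp add: delta_FL)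
    then show "lin (\<lambda>(x, y). tens (tens (tens a (delta x)) (delta [])) (delta y)) g \<in> pm.span (AWAW n)"
      unfolding eq by (rule pm.span_base)
  qed
  then show "De (tens a w) \<in> AWAW n"
    unfolding De_tens_dc[OF W_FE[OF w]]
    by (intro pm.subspace_sum[OF subspaces(3)]) (simp add: pm.span_eq_iff[THEN iffD2, OF subspaces(3)])
qed

text \<open>Since \<open>f1\<close> is a left inverse of \<open>De\<close> and both commute with the
  differentials, \<open>bX z = f1 (bY (De z))\<close>, and the range is inherited from the larger
  complex.\<close>

lemma bX_X: "z \<in> AW n \<Longrightarrow> bX z \<in> AW (n - 1)" and eX_X: "z \<in> AW n \<Longrightarrow> eX z \<in> AW (n - 1)"
  using f1_X[OF bY_Y[OF De_Y]] f1_X[OF eY_Y[OF De_Y]] by (simp_all add: f1_bY f1_eY f1_De)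

subsection \<open>Working modulo the relations of the algebra\<close>

lemma rA_mul: "rA (mul (rA p) q) = rA (mul p q)" "rA (mul p (rA q)) = rA (mul p q)"
proof -
  have 0: "rA (p - rA p) = 0" for p by (simp add: plin_diff[OF plin_rA] rA_idem)
  show "rA (mul (rA p) q) = rA (mul p q)" "rA (mul p (rA q)) = rA (mul p q)"
    using rA_mul_right_0[OF 0, of p q] rA_mul_left_0[OF 0, of p q]
    by (simp_all add: plin_diff[OF plin_mul_left] plin_diff[OF plin_mul_right] plin_diff[OF plin_rA])
qed

lemma nX_dl: "nX (dl (nX z)) = nX (dl z)"
proof (rule plin_eqI[where f = "\<lambda>z. nX (dl (nX z))" and g = "\<lambda>z. nX (dl z)"])
  fix k :: "'v key2"
  obtain u xs where k: "k = (u, xs)" by (metis surj_pair)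
  have *: "nX (dl (tens (rA a) (delta xs))) = nX (dl (tens a (delta xs)))" for a
  proof (cases xs)
    case Nil
    have "dl (tens a (delta [])) = 0" for a :: "'v list \<Rightarrow>\<^sub>0 'k"
      by (rule plin_eqI[where f = "\<lambda>a. dl (tens a (delta []))" and g = "\<lambda>a. 0"])
        ((intro plin_intros5 pmp.linear_zero)+, simp)
    then show ?thesis by (simp add: Nil)
  next
    case (Cons x ws)
    have "dl (tens a (delta xs)) = tens (mul a (delta [x])) (delta ws)" for a :: "'v list \<Rightarrow>\<^sub>0 'k"
      using dl_tens[of a x "delta ws"] by (simp add: Cons)
    then show ?thesis by (simp add: n_tens rA_mul)
  qed
  show "nX (dl (nX (delta k))) = nX (dl (delta k))"
    using *[of "delta u"] n_tens(1)[of "delta u" "delta xs"] unfolding k by simp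
qed (intro plin_intros5)+

lemma nK_dl: "nK (tmap dl (\<lambda>p. p) (nK k)) = nK (tmap dl (\<lambda>p. p) k)"
proof (rule plin_eqI[where f = "\<lambda>k. nK (tmap dl (\<lambda>p. p) (nK k))" and g = "\<lambda>k. nK (tmap dl (\<lambda>p. p) k)"])
  fix k :: "'v key3"
  obtain t v where "k = (t, v)" by (metis surj_pair)
  then have k: "delta k = tens (delta t) (delta v :: _ \<Rightarrow>\<^sub>0 'k)" by simp
  show "nK (tmap dl (\<lambda>p. p) (nK (delta k))) = nK (tmap dl (\<lambda>p. p) (delta k))"
    unfolding k by (simp add: tmap_tens plin_ops plin_ident n_tens nX_dl rA_idem del: tens_single)
qed (intro plin_intros5)+

lemma nK_dm: "nK (dm (nK k)) = nK (dm k)"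
proof (rule plin_eqI[where f = "\<lambda>k. nK (dm (nK k))" and g = "\<lambda>k. nK (dm k)"])
  fix k :: "'v key3"
  obtain u xs v where k: "k = ((u, xs), v)" by (metis surj_pair)
  have *: "nK (dm (tens (tens (rA a) (delta xs)) (rA b))) = nK (dm (tens (tens a (delta xs)) b))" for a b
  proof (cases xs rule: rev_cases)
    case Nil
    have "dm (tens (tens a (delta [])) b) = 0" for a b :: "'v list \<Rightarrow>\<^sub>0 'k"
      by (rule bilinear_eqI[where f = "\<lambda>a b. dm (tens (tens a (delta [])) b)" and g = "\<lambda>a b. 0"])
        ((intro plin_intros5 pmp.linear_zero)+, simp)
    then show ?thesis by (simp add: Nil)
  next
    case (snoc ws x)
    have "delta ws \<in> FE UNIV (length ws)" by (simp add: delta_FE)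
    from dm_tens[OF this, of _ x]
    have "dm (tens (tens a (delta xs)) b) = - scl ((- 1) ^ length ws) (tens (tens a (delta ws)) (mul (delta [x]) b))"
      for a b :: "'v list \<Rightarrow>\<^sub>0 'k"
      by (simp add: snoc)
    then show ?thesis
      by (simp add: n_tens rA_mul rA_idem plin_scl[OF plin_n(2)] plin_uminus[OF plin_n(2)])
  qed
  show "nK (dm (nK (delta k))) = nK (dm (delta k))"
    using *[of "delta u" "delta v"] n_tens(2)[of "tens (delta u) (delta xs)" "delta v"]
      n_tens(1)[of "delta u" "delta xs"] unfolding k by (simp del: dm_single)
qed (intro plin_intros5)+

lemma nK_dK: "nK (dK (nK k)) = nK (dK k)"
  by (simp add: dK_eq plin_add[OF plin_n(2)] nK_dl nK_dm)

lemma nY_D1: "nY (D1 (nY y)) = nY (D1 y)"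
proof (rule plin_eqI[where f = "\<lambda>y. nY (D1 (nY y))" and g = "\<lambda>y. nY (D1 y)"])
  fix k :: "'v key4"
  obtain t v where "k = (t, v)" by (metis surj_pair)
  then have k: "delta k = tens (delta t) (delta v :: _ \<Rightarrow>\<^sub>0 'k)" by simp
  show "nY (D1 (nY (delta k))) = nY (D1 (delta k))"
    unfolding k by (simp add: D1_eq tmap_tens plin_tmap plin_ident n_tens nK_dl del: tens_single)
qed (intro plin_intros5)+

lemma nY_D2: "nY (D2 (nY y)) = nY (D2 y)"
proof (rule plin_eqI[where f = "\<lambda>y. nY (D2 (nY y))" and g = "\<lambda>y. nY (D2 y)"])
  fix k :: "'v key4"
  obtain t v where "k = (t, v)" by (metis surj_pair)
  then have k: "delta k = tens (delta t) (delta v :: _ \<Rightarrow>\<^sub>0 'k)" by simp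
  show "nY (D2 (nY (delta k))) = nY (D2 (delta k))"
    unfolding k by (simp add: D2_eq tmap_tens plin_dm plin_ident n_tens nK_dm del: tens_single)
qed (intro plin_intros5)+

lemma delta4: "delta (((u, xs), v), ys) = tens (tens (tens (delta u) (delta xs)) (delta v)) (delta ys)"
  by simp

lemma nY_swp: "nY (swp y) = swp (nY y)"
proof (rule plin_eqI[where f = "\<lambda>y. nY (swp y)" and g = "\<lambda>y. swp (nY y)"])
  fix k :: "'v key4"
  obtain u xs v ys where k: "k = (((u, xs), v), ys)" by (metis surj_pair)
  have F: "delta xs \<in> FE UNIV (length xs)" "delta ys \<in> FE UNIV (length ys)" by (simp_all add: delta_FE)
  show "nY (swp (delta k)) = swp (nY (delta k))"
    unfolding k delta4 swp_tens[OF F] n_tens plin_scl[OF plin_n(3)] ..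
qed (intro plin_intros5)+

text \<open>On one word \<open>rA\<close> produces only words of the same length, so weights can be
  evaluated before or after it.\<close>

lemma rA_lw: "rA (lw h p) = lw h (rA p)"
proof (rule plin_eqI[where f = "\<lambda>p. rA (lw h p)" and g = "\<lambda>p. lw h (rA p)"])
  fix v :: "'v list"
  have "lw h (rA (delta v)) = lin (\<lambda>u. scl (h (length v)) (delta u)) (rA (delta v))"
    unfolding lw_def using rA_keys[of v] by (intro lin_cong) auto
  also have "\<dots> = scl (h (length v)) (rA (delta v))"
    by (simp only: lin_scl_fun lin_delta)
  also have "\<dots> = rA (lw h (delta v))"
    by (simp add: plin_scl[OF plin_rA, symmetric])
  finally show "rA (lw h (delta v)) = lw h (rA (delta v))" ..
qed (intro plin_intros5)+

lemma nY_wv: "nY (wv y) = wv (nY y)"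
proof (rule plin_eqI[where f = "\<lambda>y. nY (wv y)" and g = "\<lambda>y. wv (nY y)"])
  fix k :: "'v key4"
  obtain u xs v ys where k: "k = (((u, xs), v), ys)" by (metis surj_pair)
  have F: "delta ys \<in> FE UNIV (length ys)" by (simp add: delta_FE)
  show "nY (wv (delta k)) = wv (nY (delta k))"
    unfolding k delta4 wv_tens[OF F] n_tens rA_lw ..
qed (intro plin_intros5)+

end

section \<open>The filtration by the length of the last word\<close>

lemma lookup_col:
  fixes m :: "'a \<times> 'b \<Rightarrow>\<^sub>0 'c::field"
  shows "lookup (col y m) x = lookup m (x, y)"
proof -
  have *: "lookup ((case k of (u, v) \<Rightarrow> if v = y then delta u else 0) :: _ \<Rightarrow>\<^sub>0 'c) x = (if k = (x, y) then 1 else 0)"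
    for k by (auto simp: lookup_single when_def split: prod.splits)
  show ?thesis
    unfolding col_def lin_def
    by (simp add: lookup_sum * if_distrib[of "\<lambda>z. _ * z"] in_keys_iff cong: if_cong)
qed

lemma col_eqI: "(\<And>y. col y m = col y m') \<Longrightarrow> m = m'"
  by (rule poly_mapping_eqI) (metis lookup_col surj_pair)

definition mu :: "('v key3 \<Rightarrow>\<^sub>0 'k::field) \<Rightarrow> ('v list \<Rightarrow>\<^sub>0 'k)" where
  "mu = lin (\<lambda>((u, xs), v). if xs = [] then delta (u @ v) else 0)"

definition pr :: "nat \<Rightarrow> ('v key4 \<Rightarrow>\<^sub>0 'k::field) \<Rightarrow> ('v key4 \<Rightarrow>\<^sub>0 'k)" where
  "pr q = lin (\<lambda>(t, ys). if length ys = q then delta (t, ys) else 0)"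

lemma plin_pr: "plin mu" "plin (pr q)"
  unfolding mu_def pr_def by (rule plin_lin)+

lemma mu_single [simp]: "mu (single ((u, xs), v) c) = (if xs = [] then single (u @ v) c else 0)"
  by (simp add: mu_def)

lemma pr_single [simp]: "pr q (single (t, ys) c) = (if length ys = q then single (t, ys) c else 0)"
  by (simp add: pr_def)

lemma mu_tens: "mu (tens (tens a w) b) = scl (lookup w []) (mul a b)"
  by (rule trilinear_eqI[where f = "\<lambda>a w b. mu (tens (tens a w) b)" and g = "\<lambda>a w b. scl (lookup w []) (mul a b)"])
    ((intro plin_intros4 plin_pr[THEN plin_comp[rotated]])+, auto simp: lookup_single)

lemma f1_eq: "f1 y = tmap mu (\<lambda>p. p) y"
proof (rule plin_eqI[where f = f1 and g = "\<lambda>y. tmap mu (\<lambda>p. p) y"])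
  fix k :: "'a key4"
  obtain u xs v ys where k: "k = (((u, xs), v), ys)" by (metis surj_pair)
  show "f1 (delta k) = tmap mu (\<lambda>p. p) (delta k :: _ \<Rightarrow>\<^sub>0 'b)"
    unfolding k by simp
qed (intro plin_ops plin_tmap)+

lemma pr_tens:
  assumes "w \<in> FE E n"
  shows "pr q (tens k w) = (if n = q then tens k w else 0)"
proof (rule bilinear_eqI[where f = "\<lambda>k w. pr q (tens k w)" and g = "\<lambda>k w. if n = q then tens k w else 0"])
  show "pr q (tens (delta x) (delta y)) = (if n = q then tens (delta x) (delta y) else (0 :: _ \<Rightarrow>\<^sub>0 'b))" if "y \<in> keys w" for x y
    using that assms by (auto simp: FE_def words_def)
  show "plin (\<lambda>p. if n = q then tens p r else 0)" "plin (\<lambda>p. if n = q then tens r' p else 0)"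
    for r :: "'a list \<Rightarrow>\<^sub>0 'b" and r' :: "'a key3 \<Rightarrow>\<^sub>0 'b"
    by (cases "n = q"; simp add: plin_tens_left plin_tens_right pmp.linear_zero)+
qed (intro plin_intros4 plin_pr[THEN plin_comp[rotated]])+

text \<open>\<open>D3\<close> and \<open>eY\<close> shorten the last word by one letter, while
  \<open>D1\<close> and \<open>D2\<close> form the vertical differential.\<close>

lemma pr_bY: "pr q (bY y) = tmap dK (\<lambda>p. p) (pr q y) + (D3 (pr (Suc q) y) + eY (pr (Suc q) y))"
  unfolding D12_eq[symmetric]
proof (rule plin_eqI[where f = "\<lambda>y. pr q (bY y)" and
      g = "\<lambda>y. D1 (pr q y) + D2 (pr q y) + (D3 (pr (Suc q) y) + eY (pr (Suc q) y))"])
  fix k :: "'a key4"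
  obtain u xs v ys where k: "k = (((u, xs), v), ys)" by (metis surj_pair)
  show "pr q (bY (delta k)) = D1 (pr q (delta k)) + D2 (pr q (delta k)) + (D3 (pr (Suc q) (delta k)) + eY (pr (Suc q) (delta k)) :: _ \<Rightarrow>\<^sub>0 'b)"
    unfolding k by (cases "length ys") (auto simp: op_simps plin_pr[THEN plin_add] plin_pr[THEN plin_zero])
qed (intro plin_intros4 plin_pr[THEN plin_comp[rotated]])+

section \<open>Compatibility with the relations, and squares that vanish modulo them\<close>

context koszul_model begin

lemma nX_f1: "nX (f1 (nY y)) = nX (f1 y)"
proof (rule plin_eqI[where f = "\<lambda>y. nX (f1 (nY y))" and g = "\<lambda>y. nX (f1 y)"])
  fix k :: "'v key4"
  obtain u xs v ys where k: "k = (((u, xs), v), ys)" by (metis surj_pair)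
  show "nX (f1 (nY (delta k))) = nX (f1 (delta k))"
    unfolding k delta4 n_tens f1_tens plin_scl[OF plin_n(1)] rA_mul ..
qed (intro plin_intros5)+

lemma nY_De: "nY (De z) = De (nX z)"
proof (rule plin_eqI[where f = "\<lambda>z. nY (De z)" and g = "\<lambda>z. De (nX z)"])
  fix k :: "'v key2"
  obtain u xs where "k = (u, xs)" by (metis surj_pair)
  then have k: "delta k = tens (delta u) (delta xs :: _ \<Rightarrow>\<^sub>0 'k)" by simp
  show "nY (De (delta k)) = De (nX (delta k))"
    unfolding k n_tens De_tens plin_sum[OF plin_n(3)] rA_Nil ..
qed (intro plin_intros5)+

lemma nX_wt: "nX (wt h z) = wt h (nX z)"
proof (rule plin_eqI[where f = "\<lambda>z. nX (wt h z)" and g = "\<lambda>z. wt h (nX z)"])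
  fix k :: "'v key2"
  obtain u xs where "k = (u, xs)" by (metis surj_pair)
  then have k: "delta k = tens (delta u) (delta xs :: _ \<Rightarrow>\<^sub>0 'k)" by simp
  have F: "delta xs \<in> FE UNIV (length xs)" by (simp add: delta_FE)
  show "nX (wt h (delta k)) = wt h (nX (delta k))"
    unfolding k wt_tens[OF F] n_tens rA_lw ..
qed (intro plin_intros5)+

lemma nY_cong:
  assumes "nY p = nY q"
  shows "nY (D1 p) = nY (D1 q)" "nY (D2 p) = nY (D2 q)" "nY (swp p) = nY (swp q)" "nY (swp' p) = nY (swp' q)"
    "nY (D3 p) = nY (D3 q)" "nY (eY p) = nY (eY q)" "nY (bY p) = nY (bY q)" "nX (f1 p) = nX (f1 q)"
proof -
  have 1: "nY (D1 p) = nY (D1 q)" "nY (D2 p) = nY (D2 q)" "nY (swp p) = nY (swp q)" "nX (f1 p) = nX (f1 q)"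
    if "nY p = nY q" for p q
    using nY_D1[of p] nY_D1[of q] nY_D2[of p] nY_D2[of q] nX_f1[of p] nX_f1[of q] that
    by (simp_all add: nY_swp)
  show "nY (swp' p) = nY (swp' q)" using assms by (simp add: swp'_eq nY_swp nY_wv)
  show 2: "nY (D3 p) = nY (D3 q)" "nY (eY p) = nY (eY q)"
    unfolding D3_eq eY_eq by (intro 1 assms)+
  show "nY (bY p) = nY (bY q)"
    by (simp add: bY_def plin_add[OF plin_n(3)] 1[OF assms] 2)
  show "nY (D1 p) = nY (D1 q)" "nY (D2 p) = nY (D2 q)" "nY (swp p) = nY (swp q)" "nX (f1 p) = nX (f1 q)"
    by (rule 1[OF assms])+
qed

lemma nY_0:
  assumes "nY p = 0"
  shows "nY (D1 p) = 0" "nY (D2 p) = 0" "nY (swp p) = 0" "nY (swp' p) = 0"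
    "nY (D3 p) = 0" "nY (eY p) = 0" "nY (bY p) = 0" "nX (f1 p) = 0"
  using nY_cong[of p 0] assms
  by (simp_all add: plin_n[THEN plin_zero] plin_ops[THEN plin_zero])

text \<open>Transported from the large complex, where \<open>bX\<close> and \<open>eX\<close> are
  \<open>f1\<close> after \<open>bY\<close> and \<open>eY\<close> after \<open>De\<close>.\<close>

lemma nX_cong:
  assumes "nX p = nX q"
  shows "nX (bX p) = nX (bX q)" "nX (eX p) = nX (eX q)"
proof -
  have "nY (De p) = nY (De q)" by (simp add: nY_De assms)
  from nY_cong(7)[OF this, THEN nY_cong(8)] nY_cong(6)[OF this, THEN nY_cong(8)]
  show "nX (bX p) = nX (bX q)" "nX (eX p) = nX (eX q)"
    by (simp_all add: f1_bY f1_eY f1_De)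
qed

lemma nX_0:
  assumes "nX p = 0"
  shows "nX (bX p) = 0" "nX (eX p) = 0"
  using nX_cong[of p 0] assms by (simp_all add: plin_n[THEN plin_zero] plin_ops[THEN plin_zero])

text \<open>The two letters moved into A are the first two letters of an element of W, and these
  form a relation, which is zero in A. In degrees 0 and 1 there are not enough letters.\<close>

lemma nX_dl_dl:
  assumes a: "a \<in> FL E" and w: "w \<in> W n"
  shows "nX (dl (dl (tens a w))) = 0"
proof -
  consider "n = 0" | "n = 1" | m where "n = 2 + m"
    by (metis One_nat_def add_2_eq_Suc not0_implies_Suc)
  then show ?thesis
  proof cases
    case 1
    then show ?thesis using dl_X0[OF tens_X[OF a w[unfolded 1]]]
      by (simp add: plin_zero[OF plin_ops(1)] plin_zero[OF plin_n(1)])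
  next
    case 2
    then show ?thesis using dl_X0[OF dl_X[of "tens a w" 0]] tens_X[OF a w]
      by (simp add: plin_zero[OF plin_n(1)])
  next
    case (3 m)
    show ?thesis
    proof (rule plin_span_eqI[where f = "\<lambda>w. nX (dl (dl (tens a w)))" and g = "\<lambda>w. 0"])
      show "w \<in> pm.span {mul w' (delta v) | v w'. v \<in> words E m \<and> w' \<in> W 2}"
        using W_right[of w 2 m] w 3 by simp
      fix x assume "x \<in> {mul w' (delta v) | v w'. v \<in> words E m \<and> w' \<in> W 2}"
      then obtain v r where x: "x = mul r (delta v)" "r \<in> W 2" by auto
      have r: "rA r = 0" "r \<in> FE E 2" using x W2 rA_Rm W_FE by auto
      have "dl (dl (tens a (mul r (delta v)))) = tens (mul a r) (delta v)"
        by (rule bilinear_eqI[where f = "\<lambda>a r. dl (dl (tens a (mul r (delta v))))" and g = "\<lambda>a r. tens (mul a r) (delta v)"])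
          ((intro plin_intros5)+, use r(2) in \<open>auto simp: FE_def words_def length_Suc_conv numeral_2_eq_2 dest!: subsetD\<close>)
      then show "nX (dl (dl (tens a x))) = 0"
        by (simp add: x n_tens rA_mul_left_0 r)
    qed (intro plin_intros5 pmp.linear_zero)+
  qed
qed

lemma nK_dm_dm:
  assumes a: "a \<in> FL E" and w: "w \<in> W n" and b: "b \<in> FL E"
  shows "nK (dm (dm (tens (tens a w) b))) = 0"
proof -
  have t: "tens (tens a w) b \<in> AWA n" by (intro tens_K tens_X a w b)
  consider "n = 0" | "n = 1" | m where "n = m + 2"
    by (metis One_nat_def add_2_eq_Suc' not0_implies_Suc)
  then show ?thesis
  proof cases
    case 1
    then show ?thesis using dm_K0 t
      by (simp add: plin_zero[OF plin_dm] plin_zero[OF plin_n(2)])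
  next
    case 2
    then show ?thesis using dm_K0[OF dm_K[of _ 0]] t
      by (simp add: plin_zero[OF plin_n(2)])
  next
    case (3 m)
    show ?thesis
    proof (rule plin_span_eqI[where f = "\<lambda>w. nK (dm (dm (tens (tens a w) b)))" and g = "\<lambda>w. 0"])
      show "w \<in> pm.span {mul (delta u) w' | u w'. u \<in> words E m \<and> w' \<in> W 2}"
        using W_left[of w m 2] w 3 by simp
      fix x assume "x \<in> {mul (delta u) w' | u w'. u \<in> words E m \<and> w' \<in> W 2}"
      then obtain v r where x: "x = mul (delta v) r" "r \<in> W 2" by auto
      have r: "rA r = 0" "r \<in> FE E 2" using x W2 rA_Rm W_FE by auto
      \<comment> \<open>The two signs belong to words of consecutive lengths, so their product is
        -1.\<close>
      have "dm (dm (tens (tens a (mul (delta v) r)) b)) = scl (- 1) (tens (tens a (delta v)) (mul r b))"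
      proof (rule trilinear_eqI[where f = "\<lambda>a r b. dm (dm (tens (tens a (mul (delta v) r)) b))"
            and g = "\<lambda>a r b. scl (- 1) (tens (tens a (delta v)) (mul r b))"])
        fix u y u' assume "y \<in> keys r"
        then have "length y = 2" using r(2) by (auto simp: FE_def words_def)
        then obtain c d where y: "y = [c, d]" by (auto simp: length_Suc_conv numeral_2_eq_2)
        have "butlast (v @ [c, d]) = v @ [c]" by (simp add: butlast_append)
        then show "dm (dm (tens (tens (delta u) (mul (delta v) (delta y))) (delta u'))) =
            scl (- 1) (tens (tens (delta u) (delta v)) (mul (delta y) (delta u' :: _ \<Rightarrow>\<^sub>0 'k)))"
          by (cases "even (length v)") (simp_all add: y single_uminus plin_uminus[OF plin_dm])
      qed (intro plin_intros5)+
      then show "nK (dm (dm (tens (tens a x) b))) = 0"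
        by (simp add: x n_tens rA_mul_right_0 r plin_uminus[OF plin_n(2)])
    qed (intro plin_intros5 pmp.linear_zero)+
  qed
qed

lemma nY_D1_D1:
  assumes "y \<in> AWAW n"
  shows "nY (D1 (D1 y)) = 0"
proof (rule plin_span_eqI[where f = "\<lambda>y. nY (D1 (D1 y))" and g = "\<lambda>y. 0", OF _ _ assms[unfolded AWAW_def]])
  fix y assume "y \<in> {tens (tens (tens a w) b) w' | a w b w' p q.
     a \<in> FL E \<and> w \<in> W p \<and> b \<in> FL E \<and> w' \<in> W q \<and> p + q = n}"
  then show "nY (D1 (D1 y)) = 0"
    by (auto simp: D1_eq tmap_tens plin_tmap plin_ident plin_ops n_tens nX_dl_dl)
qed (intro plin_intros5 pmp.linear_zero)+

lemma nY_D2_D2: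
  assumes "y \<in> AWAW n"
  shows "nY (D2 (D2 y)) = 0"
proof (rule plin_span_eqI[where f = "\<lambda>y. nY (D2 (D2 y))" and g = "\<lambda>y. 0", OF _ _ assms[unfolded AWAW_def]])
  fix y assume "y \<in> {tens (tens (tens a w) b) w' | a w b w' p q.
     a \<in> FL E \<and> w \<in> W p \<and> b \<in> FL E \<and> w' \<in> W q \<and> p + q = n}"
  then show "nY (D2 (D2 y)) = 0"
    by (auto simp: D2_eq tmap_tens plin_tmap plin_ident plin_dm n_tens nK_dm_dm)
qed (intro plin_intros5 pmp.linear_zero)+

text \<open>\<open>D3\<close> and \<open>eY\<close> square to zero by rotation from
  \<open>D1\<close> and \<open>D2\<close>. The anticommutator of \<open>bY\<close> and
  \<open>eY\<close> is twice the square of \<open>eY\<close>, since the cross terms cancel.\<close>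

lemma nY_squares:
  assumes y: "y \<in> AWAW n"
  shows "nY (bY (bY y)) = 0" "nY (bY (eY y)) = - nY (eY (bY y))" "nY (eY (eY y)) = 0"
proof -
  have "nY (D3 (D3 y)) = 0" "nY (eY (eY y)) = 0"
    using nY_0(3)[OF nY_D1_D1[OF swp_Y[OF y]]] nY_0(3)[OF nY_D2_D2[OF swp_Y[OF y]]]
    by (simp_all add: swp_D)
  moreover note nY_D1_D1[OF y] nY_D2_D2[OF y]
  ultimately show "nY (bY (bY y)) = 0" "nY (eY (eY y)) = 0"
    by (simp_all add: bY_bY plin_add[OF plin_n(3)])
  have "nY (bY (eY y)) + nY (eY (bY y)) = 0"
    using \<open>nY (eY (eY y)) = 0\<close> by (simp add: plin_add[OF plin_n(3), symmetric] bY_eY) (simp add: plin_add[OF plin_n(3)])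
  then show "nY (bY (eY y)) = - nY (eY (bY y))" by (simp add: eq_neg_iff_add_eq_0)
qed

lemma nX_squares:
  assumes z: "z \<in> AW n"
  shows "nX (bX (bX z)) = 0" "nX (bX (eX z)) = - nX (eX (bX z))" "nX (eX (eX z)) = 0"
proof -
  note sq = nY_squares[OF De_Y[OF z]]
  show "nX (bX (bX z)) = 0" "nX (eX (eX z)) = 0"
    using nY_0(8)[OF sq(1)] nY_0(8)[OF sq(3)] by (simp_all add: f1_bY f1_eY f1_De)
  have "nY (bY (eY (De z)) + eY (bY (De z))) = 0"
    by (simp add: plin_add[OF plin_n(3)] sq(2))
  from nY_0(8)[OF this] have "nX (bX (eX z)) + nX (eX (bX z)) = 0"
    by (simp add: plin_add[OF plin_ops(12)] plin_add[OF plin_n(1)] f1_bY f1_eY f1_De)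
  then show "nX (bX (eX z)) = - nX (eX (bX z))" by (simp add: eq_neg_iff_add_eq_0)
qed

end

section \<open>Lifting along the projection for a Koszul algebra\<close>

context koszul_model begin

text \<open>Vanishing of the positive homology of K(A), stated on representatives: equality of
  chains is equality after \<open>nK\<close>.\<close>

definition koszul_exact :: bool where
  "koszul_exact \<longleftrightarrow> (\<forall>n>0. \<forall>k\<in>AWA n. nK (dK k) = 0 \<longrightarrow> (\<exists>k'\<in>AWA (Suc n). nK (dK k') = nK k))"

definition AWAV :: "nat \<Rightarrow> nat \<Rightarrow> ('v key4 \<Rightarrow>\<^sub>0 'k) set" where
  "AWAV p q = pm.span {tens k w | k w. k \<in> AWA p \<and> w \<in> W q}"

lemma tens_AWAV: "k \<in> AWA p \<Longrightarrow> w \<in> W q \<Longrightarrow> tens k w \<in> AWAV p q"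
  unfolding AWAV_def by (rule pm.span_base) blast

lemma subspace_AWAV: "pm.subspace (AWAV p q)"
  unfolding AWAV_def by (rule pm.subspace_span)

lemma AWAV_eqI:
  assumes "y \<in> AWAV p q" "plin f" "plin g"
    and "\<And>k w. k \<in> AWA p \<Longrightarrow> w \<in> W q \<Longrightarrow> f (tens k w) = g (tens k w)"
  shows "f y = g y"
  using assms(1) unfolding AWAV_def by (rule plin_span_eqI[OF assms(2,3)]) (auto intro!: assms(4))

lemma AWAV_induct:
  assumes "y \<in> AWAV p q" "plin f" "pm.subspace S"
    and "\<And>k w. k \<in> AWA p \<Longrightarrow> w \<in> W q \<Longrightarrow> f (tens k w) \<in> S"
  shows "f y \<in> S"
proof -
  have "f y \<in> pm.span S"
    using assms(1) unfolding AWAV_def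
    by (rule plin_span_subset[OF assms(2)]) (auto intro!: pm.span_base assms(4))
  then show ?thesis by (simp add: pm.span_eq_iff[THEN iffD2, OF assms(3)])
qed

lemma AWAV_AWAW: "y \<in> AWAV p q \<Longrightarrow> y \<in> AWAW (p + q)"
  by (rule AWAV_induct[where f = "\<lambda>y. y", OF _ plin_ident subspaces(3)]) (auto intro: tens_Y)

lemma col_AWAV: "y \<in> AWAV p q \<Longrightarrow> col ys y \<in> AWA p"
  by (rule AWAV_induct[where f = "col ys", OF _ plin_col subspaces(2)])
    (auto simp: col_tens intro: pm.subspace_scale[OF subspaces(2)])

lemma pr_AWAW:
  assumes "y \<in> AWAW (p + q)"
  shows "pr q y \<in> AWAV p q"
proof (rule Y_induct[where f = "pr q", OF assms plin_pr(2)])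
  show "pm.subspace (AWAV p q)" by (rule subspace_AWAV)
  fix k w p' q' assume *: "k \<in> AWA p'" "w \<in> W q'" "p' + q' = p + q"
  show "pr q (tens k w) \<in> AWAV p q"
    using * by (auto simp: pr_tens[OF W_FE[OF *(2)]] intro!: tens_AWAV pm.subspace_0[OF subspace_AWAV])
qed

lemma pr_AWAW_0:
  assumes "y \<in> AWAW n" "n < q"
  shows "pr q y = 0"
proof (rule Y_eqI[where f = "pr q" and g = "\<lambda>y. 0", OF assms(1) plin_pr(2) pmp.linear_zero])
  fix k w p' q' assume *: "k \<in> AWA p'" "w \<in> W q'" "p' + q' = n"
  show "pr q (tens k w) = 0"
    using * assms(2) by (auto simp: pr_tens[OF W_FE[OF *(2)]])
qed

lemma pr_AWAV: "y \<in> AWAV p q \<Longrightarrow> pr r y = (if q = r then y else 0)"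
proof (rule AWAV_eqI[where f = "pr r" and g = "\<lambda>y. if q = r then y else 0", OF _ plin_pr(2)])
  show "plin (\<lambda>y. if q = r then y else 0)" by (cases "q = r") (simp_all add: plin_ident pmp.linear_zero)
qed (auto simp: pr_tens[OF W_FE])

lemma sum_pr:
  assumes "y \<in> AWAW n"
  shows "y = (\<Sum>q\<le>n. pr q y)"
proof (rule Y_eqI[where f = "\<lambda>y. y" and g = "\<lambda>y. \<Sum>q\<le>n. pr q y", OF assms plin_ident])
  show "plin (\<lambda>y. \<Sum>q\<le>n. pr q y)"
    by (intro pmp.linear_compose_sum ballI plin_pr)
  fix k w p' q' assume *: "k \<in> AWA p'" "w \<in> W q'" "p' + q' = n"
  then show "tens k w = (\<Sum>q\<le>n. pr q (tens k w))"
    by (simp add: pr_tens[OF W_FE[OF *(2)]])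
qed

lemma nY_pr: "nY (pr q y) = pr q (nY y)"
proof (rule plin_eqI[where f = "\<lambda>y. nY (pr q y)" and g = "\<lambda>y. pr q (nY y)"])
  fix k :: "'v key4"
  obtain t ys where "k = (t, ys)" by (metis surj_pair)
  then have k: "delta k = tens (delta t) (delta ys :: _ \<Rightarrow>\<^sub>0 'k)" by simp
  have F: "delta ys \<in> FE UNIV (length ys)" by (simp add: delta_FE)
  show "nY (pr q (delta k)) = pr q (nY (delta k))"
    unfolding k pr_tens[OF F] n_tens by (simp add: plin_zero[OF plin_n(3)] n_tens del: tens_single)
qed (intro plin_intros5 plin_pr[THEN plin_comp[rotated]])+

text \<open>Exactness of \<open>K\<^sub>1 \<rightarrow> K\<^sub>0 \<rightarrow> A\<close>: letters are moved one by one from the right factor to the left one.\<close>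

lemma exact_0_word:
  assumes "set v \<subseteq> E" "a \<in> FL E"
  shows "\<exists>k'\<in>AWA 1. dK k' = tens (tens a (delta [])) (delta v) - tens (tens (mul a (delta v)) (delta [])) (delta [])"
  using assms
proof (induction v arbitrary: a)
  case Nil
  then show ?case
    by (intro bexI[of _ 0]) (simp_all add: plin_ops[THEN plin_zero] pm.subspace_0[OF subspaces(2)])
next
  case (Cons x v)
  let ?k = "tens (tens a (delta [x])) (delta v)"
  have k: "?k \<in> AWA 1"
    using Cons.prems by (intro tens_K tens_X) (auto simp: W_small delta_FE delta_FL)
  have "mul a (delta [x]) \<in> FL E" using Cons.prems by (intro mul_FL) (auto simp: delta_FL)
  then obtain k' where k': "k' \<in> AWA 1" "dK k' = tens (tens (mul a (delta [x])) (delta [])) (delta v) -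
      tens (tens (mul (mul a (delta [x])) (delta v)) (delta [])) (delta [])"
    using Cons by auto
  have "dK ?k = tens (tens (mul a (delta [x])) (delta [])) (delta v) - tens (tens a (delta [])) (delta (x # v))"
    by (rule plin_eqI[where f = "\<lambda>a. dK (tens (tens a (delta [x])) (delta v))" and
        g = "\<lambda>a. tens (tens (mul a (delta [x])) (delta [])) (delta v) - tens (tens a (delta [])) (delta (x # v))"])
      ((intro plin_intros5)+, simp add: single_uminus)
  then have "dK (k' - ?k) = tens (tens a (delta [])) (delta (x # v)) - tens (tens (mul a (delta (x # v))) (delta [])) (delta [])"
    using k'(2) by (simp add: plin_diff[OF plin_ops(4)] mul_assoc)
  then show ?case
    using k k'(1) by (intro bexI[of _ "k' - ?k"] pm.subspace_diff[OF subspaces(2)])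
qed

text \<open>Modulo boundaries every \<open>k\<close> in degree 0 equals \<open>mu k\<close> placed
  in the left factor, and this is zero in A by hypothesis.\<close>

lemma exact_0:
  assumes k: "k \<in> AWA 0" and mu: "rA (mu k) = 0"
  shows "\<exists>k'\<in>AWA 1. nK (dK k') = nK k"
proof -
  \<comment> \<open>A linear section of \<open>mu\<close>, with units in the other two
    factors.\<close>
  define i :: "('v list \<Rightarrow>\<^sub>0 'k) \<Rightarrow> ('v key3 \<Rightarrow>\<^sub>0 'k)" where "i = (\<lambda>p. tens (tens p (delta [])) (delta []))"
  have i: "plin i" unfolding i_def by (intro plin_intros5)
  have sub: "pm.subspace (dK ` AWA 1)"
    by (intro pmp.linear_subspace_image plin_ops subspaces)
  have "k - i (mu k) \<in> dK ` AWA 1"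
  proof -
    have "k - i (mu k) \<in> pm.span (dK ` AWA 1)"
      using k[unfolded AWA_def]
    proof (rule plin_span_subset[where f = "\<lambda>k. k - i (mu k)", rotated])
      show "plin (\<lambda>k. k - i (mu k))"
        by (intro plin_minus plin_ident plin_comp[OF plin_pr(1) i])
      fix g assume "g \<in> {tens (tens a w) b |a w b. a \<in> FL E \<and> w \<in> W 0 \<and> b \<in> FL E}"
      then obtain a w b where g: "g = tens (tens a w) b" "a \<in> FL E" "w \<in> W 0" "b \<in> FL E" by auto
      have w: "w = scl (lookup w []) (delta [])"
        using W_FE[OF g(3)] by (intro poly_mapping_eqI) (auto simp: FE_def words_def lookup_single when_def in_keys_iff)
      have "tens (tens a (delta [])) b - i (mul a b) = lin (\<lambda>v. tens (tens a (delta [])) (delta v) - i (mul a (delta v))) b"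
        by (rule lin_eqI) (intro plin_intros5 plin_comp[OF plin_mul_right i], simp)
      also have "\<dots> \<in> dK ` AWA 1"
      proof (rule lin_in_subspace[OF sub])
        fix v assume "v \<in> keys b"
        then have "set v \<subseteq> E" using g(4) by (auto simp: FL_def)
        from exact_0_word[OF this g(2)] show "tens (tens a (delta [])) (delta v) - i (mul a (delta v)) \<in> dK ` AWA 1"
          unfolding i_def by (metis imageI)
      qed
      finally have "scl (lookup w []) (tens (tens a (delta [])) b - i (mul a b)) \<in> dK ` AWA 1"
        by (rule pm.subspace_scale[OF sub])
      moreover have "g = scl (lookup w []) (tens (tens a (delta [])) b)"
        unfolding g(1) by (subst w) (simp only: tens_scl_left tens_scl_right)
      ultimately have "g - i (mu g) \<in> dK ` AWA 1"
        unfolding g(1) mu_tens plin_scl[OF i] by (simp only: pm.scale_right_diff_distrib)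
      then show "g - i (mu g) \<in> pm.span (dK ` AWA 1)" by (rule pm.span_base)
    qed
    then show ?thesis by (simp only: pm.span_eq_iff[THEN iffD2, OF sub])
  qed
  then obtain k' where k': "k' \<in> AWA 1" "dK k' = k - i (mu k)" by auto
  have "nK (i (mu k)) = 0" by (simp add: i_def n_tens mu)
  then show ?thesis using k' by (intro bexI[of _ k']) (simp_all add: plin_diff[OF plin_n(2)])
qed

text \<open>A linear choice of preimages under the Koszul differential, applied to all coefficients.\<close>

lemma exact_vertical:
  assumes y: "y \<in> AWAV p q" and "\<And>ys. \<exists>k'\<in>AWA (Suc p). nK (dK k') = nK (col ys y)"
  shows "\<exists>s\<in>AWAV (Suc p) q. nY (tmap dK (\<lambda>p. p) s) = nY y"
proof -
  have lin: "plin (\<lambda>k. nK (dK k))" by (intro plin_intros5)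
  obtain h where h: "h ` UNIV \<subseteq> AWA (Suc p)" "plin h" "\<forall>v\<in>(\<lambda>k. nK (dK k)) ` AWA (Suc p). nK (dK (h v)) = v"
    using pmp.linear_exists_right_inverse_on[OF lin subspaces(2)] by blast
  \<comment> \<open>\<open>h\<close> chooses preimages of normal forms, so it is applied after
    \<open>nK\<close>.\<close>
  have hn: "plin (\<lambda>k. h (nK k))" by (rule plin_comp[OF plin_n(2) h(2)])
  let ?s = "tmap (\<lambda>k. h (nK k)) (\<lambda>p. p) y"
  have s: "?s \<in> AWAV (Suc p) q"
    by (rule AWAV_induct[where f = "tmap (\<lambda>k. h (nK k)) (\<lambda>p. p)", OF y plin_tmap subspace_AWAV])
      (use h(1) in \<open>auto simp: tmap_tens hn plin_ident intro!: tens_AWAV\<close>)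
  have "nY (tmap dK (\<lambda>p. p) ?s) = nY y"
  proof (rule col_eqI)
    fix ys
    have "nK (col ys y) \<in> (\<lambda>k. nK (dK k)) ` AWA (Suc p)" using assms(2)[of ys] by (metis imageI)
    then show "col ys (nY (tmap dK (\<lambda>p. p) ?s)) = col ys (nY y)"
      unfolding nY_def by (simp add: col_tmap plin_n plin_ops hn h(3))
  qed
  with s show ?thesis by blast
qed

text \<open>\<open>mu\<close> kills all positive degrees of K(A), so in total degree n only last
  words of length n contribute.\<close>

lemma f1_pr:
  assumes "y \<in> AWAW n"
  shows "f1 y = f1 (pr n y)"
proof (rule Y_eqI[where f = f1 and g = "\<lambda>y. f1 (pr n y)", OF assms plin_ops(12) plin_comp[OF plin_pr(2) plin_ops(12)]])
  fix k w p' q' assume *: "k \<in> AWA p'" "w \<in> W q'" "p' + q' = n"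
  have "f1 (tens k w) = 0" if "p' \<noteq> 0"
  proof -
    have "mu k = 0"
      using *(1) unfolding AWA_def
    proof (rule plin_span_eqI[OF plin_pr(1) pmp.linear_zero])
      fix x assume "x \<in> {tens (tens a w) b |a w b. a \<in> FL E \<and> w \<in> W p' \<and> b \<in> FL E}"
      then obtain a w b where x: "x = tens (tens a w) b" "w \<in> W p'" by auto
      have "lookup w [] = 0" using W_FE[OF x(2)] that by (auto simp: FE_def words_def in_keys_iff)
      then show "mu x = 0" by (simp add: x mu_tens)
    qed
    then show ?thesis by (simp add: f1_eq tmap_tens plin_pr plin_ident)
  qed
  with * show "f1 (tens k w) = f1 (pr n (tens k w))"
    by (auto simp: pr_tens[OF W_FE[OF *(2)]] plin_zero[OF plin_ops(12)])
qed

text \<open>Acyclicity of the kernel of \<open>f1\<close>, by induction on a bound \<open>Q\<close>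
  for the lengths of last words that occur. The top component is a vertical cycle and can be lifted
  vertically; subtracting \<open>bY\<close> of the lift lowers the bound. That \<open>f1\<close>
  also kills the lift is needed when the lemma is used a second time for the t-coefficient.\<close>

lemma exact_f1:
  assumes ex: koszul_exact and "g \<in> AWAW m" "nY (bY g) = 0" "nX (f1 g) = 0"
  shows "\<exists>s\<in>AWAW (Suc m). nY (bY s) = nY g \<and> nX (f1 s) = 0"
proof -
  have "\<exists>s\<in>AWAW (Suc m). nY (bY s) = nY g \<and> nX (f1 s) = 0"
    if "g \<in> AWAW m" "nY (bY g) = 0" "nX (f1 g) = 0" "\<And>q. Q \<le> q \<Longrightarrow> nY (pr q g) = 0" for Q g
    using that
  proof (induction Q arbitrary: g)
    case 0
    have "nY g = nY (\<Sum>q\<le>m. pr q g)" by (subst sum_pr[OF 0(1)]) (rule refl)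
    also have "\<dots> = 0" by (simp add: plin_sum[OF plin_n(3)] 0(4))
    finally show ?case
      by (intro bexI[of _ 0]) (simp_all add: op_simps plin_n[THEN plin_zero] pm.subspace_0[OF subspaces(3)])
  next
    case (Suc Q)
    show ?case
    proof (cases "Q \<le> m")
      \<comment> \<open>Last words longer than the total degree do not occur, so the bound can be
        lowered at once.\<close>
      case False
      then have "nY (pr q g) = 0" if "Q \<le> q" for q
        using pr_AWAW_0[OF Suc.prems(1), of q] that by (simp add: plin_zero[OF plin_n(3)])
      then show ?thesis using Suc by blast
    next
      case True
      let ?y = "pr Q g"
      have y: "?y \<in> AWAV (m - Q) Q" using pr_AWAW[of g "m - Q" Q] Suc.prems(1) True by simp
      have "nY (pr (Suc Q) g) = 0" using Suc.prems(4) by simp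
      note 0 = nY_0[OF this]
      \<comment> \<open>The horizontal contribution comes from last words of length Q + 1, which
        vanish by the bound; what remains is the vertical differential of the top component.\<close>
      have "nY (pr Q (bY g)) = 0" by (simp add: nY_pr Suc.prems(2) plin_zero[OF plin_pr(2)])
      then have dy: "nY (tmap dK (\<lambda>p. p) ?y) = 0"
        by (simp add: pr_bY plin_add[OF plin_n(3)] 0)
      have "\<exists>k'\<in>AWA (Suc (m - Q)). nK (dK k') = nK (col ys ?y)" for ys
      proof (cases "m - Q = 0")
        case False
        have "nK (dK (col ys ?y)) = col ys (nY (tmap dK (\<lambda>p. p) ?y))"
          unfolding nY_def by (simp add: col_tmap plin_n plin_ops)
        then have "nK (dK (col ys ?y)) = 0" by (simp add: dy plin_zero[OF plin_col])
        then show ?thesis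
          using ex False col_AWAV[OF y, of ys] by (auto simp: koszul_exact_def)
      next
        \<comment> \<open>At the bottom of the column exactness is replaced by
          \<open>exact_0\<close>; its hypothesis is the one on \<open>f1 g\<close>, read column by
          column.\<close>
        case True
        with \<open>Q \<le> m\<close> have "Q = m" by simp
        then have "nX (f1 ?y) = 0" using f1_pr[OF Suc.prems(1)] Suc.prems(3) by simp
        then have "col ys (nX (f1 ?y)) = 0" by (simp add: plin_zero[OF plin_col])
        moreover have "nX (tmap mu (\<lambda>p. p) x) = tmap (\<lambda>k. rA (mu k)) (\<lambda>p. p) x" for x
          unfolding nX_def by (subst tmap_comp) (simp_all add: plin_rA plin_pr plin_ident)
        ultimately have "rA (mu (col ys ?y)) = 0"
          by (simp add: f1_eq col_tmap plin_comp[OF plin_pr(1) plin_rA])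
        then show ?thesis
          using exact_0[of "col ys ?y"] col_AWAV[OF y, of ys] True by simp
      qed
      from exact_vertical[OF y this] obtain s where s: "s \<in> AWAV (Suc (m - Q)) Q" "nY (tmap dK (\<lambda>p. p) s) = nY ?y"
        by blast
      have sY: "s \<in> AWAW (Suc m)" using AWAV_AWAW[OF s(1)] True by simp
      \<comment> \<open>The last words of \<open>s\<close> have length Q \<le> m, but in total
        degree m + 1 \<open>f1\<close> sees only last words of length m + 1.\<close>
      have "f1 s = f1 (pr (Suc m) s)" by (rule f1_pr[OF sY])
      then have f1s: "f1 s = 0" using True by (simp add: pr_AWAV[OF s(1)] plin_zero[OF plin_ops(12)])
      let ?g = "g - bY s"
      have "\<exists>s\<in>AWAW (Suc m). nY (bY s) = nY ?g \<and> nX (f1 s) = 0"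
      proof (rule Suc.IH)
        show "?g \<in> AWAW m" using bY_Y[OF sY] Suc.prems(1) by (intro pm.subspace_diff[OF subspaces(3)]) simp_all
        show "nY (bY ?g) = 0"
          by (simp add: plin_diff[OF plin_ops(9)] plin_diff[OF plin_n(3)] Suc.prems(2) nY_squares(1)[OF sY])
        show "nX (f1 ?g) = 0"
          by (simp add: plin_diff[OF plin_ops(12)] plin_diff[OF plin_n(1)] Suc.prems(3) f1_bY f1s
              plin_zero[OF plin_ops(3)] plin_zero[OF plin_n(1)])
        fix q assume q: "Q \<le> q"
        have "pr q (bY s) = tmap dK (\<lambda>p. p) (if q = Q then s else 0)"
          using q by (simp add: pr_bY pr_AWAV[OF s(1)] plin_ops[THEN plin_zero])
        moreover have "nY (pr q g) = 0" if "q \<noteq> Q" using Suc.prems(4)[of q] q that by simp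
        ultimately show "nY (pr q ?g) = 0"
          by (auto simp: plin_diff[OF plin_pr(2)] plin_diff[OF plin_n(3)] s(2) plin_zero[OF plin_tmap] plin_zero[OF plin_n(3)])
      qed
      then obtain s' where s': "s' \<in> AWAW (Suc m)" "nY (bY s') = nY ?g" "nX (f1 s') = 0" by blast
      have "nY (bY (s' + s)) = nY g"
        by (simp add: plin_add[OF plin_ops(9)] plin_add[OF plin_n(3)] s'(2) plin_diff[OF plin_n(3)])
      moreover have "nX (f1 (s' + s)) = 0"
        by (simp add: plin_add[OF plin_ops(12)] plin_add[OF plin_n(1)] s'(3) f1s plin_zero[OF plin_n(1)])
      ultimately show ?thesis
        using pm.subspace_add[OF subspaces(3) s'(1) sY] by blast
    qed
  qed
  from this[of g "Suc m"] show ?thesis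
    using assms(2-4) by (metis Suc_le_lessD pr_AWAW_0 plin_n(3) plin_zero)
qed

text \<open>Over the dual numbers the rotation is \<open>swp + t swp'\<close> and the differentials are \<open>bX + t eX\<close> and
  \<open>bY + t eY\<close>; \<open>g0 + t g1\<close> is the rotation minus the identity applied to \<open>De (z - t y)\<close>.\<close>

lemma weight_exact:
  assumes ex: koszul_exact and z: "z \<in> AW n" and y: "y \<in> AW n"
    and bz: "nX (bX z) = 0" and ez: "nX (eX z) = nX (bX y)"
  shows "\<exists>u\<in>AW (Suc n). \<exists>v\<in>AW (Suc n). nX (bX v) = 0 \<and> nX (NX z) = nX (bX u + eX v)"
proof -
  note op = plin_ops[THEN plin_add] plin_ops[THEN plin_diff] plin_n[THEN plin_add] plin_n[THEN plin_diff]
    plin_n[THEN plin_zero] plin_ops[THEN plin_zero]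
  define g0 where "g0 = swp (De z) - De z"
  define g1 where "g1 = swp' (De z) - swp (De y) + De y"
  have Y: "De z \<in> AWAW n" "De y \<in> AWAW n" by (intro De_Y z y)+
  have g0Y: "g0 \<in> AWAW n" and g1Y: "g1 \<in> AWAW n"
    unfolding g0_def g1_def
    by (intro pm.subspace_add[OF subspaces(3)] pm.subspace_diff[OF subspaces(3)] swp_Y swp'_Y Y)+
  have "nY (De (bX z)) = 0" by (simp add: nY_De bz op)
  note bz0 = this nY_0[OF this]
  have "nY (De (eX z - bX y)) = 0" by (simp add: nY_De ez op)
  note ez0 = this nY_0[OF this]
  have bg0: "nY (bY g0) = 0"
    by (simp add: g0_def op swp_bY[symmetric] bY_De bz0)
  have f1g0: "f1 g0 = 0" by (simp add: g0_def op f1_swp_De f1_De)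
  have f1g1: "f1 g1 = 0" by (simp add: g1_def op f1_swp_De f1_De f1_swp'_De)
  \<comment> \<open>The t-coefficient of the cycle condition for g0 + t g1; it reduces to the
    hypotheses on \<open>bX z\<close> and \<open>eX z\<close>.\<close>
  have "bY g1 + eY g0 = (bY (swp' (De z)) + eY (swp (De z))) - swp (De (bX y)) + De (bX y) - De (eX z)"
    by (simp add: g1_def g0_def op swp_bY[symmetric] bY_De eY_De)
  also have "\<dots> = swp' (De (bX z)) + swp (De (eX z - bX y)) - De (eX z - bX y)"
    by (simp add: swp'_bY[symmetric] op bY_De eY_De)
  finally have bg1: "nY (bY g1 + eY g0) = 0"
    by (simp only: plin_n(3)[THEN plin_add] plin_n(3)[THEN plin_diff] bz0 ez0) simp
  obtain s0 where s0: "s0 \<in> AWAW (Suc n)" "nY (bY s0) = nY g0" "nX (f1 s0) = 0"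
    using exact_f1[OF ex g0Y bg0] by (auto simp: f1g0 op)
  \<comment> \<open>The equation (bY + t eY) (s0 + t s1) = g0 + t g1 is solved order by order; the
    error left by \<open>s0\<close> in order t is \<open>eY s0\<close>.\<close>
  have "\<exists>s\<in>AWAW (Suc n). nY (bY s) = nY (g1 - eY s0) \<and> nX (f1 s) = 0"
  proof (rule exact_f1[OF ex])
    show "g1 - eY s0 \<in> AWAW n"
      using eY_Y[OF s0(1)] g1Y by (intro pm.subspace_diff[OF subspaces(3)]) simp_all
    have "nY (bY (g1 - eY s0)) = nY (bY g1) + nY (eY (bY s0))"
      by (simp add: op nY_squares(2)[OF s0(1)])
    also have "nY (eY (bY s0)) = nY (eY g0)" by (rule nY_cong(6)[OF s0(2)])
    finally have "nY (bY (g1 - eY s0)) = nY (bY g1) + nY (eY g0)" .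
    then show "nY (bY (g1 - eY s0)) = 0" using bg1 by (simp only: plin_n(3)[THEN plin_add])
    show "nX (f1 (g1 - eY s0)) = 0"
      by (simp add: op f1g1 f1_eY nX_0[OF s0(3)] plin_n(1)[THEN plin_uminus])
  qed
  then obtain s1 where s1: "s1 \<in> AWAW (Suc n)" "nY (bY s1) = nY (g1 - eY s0)" by blast
  \<comment> \<open>The twisted rotation followed by \<open>f1\<close>, applied to s0 + t s1, gives
    v + t u.\<close>
  define u where "u = f1 (swp s1) + f1 (swp' s0)"
  define v where "v = f1 (swp s0)"
  have uX: "u \<in> AW (Suc n)" and vX: "v \<in> AW (Suc n)"
    unfolding u_def v_def by (intro pm.subspace_add[OF subspaces(1)] f1_X swp_Y swp'_Y s0 s1)+
  have "nX (bX v) = nX (f1 (swp (bY s0)))" by (simp add: v_def f1_bY[symmetric] swp_bY)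
  also have "\<dots> = nX (f1 (swp g0))" by (rule nY_cong(8)[OF nY_cong(3)[OF s0(2)]])
  \<comment> \<open>The rotation is an involution to order 0, so it only changes the sign of
    \<open>g0\<close>, and \<open>f1\<close> sends both terms of \<open>g0\<close> to z.\<close>
  also have "\<dots> = 0" by (simp add: g0_def op swp_D f1_De f1_swp_De)
  finally have bv: "nX (bX v) = 0" .
  have "bX u + eX v = f1 (swp (bY s1)) + f1 (bY (swp' s0) + eY (swp s0))"
    by (simp add: u_def v_def op f1_bY[symmetric] f1_eY[symmetric] swp_bY)
  also have "\<dots> = f1 (swp (bY s1)) + f1 (swp' (bY s0)) + f1 (swp (eY s0))"
    by (simp add: swp'_bY[symmetric] op add.assoc)
  finally have "nX (bX u + eX v) = nX (f1 (swp (bY s1))) + nX (f1 (swp' (bY s0))) + nX (f1 (swp (eY s0)))"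
    by (simp add: op)
  also have "nX (f1 (swp (bY s1))) = nX (f1 (swp (g1 - eY s0)))" by (rule nY_cong(8)[OF nY_cong(3)[OF s1(2)]])
  also have "nX (f1 (swp' (bY s0))) = nX (f1 (swp' g0))" by (rule nY_cong(8)[OF nY_cong(4)[OF s0(2)]])
  also have "nX (f1 (swp (g1 - eY s0))) + nX (f1 (swp' g0)) + nX (f1 (swp (eY s0))) = nX (f1 (swp g1) + f1 (swp' g0))"
    by (simp add: op)
  \<comment> \<open>The terms with y cancel: \<open>f1\<close> returns y from \<open>De y\<close>
    both before and after a rotation. What is left is the t-coefficient of the squared
    rotation.\<close>
  also have "f1 (swp g1) + f1 (swp' g0) = f1 (swp (swp' (De z))) + f1 (swp' (swp (De z)))"
    by (simp add: g0_def g1_def op swp_D f1_De f1_swp_De f1_swp'_De)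
  also have "\<dots> = NX z" by (simp add: f1_swp_swp' f1_De)
  finally show ?thesis using uX vX bv by metis
qed

text \<open>The weight is at least the degree n > 0, hence invertible in characteristic 0. Operators
  that scale by weight commute with everything in sight, so the previous lemma is applied to z and y
  divided by the weight.\<close>

lemma cap_exact:
  assumes ex: koszul_exact and n: "n > 0" and z: "z \<in> AW n" and y: "y \<in> AW n"
    and bz: "nX (bX z) = 0" and ez: "nX (eX z) = nX (bX y)"
  shows "\<exists>u\<in>AW (Suc n). \<exists>v\<in>AW (Suc n). nX (bX v) = 0 \<and> nX z = nX (bX u + eX v)"
proof -
  \<comment> \<open>The value at 0 is the default 1 / 0 = 0, but words of weight 0 do not occur
    because n > 0.\<close>
  let ?h = "\<lambda>i. 1 / of_nat i :: 'k"
  have "NX (wt ?h z) = z"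
  proof -
    have "NX (wt ?h z) = wt (\<lambda>i. of_nat i * ?h i) z" by (simp add: NX_eq wt_wt)
    also have "\<dots> = z"
    proof (rule plin_eqI[OF plin_wt(2) plin_ident])
      fix k assume "k \<in> keys z"
      then obtain u xs where k: "k = (u, xs)" "length xs = n" using X0_keys[OF z] by (metis surj_pair)
      then have "of_nat (length u + length xs) \<noteq> (0 :: 'k)" using n by (simp only: of_nat_eq_0_iff)
      then have "of_nat (length u + length xs) * ?h (length u + length xs) = 1" by simp
      then show "wt (\<lambda>i. of_nat i * ?h i) (delta k) = delta k" by (simp only: k(1) wt_single mult_1)
    qed
    finally show ?thesis .
  qed
  then show ?thesis
    using weight_exact[OF ex wt_X[OF z] wt_X[OF y], of ?h ?h] bz ez
    by (simp add: wt_bX[symmetric] wt_eX[symmetric] nX_wt plin_zero[OF plin_wt(2)])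
qed

text \<open>For a nonempty word, moving the first letter of a rotation into W gives a chain whose
  \<open>bX\<close> is the difference of two consecutive rotations and whose \<open>eX\<close> is
  minus a rotation. The differences telescope around the cycle.\<close>

lemma augmentation_exact:
  assumes z: "z \<in> AW 0" and 0: "lookup z ([], []) = 0"
  shows "\<exists>u\<in>AW 1. \<exists>v\<in>AW 1. bX v = 0 \<and> z = bX u + eX v"
proof -
  define S where "S = {bX u + eX v | u v. u \<in> AW 1 \<and> v \<in> AW 1 \<and> bX v = 0}"
  have S: "pm.subspace S"
  proof (rule pm.subspaceI)
    show "0 \<in> S"
      unfolding S_def using pm.subspace_0[OF subspaces(1), of 1]
      by (intro CollectI exI[of _ 0]) (simp add: plin_ops[THEN plin_zero])
    fix x y c assume "x \<in> S"
    then obtain u v where x: "x = bX u + eX v" "u \<in> AW 1" "v \<in> AW 1" "bX v = 0" by (auto simp: S_def)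
    then show "scl c x \<in> S" unfolding S_def
      by (intro CollectI exI[of _ "scl c u"] exI[of _ "scl c v"])
        (simp add: plin_ops[THEN plin_scl] pm.subspace_scale[OF subspaces(1)] pm.scale_right_distrib)
    assume "y \<in> S"
    then obtain u' v' where "y = bX u' + eX v'" "u' \<in> AW 1" "v' \<in> AW 1" "bX v' = 0" by (auto simp: S_def)
    with x show "x + y \<in> S" unfolding S_def
      by (intro CollectI exI[of _ "u + u'"] exI[of _ "v + v'"])
        (simp add: plin_ops[THEN plin_add] pm.subspace_add[OF subspaces(1)])
  qed
  have word: "delta (us, []) \<in> S" if us: "us \<noteq> []" "set us \<subseteq> E" for us
  proof -
    let ?n = "length us"
    define g where "g = (\<lambda>i. delta (tl (rotate i us), [hd (rotate i us)]) :: _ \<Rightarrow>\<^sub>0 'k)"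
    have ne: "rotate i us \<noteq> []" for i using us by simp
    have set: "hd (rotate i us) \<in> E" "set (tl (rotate i us)) \<subseteq> E" for i
      using us(2) list.set_sel[OF ne[of i]] by (auto simp del: set_rotate dest: in_set_dropD simp: set_rotate)
    have gX: "g i \<in> AW 1" for i
      using tens_X[of "delta (tl (rotate i us))" "delta [hd (rotate i us)]" 1] set
      by (simp add: g_def W_small delta_FE delta_FL)
    have bg: "bX (g i) = delta (rotate (Suc i) us, []) - delta (rotate i us, [])" for i
      using ne[of i] by (simp add: g_def op_simps rotate1_hd_tl single_uminus)
    have eg: "eX (g i) = - delta (rotate i us, [])" for i
      using ne[of i] by (simp add: g_def op_simps single_uminus)
    have rot: "(\<Sum>j<i. bX (g j)) = delta (rotate i us, []) - delta (us, [])" for i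
      by (induction i) (simp_all add: bg)
    define v where "v = (\<Sum>i<?n. g i)"
    \<comment> \<open>The double sum is chosen so that \<open>bX u\<close> is the sum of all
      rotations minus length-many copies of \<open>us\<close>; adding \<open>eX v\<close> removes
      the rotations.\<close>
    define u where "u = (\<Sum>i<?n. \<Sum>j<i. g j)"
    have X: "u \<in> AW 1" "v \<in> AW 1"
      unfolding u_def v_def by (intro pm.subspace_sum[OF subspaces(1)] gX)+
    have "bX v = 0" by (simp add: v_def plin_sum[OF plin_ops(3)] rot)
    moreover have "bX (- u) + eX (- v) = scl (of_nat ?n) (delta (us, []))"
    proof -
      have "bX u + eX v = (\<Sum>i<?n. - delta (us, []))"
        by (simp add: u_def v_def plin_sum[OF plin_ops(3)] plin_sum[OF plin_ops(2)] rot eg sum_subtractf sum_negf)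
      also have "\<dots> = - scl (of_nat ?n) (delta (us, []))"
      proof -
        have "(\<Sum>i<m. - delta (us, [])) = - scl (of_nat m) (delta (us, []) :: _ \<Rightarrow>\<^sub>0 'k)" for m
          by (induction m) (simp_all add: single_add)
        then show ?thesis .
      qed
      finally have "- (bX u + eX v) = scl (of_nat ?n) (delta (us, []))" by simp
      then show ?thesis by (simp add: plin_uminus[OF plin_ops(3)] plin_uminus[OF plin_ops(2)])
    qed
    ultimately have "scl (of_nat ?n) (delta (us, [])) \<in> S"
      unfolding S_def using X pm.subspace_neg[OF subspaces(1)]
      by (intro CollectI exI[of _ "- u"] exI[of _ "- v"]) (simp add: plin_uminus[OF plin_ops(3)])
    \<comment> \<open>Division by the length, nonzero in characteristic 0 since the word is
      nonempty.\<close>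
    from pm.subspace_scale[OF S this, of "1 / of_nat ?n"] show ?thesis using us(1) by simp
  qed
  have "lin delta z \<in> S"
  proof (rule lin_in_subspace[OF S])
    fix k assume k: "k \<in> keys z"
    then obtain us where us: "k = (us, [])" using X0_keys[OF z] by (metis surj_pair length_0_conv)
    have "AW 0 \<subseteq> {z. keys z \<subseteq> {(u, xs). set u \<subseteq> E}}"
      unfolding AW_def
    proof (rule pm.span_minimal[OF _ subspace_keys], clarify)
      fix a w :: "'v list \<Rightarrow>\<^sub>0 'k" and u xs x assume "a \<in> FL E" "(u, xs) \<in> keys (tens a w)" "x \<in> set u"
      then show "x \<in> E" using keys_tens[of a w] by (auto simp: FL_def)
    qed
    then have "set us \<subseteq> E" using k us z by auto
    then show "delta k \<in> S" using word[of us] us k 0 by (auto simp: in_keys_iff)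
  qed
  then show ?thesis by (auto simp: S_def)
qed

text \<open>The coefficient of the empty word is the augmentation of A; it survives normal forms
  because \<open>rA\<close> preserves length and fixes the unit.\<close>

lemma lookup_nX: "lookup (nX z) ([], []) = lookup z ([], [])"
proof -
  have *: "lookup (rA (delta u)) [] = lookup (delta u) []" for u
    using rA_keys[of u] rA_Nil by (cases "u = []") (auto simp: lookup_single in_keys_iff)
  have "lookup (nX z) ([], []) = (\<Sum>k\<in>keys z. lookup z k * lookup (nX (delta k)) ([], []))"
    by (subst plin_eq_lin[OF plin_n(1)]) (simp add: lin_def lookup_sum)
  also have "\<dots> = (\<Sum>k\<in>keys z. lookup z k * lookup (delta k) ([], []))"
  proof (intro sum.cong refl arg_cong2[where f = "(*)"])
    fix k :: "'v key2" assume "k \<in> keys z"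
    obtain u xs where "k = (u, xs)" by (metis surj_pair)
    then have k: "delta k = tens (delta u) (delta xs :: _ \<Rightarrow>\<^sub>0 'k)" by simp
    show "lookup (nX (delta k)) ([], []) = lookup (delta k) ([], [])"
      unfolding k n_tens lookup_tens * ..
  qed
  also have "\<dots> = lookup (lin delta z) ([], [])" by (simp only: lin_def lookup_sum lookup_scl)
  finally show ?thesis by simp
qed

text \<open>Both terms leave at least one letter in the factor A.\<close>

lemma lookup_bX: "lookup (bX z) ([], []) = 0" and lookup_eX: "lookup (eX z) ([], []) = 0"
proof -
  have *: "([], []) \<notin> keys (dl z)" "([], []) \<notin> keys (eX z)"
    unfolding dl_def eX_def
    by (rule contra_subsetD[OF keys_lin]; auto split: if_splits)+
  show "lookup (eX z) ([], []) = 0" using * by (simp add: in_keys_iff)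
  then show "lookup (bX z) ([], []) = 0" using * by (simp add: bX_def lookup_add in_keys_iff)
qed

end

section \<open>Vector spaces on carriers\<close>

lemma scalars_simps [simp]:
  "carrier (scalars :: 'k::field ring) = UNIV" "\<one>\<^bsub>(scalars :: 'k ring)\<^esub> = 1" "\<zero>\<^bsub>(scalars :: 'k ring)\<^esub> = 0"
  "x \<oplus>\<^bsub>(scalars :: 'k ring)\<^esub> y = x + y" "x \<otimes>\<^bsub>(scalars :: 'k ring)\<^esub> y = x * y"
  by (simp_all add: ring_of_type_algebra_def)

definition vsp :: "('k::field, 'a) module \<Rightarrow> bool" where
  "vsp M \<longleftrightarrow> Module.module scalars M"

lemma vspI:
  fixes M :: "('k::field, 'a) module"
  assumes "abelian_group M"
    and "\<And>c x. x \<in> carrier M \<Longrightarrow> c \<odot>\<^bsub>M\<^esub> x \<in> carrier M"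
    and "\<And>c d x. x \<in> carrier M \<Longrightarrow> (c + d) \<odot>\<^bsub>M\<^esub> x = c \<odot>\<^bsub>M\<^esub> x \<oplus>\<^bsub>M\<^esub> d \<odot>\<^bsub>M\<^esub> x"
    and "\<And>c x y. x \<in> carrier M \<Longrightarrow> y \<in> carrier M \<Longrightarrow> c \<odot>\<^bsub>M\<^esub> (x \<oplus>\<^bsub>M\<^esub> y) = c \<odot>\<^bsub>M\<^esub> x \<oplus>\<^bsub>M\<^esub> c \<odot>\<^bsub>M\<^esub> y"
    and "\<And>c d x. x \<in> carrier M \<Longrightarrow> (c * d) \<odot>\<^bsub>M\<^esub> x = c \<odot>\<^bsub>M\<^esub> (d \<odot>\<^bsub>M\<^esub> x)"
    and "\<And>x. x \<in> carrier M \<Longrightarrow> 1 \<odot>\<^bsub>M\<^esub> x = x"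
  shows "vsp M"
  unfolding vsp_def by (rule Module.moduleI) (use assms cring_from_type_algebra in simp_all)

lemma
  assumes "vsp M"
  shows vsp_abelian_group: "abelian_group M"
    and vsp_smult_closed: "x \<in> carrier M \<Longrightarrow> c \<odot>\<^bsub>M\<^esub> x \<in> carrier M"
    and vsp_smult_l_distr: "x \<in> carrier M \<Longrightarrow> (c + d) \<odot>\<^bsub>M\<^esub> x = c \<odot>\<^bsub>M\<^esub> x \<oplus>\<^bsub>M\<^esub> d \<odot>\<^bsub>M\<^esub> x"
    and vsp_smult_r_distr: "x \<in> carrier M \<Longrightarrow> y \<in> carrier M \<Longrightarrow>
      c \<odot>\<^bsub>M\<^esub> (x \<oplus>\<^bsub>M\<^esub> y) = c \<odot>\<^bsub>M\<^esub> x \<oplus>\<^bsub>M\<^esub> c \<odot>\<^bsub>M\<^esub> y"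
    and vsp_smult_assoc: "x \<in> carrier M \<Longrightarrow> (c * d) \<odot>\<^bsub>M\<^esub> x = c \<odot>\<^bsub>M\<^esub> (d \<odot>\<^bsub>M\<^esub> x)"
    and vsp_smult_one: "x \<in> carrier M \<Longrightarrow> 1 \<odot>\<^bsub>M\<^esub> x = x"
    and vsp_smult_0: "x \<in> carrier M \<Longrightarrow> 0 \<odot>\<^bsub>M\<^esub> x = \<zero>\<^bsub>M\<^esub>"
    and vsp_smult_zero: "c \<odot>\<^bsub>M\<^esub> \<zero>\<^bsub>M\<^esub> = \<zero>\<^bsub>M\<^esub>"
proof -
  interpret Module.module scalars M using assms by (simp add: vsp_def)
  show "abelian_group M" ..
  show "x \<in> carrier M \<Longrightarrow> c \<odot>\<^bsub>M\<^esub> x \<in> carrier M" by simp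
  show "x \<in> carrier M \<Longrightarrow> (c + d) \<odot>\<^bsub>M\<^esub> x = c \<odot>\<^bsub>M\<^esub> x \<oplus>\<^bsub>M\<^esub> d \<odot>\<^bsub>M\<^esub> x"
    using smult_l_distr[of c d x] by simp
  show "x \<in> carrier M \<Longrightarrow> y \<in> carrier M \<Longrightarrow> c \<odot>\<^bsub>M\<^esub> (x \<oplus>\<^bsub>M\<^esub> y) = c \<odot>\<^bsub>M\<^esub> x \<oplus>\<^bsub>M\<^esub> c \<odot>\<^bsub>M\<^esub> y"
    using smult_r_distr[of c x y] by simp
  show "x \<in> carrier M \<Longrightarrow> (c * d) \<odot>\<^bsub>M\<^esub> x = c \<odot>\<^bsub>M\<^esub> (d \<odot>\<^bsub>M\<^esub> x)"
    using smult_assoc1[of c d x] by simp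
  show "x \<in> carrier M \<Longrightarrow> 1 \<odot>\<^bsub>M\<^esub> x = x" using smult_one[of x] by simp
  show "x \<in> carrier M \<Longrightarrow> 0 \<odot>\<^bsub>M\<^esub> x = \<zero>\<^bsub>M\<^esub>" using smult_l_null[of x] by simp
  show "c \<odot>\<^bsub>M\<^esub> \<zero>\<^bsub>M\<^esub> = \<zero>\<^bsub>M\<^esub>" using smult_r_null[of c] by simp
qed

text \<open>Closure under additive inverses, demanded by \<open>submodule\<close>, is multiplication
  by -1.\<close>

lemma submodule_iff:
  assumes "vsp M"
  shows "submodule H scalars M \<longleftrightarrow> H \<subseteq> carrier M \<and> \<zero>\<^bsub>M\<^esub> \<in> H \<and> (\<forall>x\<in>H. \<forall>y\<in>H. x \<oplus>\<^bsub>M\<^esub> y \<in> H) \<and> (\<forall>c. \<forall>x\<in>H. c \<odot>\<^bsub>M\<^esub> x \<in> H)"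
    (is "_ \<longleftrightarrow> ?R")
proof -
  interpret Module.module scalars M using assms by (simp add: vsp_def)
  show ?thesis
  proof
    assume H: "submodule H scalars M"
    interpret H: submodule H scalars M by fact
    show ?R
      using submoduleE[OF H] H.one_closed by auto
  next
    assume R: ?R
    show "submodule H scalars M"
    proof (rule submoduleI)
      fix x assume x: "x \<in> H"
      then have "(- 1) \<odot>\<^bsub>M\<^esub> x \<oplus>\<^bsub>M\<^esub> x = (- 1 + 1) \<odot>\<^bsub>M\<^esub> x"
        using R vsp_smult_l_distr[OF assms, of x "- 1" 1] vsp_smult_one[OF assms, of x] by auto
      also have "\<dots> = \<zero>\<^bsub>M\<^esub>" using R x vsp_smult_0[OF assms] by auto
      finally have "\<ominus>\<^bsub>M\<^esub> x = (- 1) \<odot>\<^bsub>M\<^esub> x"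
        using R x by (intro M.minus_equality) auto
      then show "\<ominus>\<^bsub>M\<^esub> x \<in> H" using R x by auto
    qed (use R in auto)
  qed
qed

lemma vsp_restrict:
  assumes "vsp M" "submodule H scalars M"
  shows "vsp (M\<lparr>carrier := H\<rparr>)"
  using submodule.submodule_is_module[OF assms(2)] assms(1) by (simp add: vsp_def)

lemma submodule_restrict:
  assumes "vsp M" "submodule H scalars M" "submodule N scalars M" "N \<subseteq> H"
  shows "submodule N scalars (M\<lparr>carrier := H\<rparr>)"
  using assms(3,4) by (simp add: submodule_iff[OF vsp_restrict[OF assms(1,2)]] submodule_iff[OF assms(1)])

lemma restrict_coset [simp]: "N +>\<^bsub>M\<lparr>carrier := H\<rparr>\<^esub> x = N +>\<^bsub>M\<^esub> x"
  by (simp add: a_r_coset_def')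

text \<open>Linearity without the extensionality built into \<open>linear_maps\<close>, so that one
  function can be regarded as a map between various subspaces.\<close>

definition lhom :: "('k::field, 'a) module \<Rightarrow> ('k, 'b) module \<Rightarrow> ('a \<Rightarrow> 'b) \<Rightarrow> bool" where
  "lhom M N f \<longleftrightarrow> (\<forall>x\<in>carrier M. f x \<in> carrier N) \<and>
     (\<forall>x\<in>carrier M. \<forall>y\<in>carrier M. f (x \<oplus>\<^bsub>M\<^esub> y) = f x \<oplus>\<^bsub>N\<^esub> f y) \<and>
     (\<forall>c. \<forall>x\<in>carrier M. f (c \<odot>\<^bsub>M\<^esub> x) = c \<odot>\<^bsub>N\<^esub> f x)"

lemma linear_maps_lhom: "f \<in> linear_maps M N \<Longrightarrow> lhom M N f"
  by (auto simp: linear_maps_def lhom_def)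

lemma lhom_zero: "vsp M \<Longrightarrow> vsp N \<Longrightarrow> lhom M N f \<Longrightarrow> f \<zero>\<^bsub>M\<^esub> = \<zero>\<^bsub>N\<^esub>"
proof -
  assume M: "vsp M" and N: "vsp N" and f: "lhom M N f"
  interpret abelian_group M using vsp_abelian_group[OF M] .
  have "f (0 \<odot>\<^bsub>M\<^esub> \<zero>\<^bsub>M\<^esub>) = 0 \<odot>\<^bsub>N\<^esub> f \<zero>\<^bsub>M\<^esub>" "f \<zero>\<^bsub>M\<^esub> \<in> carrier N"
    using f unfolding lhom_def by simp_all
  then show ?thesis by (simp add: vsp_smult_zero[OF M] vsp_smult_0[OF N])
qed

lemma lhom_image:
  assumes "vsp M" "vsp N" "lhom M N f" "submodule H scalars M"
  shows "submodule (f ` H) scalars N"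
proof -
  have H: "H \<subseteq> carrier M" "\<zero>\<^bsub>M\<^esub> \<in> H" "\<And>x y. x \<in> H \<Longrightarrow> y \<in> H \<Longrightarrow> x \<oplus>\<^bsub>M\<^esub> y \<in> H"
    "\<And>c x. x \<in> H \<Longrightarrow> c \<odot>\<^bsub>M\<^esub> x \<in> H"
    using assms(4) by (auto simp: submodule_iff[OF assms(1)])
  have f: "\<And>x. x \<in> H \<Longrightarrow> f x \<in> carrier N" "\<And>x y. x \<in> H \<Longrightarrow> y \<in> H \<Longrightarrow> f x \<oplus>\<^bsub>N\<^esub> f y = f (x \<oplus>\<^bsub>M\<^esub> y)"
    "\<And>c x. x \<in> H \<Longrightarrow> c \<odot>\<^bsub>N\<^esub> f x = f (c \<odot>\<^bsub>M\<^esub> x)"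
    using assms(3) H(1) by (auto simp: lhom_def subset_iff)
  show ?thesis
    unfolding submodule_iff[OF assms(2)]
  proof (intro conjI ballI allI)
    show "f ` H \<subseteq> carrier N" using f(1) by blast
    show "\<zero>\<^bsub>N\<^esub> \<in> f ` H" using H(2) lhom_zero[OF assms(1-3)] by (metis imageI)
    fix x assume "x \<in> f ` H"
    then obtain a where a: "x = f a" "a \<in> H" by blast
    show "c \<odot>\<^bsub>N\<^esub> x \<in> f ` H" for c unfolding a(1) f(3)[OF a(2)] by (intro imageI H a)
    fix y assume "y \<in> f ` H"
    then obtain b where b: "y = f b" "b \<in> H" by blast
    show "x \<oplus>\<^bsub>N\<^esub> y \<in> f ` H" unfolding a(1) b(1) f(2)[OF a(2) b(2)] by (intro imageI H a b)
  qed
qed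

lemma lhom_kernel:
  assumes "vsp M" "vsp N" "lhom M N f"
  shows "submodule {x \<in> carrier M. f x = \<zero>\<^bsub>N\<^esub>} scalars M"
proof -
  interpret M: abelian_group M using vsp_abelian_group[OF assms(1)] .
  interpret N: abelian_group N using vsp_abelian_group[OF assms(2)] .
  show ?thesis
    using assms(3) lhom_zero[OF assms] vsp_smult_closed[OF assms(1)] vsp_smult_zero[OF assms(2)]
    by (auto simp: submodule_iff[OF assms(1)] lhom_def)
qed

subsection \<open>Quotients\<close>

lemma quotient_simps:
  "carrier (quotient M N) = (\<lambda>x. N +>\<^bsub>M\<^esub> x) ` carrier M"
  "\<zero>\<^bsub>quotient M N\<^esub> = N"
  "C \<oplus>\<^bsub>quotient M N\<^esub> D = C <+>\<^bsub>M\<^esub> D"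
  "c \<odot>\<^bsub>quotient M N\<^esub> C = (\<Union>x\<in>C. N +>\<^bsub>M\<^esub> (c \<odot>\<^bsub>M\<^esub> x))"
  "C \<otimes>\<^bsub>quotient M N\<^esub> D = rcoset_mult M N C D"
  "\<one>\<^bsub>quotient M N\<^esub> = N +>\<^bsub>M\<^esub> \<one>\<^bsub>M\<^esub>"
  by (auto simp: quotient_def ring.defs module.defs FactRing_def A_RCOSETS_def' image_def)

context
  fixes M :: "('k::field, 'a) module" and N :: "'a set"
  assumes M: "vsp M" and N: "submodule N scalars M"
begin

lemma quotient_abelian_subgroup: "abelian_subgroup N M"
proof -
  have "subgroup N (add_monoid M)" using N by (rule submodule.axioms)
  then show ?thesis
    by (intro abelian_subgroupI3 additive_subgroupI vsp_abelian_group[OF M])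
qed

lemma coset_add: "x \<in> carrier M \<Longrightarrow> y \<in> carrier M \<Longrightarrow>
    (N +>\<^bsub>M\<^esub> x) \<oplus>\<^bsub>quotient M N\<^esub> (N +>\<^bsub>M\<^esub> y) = N +>\<^bsub>M\<^esub> (x \<oplus>\<^bsub>M\<^esub> y)"
  by (simp add: quotient_simps abelian_subgroup.a_rcos_sum[OF quotient_abelian_subgroup])

lemma coset_eq_self_iff: "x \<in> carrier M \<Longrightarrow> N +>\<^bsub>M\<^esub> x = N \<longleftrightarrow> x \<in> N"
  by (metis M N abelian_group.a_coset_join1 abelian_group.a_coset_join2 submodule.axioms(1) vsp_abelian_group)

lemma coset_self: "x \<in> carrier M \<Longrightarrow> x \<in> N +>\<^bsub>M\<^esub> x"
  using abelian_subgroup.a_rcos_self[OF quotient_abelian_subgroup] by blast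

lemma coset_eq_iff:
  assumes "x \<in> carrier M" "y \<in> carrier M"
  shows "N +>\<^bsub>M\<^esub> x = N +>\<^bsub>M\<^esub> y \<longleftrightarrow> (\<exists>n\<in>N. x = n \<oplus>\<^bsub>M\<^esub> y)"
proof
  assume "N +>\<^bsub>M\<^esub> x = N +>\<^bsub>M\<^esub> y"
  then show "\<exists>n\<in>N. x = n \<oplus>\<^bsub>M\<^esub> y" using coset_self[OF assms(1)] by (auto simp: a_r_coset_def')
next
  assume "\<exists>n\<in>N. x = n \<oplus>\<^bsub>M\<^esub> y"
  then have "x \<in> N +>\<^bsub>M\<^esub> y" by (auto simp: a_r_coset_def')
  then show "N +>\<^bsub>M\<^esub> x = N +>\<^bsub>M\<^esub> y"
    by (metis M N abelian_group.a_repr_independence assms(2) submodule.axioms(1) vsp_abelian_group)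
qed

lemma coset_smult:
  assumes x: "x \<in> carrier M"
  shows "c \<odot>\<^bsub>quotient M N\<^esub> (N +>\<^bsub>M\<^esub> x) = N +>\<^bsub>M\<^esub> (c \<odot>\<^bsub>M\<^esub> x)"
proof -
  have sub: "N \<subseteq> carrier M" and cl: "\<And>c x. x \<in> N \<Longrightarrow> c \<odot>\<^bsub>M\<^esub> x \<in> N"
    using N by (auto simp: submodule_iff[OF M])
  have "N +>\<^bsub>M\<^esub> (c \<odot>\<^bsub>M\<^esub> y) = N +>\<^bsub>M\<^esub> (c \<odot>\<^bsub>M\<^esub> x)" if y: "y \<in> N +>\<^bsub>M\<^esub> x" for y
  proof -
    obtain n where n: "n \<in> N" "y = n \<oplus>\<^bsub>M\<^esub> x" using y by (auto simp: a_r_coset_def')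
    then have nM: "n \<in> carrier M" using sub by auto
    have yM: "y \<in> carrier M"
      unfolding n(2) using abelian_group.axioms(1)[OF vsp_abelian_group[OF M]] nM x
      by (rule abelian_monoid.a_closed)
    have "c \<odot>\<^bsub>M\<^esub> y = c \<odot>\<^bsub>M\<^esub> n \<oplus>\<^bsub>M\<^esub> c \<odot>\<^bsub>M\<^esub> x"
      unfolding n(2) by (rule vsp_smult_r_distr[OF M nM x])
    then show ?thesis
      by (intro coset_eq_iff[THEN iffD2] bexI[OF _ cl[OF n(1)]] vsp_smult_closed[OF M] x yM)
  qed
  then show ?thesis using coset_self[OF x] unfolding quotient_simps by blast
qed

lemma vsp_quotient: "vsp (quotient M N)"
proof -
  interpret M: abelian_group M using vsp_abelian_group[OF M] .
  have z: "\<zero>\<^bsub>quotient M N\<^esub> = N +>\<^bsub>M\<^esub> \<zero>\<^bsub>M\<^esub>"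
    using N by (simp add: quotient_simps(2) coset_eq_self_iff submodule_iff[OF M])
  have inv: "\<exists>y\<in>carrier M. (N +>\<^bsub>M\<^esub> y) \<oplus>\<^bsub>quotient M N\<^esub> (N +>\<^bsub>M\<^esub> x) = N +>\<^bsub>M\<^esub> \<zero>\<^bsub>M\<^esub>"
    if "x \<in> carrier M" for x
    using that by (intro bexI[of _ "\<ominus>\<^bsub>M\<^esub> x"]) (simp_all add: coset_add M.l_neg)
  show ?thesis
  proof (rule vspI)
    show "abelian_group (quotient M N)"
      by (rule abelian_groupI)
        (use inv in \<open>auto simp: z quotient_simps(1) coset_add M.a_ac\<close>)
  qed (auto simp: quotient_simps(1) coset_smult coset_add vsp_smult_closed[OF M] vsp_smult_l_distr[OF M]
      vsp_smult_r_distr[OF M] vsp_smult_assoc[OF M] vsp_smult_one[OF M])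
qed

lemma lhom_coset: "lhom M (quotient M N) (\<lambda>x. N +>\<^bsub>M\<^esub> x)"
  by (simp add: lhom_def coset_add coset_smult) (simp add: quotient_simps)

end

section \<open>Criteria for isomorphism with a given space\<close>

lemma zero_space_simps [simp]:
  "carrier (zero_space :: ('k::field, 'k) module) = {0}"
  "x \<oplus>\<^bsub>(zero_space :: ('k, 'k) module)\<^esub> y = x + y" "c \<odot>\<^bsub>(zero_space :: ('k, 'k) module)\<^esub> x = c * x"
  "carrier (base_space :: ('k::field, 'k) module) = UNIV"
  "x \<oplus>\<^bsub>(base_space :: ('k, 'k) module)\<^esub> y = x + y" "c \<odot>\<^bsub>(base_space :: ('k, 'k) module)\<^esub> x = c * x"
  "\<zero>\<^bsub>(base_space :: ('k, 'k) module)\<^esub> = 0"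
  by (simp_all add: zero_space_def base_space_def ring.defs module.defs ring_of_type_algebra_def)

lemma vsp_base_space: "vsp (base_space :: ('k::field, 'k) module)"
proof (rule vspI)
  show "abelian_group (base_space :: ('k, 'k) module)"
    by (rule abelian_groupI) (auto simp: add_ac intro: exI[of _ "- x" for x] add.left_inverse)
qed (auto simp: algebra_simps)

lemma linearly_isomorphic_zero_spaceI:
  assumes "vsp M" "carrier M \<subseteq> {\<zero>\<^bsub>M\<^esub>}"
  shows "linearly_isomorphic M (zero_space :: ('k::field, 'k) module)"
proof -
  interpret abelian_group M using vsp_abelian_group[OF assms(1)] .
  have c: "carrier M = {\<zero>\<^bsub>M\<^esub>}" using assms(2) zero_closed by blast
  let ?f = "\<lambda>x\<in>carrier M. 0 :: 'k"
  have "?f \<in> linear_maps M zero_space"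
    by (auto simp: linear_maps_def c vsp_smult_zero[OF assms(1)])
  moreover have "bij_betw ?f (carrier M) (carrier (zero_space :: ('k, 'k) module))"
    by (simp add: c bij_betw_def)
  ultimately show ?thesis unfolding linearly_isomorphic_def by blast
qed

lemma quotient_zero_spaceD:
  assumes "linearly_isomorphic (quotient M N) (zero_space :: ('k::field, 'k) module)"
    and "x \<in> carrier M" "y \<in> carrier M"
  shows "N +>\<^bsub>M\<^esub> x = N +>\<^bsub>M\<^esub> y"
proof -
  obtain f where "bij_betw f (carrier (quotient M N)) {0 :: 'k}"
    using assms(1) by (auto simp: linearly_isomorphic_def)
  then have "inj_on f (carrier (quotient M N))" "\<And>C. C \<in> carrier (quotient M N) \<Longrightarrow> f C = 0"
    by (auto simp: bij_betw_def)
  moreover have "N +>\<^bsub>M\<^esub> x \<in> carrier (quotient M N)" "N +>\<^bsub>M\<^esub> y \<in> carrier (quotient M N)"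
    using assms(2,3) by (simp_all only: quotient_simps(1) imageI)
  ultimately show ?thesis by (metis inj_onD)
qed

text \<open>The first isomorphism theorem for \<open>quotient\<close>, with kernel and image given
  elementwise.\<close>

lemma linearly_isomorphic_quotientI:
  assumes M: "vsp M" and P: "vsp P" and N: "submodule N scalars M" and g: "lhom M P g"
    and surj: "g ` carrier M = carrier P" and ker: "\<And>x. x \<in> carrier M \<Longrightarrow> g x = \<zero>\<^bsub>P\<^esub> \<longleftrightarrow> x \<in> N"
  shows "linearly_isomorphic (quotient M N) P"
proof -
  interpret M: abelian_group M using vsp_abelian_group[OF M] .
  interpret P: abelian_group P using vsp_abelian_group[OF P] .
  have gc: "\<And>x. x \<in> carrier M \<Longrightarrow> g x \<in> carrier P"
    and ga: "\<And>x y. x \<in> carrier M \<Longrightarrow> y \<in> carrier M \<Longrightarrow> g (x \<oplus>\<^bsub>M\<^esub> y) = g x \<oplus>\<^bsub>P\<^esub> g y"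
    and gs: "\<And>c x. x \<in> carrier M \<Longrightarrow> g (c \<odot>\<^bsub>M\<^esub> x) = c \<odot>\<^bsub>P\<^esub> g x"
    using g by (auto simp: lhom_def)
  have sub: "N \<subseteq> carrier M" using N by (simp add: submodule_iff[OF M])
  have coset: "g y = g x" if "x \<in> carrier M" and y: "y \<in> N +>\<^bsub>M\<^esub> x" for x y
  proof -
    obtain n where n: "n \<in> N" "y = n \<oplus>\<^bsub>M\<^esub> x" using y by (auto simp: a_r_coset_def')
    then show ?thesis using ker[of n] that(1) sub ga[of n x] gc[of x] by auto
  qed
  \<comment> \<open>\<open>g\<close> is constant on cosets, so any representative serves.\<close>
  define F where "F = (\<lambda>C\<in>carrier (quotient M N). g (SOME x. x \<in> C))"
  have inC: "N +>\<^bsub>M\<^esub> x \<in> carrier (quotient M N)" if "x \<in> carrier M" for x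
    unfolding quotient_simps(1) using that by (rule imageI)
  have f: "F (N +>\<^bsub>M\<^esub> x) = g x" if "x \<in> carrier M" for x
  proof -
    have "(SOME y. y \<in> N +>\<^bsub>M\<^esub> x) \<in> N +>\<^bsub>M\<^esub> x"
      using coset_self[OF M N that] by (rule someI)
    then have "g (SOME y. y \<in> N +>\<^bsub>M\<^esub> x) = g x" by (rule coset[OF that])
    then show ?thesis using inC[OF that] by (simp only: F_def restrict_apply if_True)
  qed
  have cosets: "\<exists>x\<in>carrier M. C = N +>\<^bsub>M\<^esub> x" if "C \<in> carrier (quotient M N)" for C
    using that unfolding quotient_simps(1) by blast
  have "F \<in> linear_maps (quotient M N) P"
    unfolding linear_maps_def
  proof (intro CollectI conjI ballI allI)
    show "F \<in> carrier (quotient M N) \<rightarrow>\<^sub>E carrier P"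
    proof (rule PiE_I)
      fix C assume "C \<in> carrier (quotient M N)"
      then obtain x where "x \<in> carrier M" "C = N +>\<^bsub>M\<^esub> x" using cosets by blast
      then show "F C \<in> carrier P" by (simp only: f gc)
    qed (simp add: F_def)
    fix C c assume "C \<in> carrier (quotient M N)"
    then obtain x where x: "x \<in> carrier M" "C = N +>\<^bsub>M\<^esub> x" using cosets by blast
    show "F (c \<odot>\<^bsub>quotient M N\<^esub> C) = c \<odot>\<^bsub>P\<^esub> F C"
      unfolding x(2) coset_smult[OF M N x(1)] f[OF x(1)] f[OF vsp_smult_closed[OF M x(1)]] by (rule gs[OF x(1)])
    fix D assume "D \<in> carrier (quotient M N)"
    then obtain y where y: "y \<in> carrier M" "D = N +>\<^bsub>M\<^esub> y" using cosets by blast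
    show "F (C \<oplus>\<^bsub>quotient M N\<^esub> D) = F C \<oplus>\<^bsub>P\<^esub> F D"
      unfolding x(2) y(2) coset_add[OF M N x(1) y(1)] f[OF x(1)] f[OF y(1)] f[OF M.a_closed[OF x(1) y(1)]]
      by (rule ga[OF x(1) y(1)])
  qed
  moreover have "bij_betw F (carrier (quotient M N)) (carrier P)"
  proof (rule bij_betw_imageI)
    show "inj_on F (carrier (quotient M N))"
    proof (rule inj_onI)
      fix C D assume C: "C \<in> carrier (quotient M N)" and D: "D \<in> carrier (quotient M N)" and eq: "F C = F D"
      obtain x where x: "x \<in> carrier M" "C = N +>\<^bsub>M\<^esub> x" using cosets[OF C] by blast
      obtain y where y: "y \<in> carrier M" "D = N +>\<^bsub>M\<^esub> y" using cosets[OF D] by blast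
      note xy = x y
      have "g (x \<ominus>\<^bsub>M\<^esub> y) \<oplus>\<^bsub>P\<^esub> g y = g x"
        using xy by (subst ga[symmetric]) (simp_all add: M.minus_eq M.a_assoc M.l_neg)
      also have "g x = g y" using eq unfolding x(2) y(2) f[OF x(1)] f[OF y(1)] .
      finally have "g (x \<ominus>\<^bsub>M\<^esub> y) = \<zero>\<^bsub>P\<^esub>"
        using P.add.r_cancel_one[OF gc[OF y(1)] gc[OF M.minus_closed[OF x(1) y(1)]]] by blast
      then have "x \<ominus>\<^bsub>M\<^esub> y \<in> N" using ker xy by simp
      moreover have "x = (x \<ominus>\<^bsub>M\<^esub> y) \<oplus>\<^bsub>M\<^esub> y" using xy by (simp add: M.minus_eq M.a_assoc M.l_neg)
      ultimately show "C = D" unfolding xy(2,4) coset_eq_iff[OF M N xy(1,3)] by blast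
    qed
    show "F ` carrier (quotient M N) = carrier P"
    proof (intro equalityI subsetI)
      fix y assume "y \<in> F ` carrier (quotient M N)"
      then obtain C where C: "C \<in> carrier (quotient M N)" "y = F C" by blast
      obtain x where "x \<in> carrier M" "C = N +>\<^bsub>M\<^esub> x" using cosets[OF C(1)] by blast
      then show "y \<in> carrier P" by (simp only: C(2) f gc)
    next
      fix y assume "y \<in> carrier P"
      then obtain x where "x \<in> carrier M" "y = g x" using surj by blast
      then have "y = F (N +>\<^bsub>M\<^esub> x)" "x \<in> carrier M" by (simp_all only: f)
      then show "y \<in> F ` carrier (quotient M N)" using inC by blast
    qed
  qed
  ultimately show ?thesis unfolding linearly_isomorphic_def by blast
qed

lemma submodule_carrier: "vsp M \<Longrightarrow> submodule (carrier M) scalars M"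
  unfolding vsp_def by (rule Module.module.carrier_is_submodule)

text \<open>What is needed of a complex to form its homology in one degree. For p = 0 the target C
  (p - 1) is \<open>C 0\<close> again, in agreement with \<open>homology\<close>.\<close>

locale complex_at =
  fixes C :: "nat \<Rightarrow> ('k::field, 'a) module" and d :: "nat \<Rightarrow> 'a \<Rightarrow> 'a" and p :: nat
  assumes vsp: "vsp (C p)" "vsp (C (Suc p))" "vsp (C (p - 1))"
    and lhom: "lhom (C p) (C (p - 1)) (d p)" "lhom (C (Suc p)) (C p) (d (Suc p))"
    and sq: "\<And>x. x \<in> carrier (C (Suc p)) \<Longrightarrow> d p (d (Suc p) x) = \<zero>\<^bsub>C (p - 1)\<^esub>"
begin

definition Z where "Z = {z \<in> carrier (C p). d p z = \<zero>\<^bsub>C (p - 1)\<^esub>}"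
definition B where "B = d (Suc p) ` carrier (C (Suc p))"

lemma Z_submodule: "submodule Z scalars (C p)"
  unfolding Z_def by (rule lhom_kernel[OF vsp(1,3) lhom(1)])

lemma vsp_Z: "vsp ((C p)\<lparr>carrier := Z\<rparr>)"
  by (rule vsp_restrict[OF vsp(1) Z_submodule])

lemma B_submodule: "submodule B scalars (C p)"
  unfolding B_def by (rule lhom_image[OF vsp(2,1) lhom(2) submodule_carrier[OF vsp(2)]])

lemma B_subset_Z: "B \<subseteq> Z"
  using sq lhom(2) by (auto simp: B_def Z_def lhom_def)

lemma B_submodule_Z: "submodule B scalars ((C p)\<lparr>carrier := Z\<rparr>)"
  by (rule submodule_restrict[OF vsp(1) Z_submodule B_submodule B_subset_Z])

lemma homology_eq: "homology C d p = quotient ((C p)\<lparr>carrier := Z\<rparr>) B"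
  by (simp add: homology_def Z_def B_def)

lemma vsp_homology: "vsp (homology C d p)"
  unfolding homology_eq by (rule vsp_quotient[OF vsp_Z B_submodule_Z])

lemma carrier_homology: "carrier (homology C d p) = (\<lambda>z. B +>\<^bsub>C p\<^esub> z) ` Z"
  and zero_homology: "\<zero>\<^bsub>homology C d p\<^esub> = B"
  by (simp_all add: homology_eq quotient_simps)

lemma homology_add: "x \<in> Z \<Longrightarrow> y \<in> Z \<Longrightarrow>
    (B +>\<^bsub>C p\<^esub> x) \<oplus>\<^bsub>homology C d p\<^esub> (B +>\<^bsub>C p\<^esub> y) = B +>\<^bsub>C p\<^esub> (x \<oplus>\<^bsub>C p\<^esub> y)"
  and homology_smult: "x \<in> Z \<Longrightarrow>
    c \<odot>\<^bsub>homology C d p\<^esub> (B +>\<^bsub>C p\<^esub> x) = B +>\<^bsub>C p\<^esub> (c \<odot>\<^bsub>C p\<^esub> x)"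
  using coset_add[OF vsp_Z B_submodule_Z] coset_smult[OF vsp_Z B_submodule_Z]
  by (simp_all add: homology_eq)

lemma homology_coset_eq_iff: "x \<in> Z \<Longrightarrow> y \<in> Z \<Longrightarrow>
    B +>\<^bsub>C p\<^esub> x = B +>\<^bsub>C p\<^esub> y \<longleftrightarrow> (\<exists>n\<in>B. x = n \<oplus>\<^bsub>C p\<^esub> y)"
  using coset_eq_iff[OF vsp_Z B_submodule_Z] by simp

lemma homology_coset_eq_zero_iff: "x \<in> Z \<Longrightarrow> B +>\<^bsub>C p\<^esub> x = B \<longleftrightarrow> x \<in> B"
  using coset_eq_self_iff[OF vsp_Z B_submodule_Z] by simp

lemma homology_coset_self: "x \<in> Z \<Longrightarrow> x \<in> B +>\<^bsub>C p\<^esub> x"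
  using coset_self[OF vsp_Z B_submodule_Z] by simp

end

section \<open>Presentations by finitely supported functions\<close>

text \<open>Linear maps from the type-based spaces of finitely supported functions into the
  carrier-based spaces of the definitions.\<close>

definition pmapto :: "('k::field, 'b) module \<Rightarrow> (('a \<Rightarrow>\<^sub>0 'k) \<Rightarrow> 'b) \<Rightarrow> bool" where
  "pmapto M f \<longleftrightarrow> (\<forall>p. f p \<in> carrier M) \<and> (\<forall>p q. f (p + q) = f p \<oplus>\<^bsub>M\<^esub> f q) \<and>
     (\<forall>c p. f (scl c p) = c \<odot>\<^bsub>M\<^esub> f p)"

lemma pmapto_zero: "vsp M \<Longrightarrow> pmapto M f \<Longrightarrow> f 0 = \<zero>\<^bsub>M\<^esub>"
  by (metis pm.scale_zero_left pmapto_def vsp_smult_0)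

lemma pmapto_diff_eq_zero_iff:
  assumes "vsp M" "pmapto M f"
  shows "f (p - q) = \<zero>\<^bsub>M\<^esub> \<longleftrightarrow> f p = f q"
proof -
  interpret abelian_group M using vsp_abelian_group[OF assms(1)] .
  have c: "f p \<in> carrier M" "f q \<in> carrier M" "f (p - q) \<in> carrier M" using assms(2) by (auto simp: pmapto_def)
  have "f p = f (p - q) \<oplus>\<^bsub>M\<^esub> f q" using assms(2) by (metis diff_add_cancel pmapto_def)
  then show ?thesis using c add.r_cancel_one[of "f q" "f (p - q)"] by (metis l_zero)
qed

lemma pmapto_comp: "pmapto M f \<Longrightarrow> plin g \<Longrightarrow> pmapto M (\<lambda>p. f (g p))"
  by (simp add: pmapto_def plin_add plin_scl)

lemma lhom_pmapto: "pmapto M f \<Longrightarrow> lhom M N g \<Longrightarrow> pmapto N (\<lambda>p. g (f p))"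
  by (simp add: pmapto_def lhom_def)

lemma pmapto_vimage_subspace:
  assumes "vsp M" "pmapto M f" "submodule H scalars M"
  shows "pm.subspace {p. f p \<in> H}"
  using assms(2,3) pmapto_zero[OF assms(1,2)]
  by (auto simp: pm.subspace_def submodule_iff[OF assms(1)] pmapto_def)

lemma pmapto_image_submodule:
  assumes "vsp M" "pmapto M f" "pm.subspace S"
  shows "submodule (f ` S) scalars M"
  unfolding submodule_iff[OF assms(1)]
proof (intro conjI ballI allI)
  show "f ` S \<subseteq> carrier M" using assms(2) by (auto simp: pmapto_def)
  show "\<zero>\<^bsub>M\<^esub> \<in> f ` S"
    using pm.subspace_0[OF assms(3)] pmapto_zero[OF assms(1,2)] by (metis imageI)
  fix x assume "x \<in> f ` S"
  then obtain p where p: "x = f p" "p \<in> S" by blast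
  have "c \<odot>\<^bsub>M\<^esub> x = f (scl c p)" for c using assms(2) by (simp add: p pmapto_def)
  then show "c \<odot>\<^bsub>M\<^esub> x \<in> f ` S" for c using pm.subspace_scale[OF assms(3) p(2)] by simp
  fix y assume "y \<in> f ` S"
  then obtain q where q: "y = f q" "q \<in> S" by blast
  have "x \<oplus>\<^bsub>M\<^esub> y = f (p + q)" using assms(2) by (simp add: p q pmapto_def)
  then show "x \<oplus>\<^bsub>M\<^esub> y \<in> f ` S" using pm.subspace_add[OF assms(3) p(2) q(2)] by simp
qed

text \<open>Spans in the carrier-based spaces become images of spans of words; this is how W and the
  chain spaces are identified below.\<close>

lemma linear_span_image:
  assumes "vsp M" "pmapto M f"
  shows "linear_span M (f ` S) = f ` pm.span S"
proof
  have "f ` S \<subseteq> f ` pm.span S" using pm.span_superset by blast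
  then show "linear_span M (f ` S) \<subseteq> f ` pm.span S"
    unfolding linear_span_def using pmapto_image_submodule[OF assms pm.subspace_span] by blast
  show "f ` pm.span S \<subseteq> linear_span M (f ` S)"
    unfolding linear_span_def
  proof (rule Inter_greatest, clarify)
    fix H q assume H: "submodule H scalars M" "f ` S \<subseteq> H" and q: "q \<in> pm.span S"
    have "pm.span S \<subseteq> {p. f p \<in> H}"
      by (rule pm.span_minimal[OF _ pmapto_vimage_subspace[OF assms H(1)]]) (use H(2) in blast)
    then show "f q \<in> H" using q by blast
  qed
qed

lemma pmapto_eqI:
  assumes "vsp M" "pmapto M f" "pmapto M g" "\<And>x. x \<in> keys p \<Longrightarrow> f (delta x) = g (delta x)"
  shows "f p = g p"
proof -
  have "pm.subspace {p. f p = g p}"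
    using assms(2,3) pmapto_zero[OF assms(1,2)] pmapto_zero[OF assms(1,3)]
    by (auto simp: pm.subspace_def pmapto_def)
  then have "lin delta p \<in> {p. f p = g p}"
    by (rule lin_in_subspace) (simp add: assms(4))
  then show ?thesis by simp
qed

text \<open>A surjection \<open>\<phi>\<close> from finitely supported functions onto \<open>M\<close>, together with an idempotent \<open>\<rho>\<close> that has
  the same kernel, so that \<open>\<rho> p\<close> is a normal form of \<open>\<phi> p\<close>.\<close>

definition pres :: "('k::field, 'b) module \<Rightarrow> (('a \<Rightarrow>\<^sub>0 'k) \<Rightarrow> 'b) \<Rightarrow> (('a \<Rightarrow>\<^sub>0 'k) \<Rightarrow> ('a \<Rightarrow>\<^sub>0 'k)) \<Rightarrow> bool" where
  "pres M \<phi> \<rho> \<longleftrightarrow> vsp M \<and> pmapto M \<phi> \<and> (\<forall>x\<in>carrier M. \<exists>p. \<phi> p = x) \<and> plin \<rho> \<and>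
     (\<forall>p. \<phi> (\<rho> p) = \<phi> p) \<and> (\<forall>p. \<phi> p = \<zero>\<^bsub>M\<^esub> \<longrightarrow> \<rho> p = 0)"

lemma
  assumes "pres M \<phi> \<rho>"
  shows pres_vsp: "vsp M" and pres_pmapto: "pmapto M \<phi>" and pres_plin: "plin \<rho>"
    and pres_surj: "x \<in> carrier M \<Longrightarrow> \<exists>p. \<phi> p = x" and pres_phi_rho: "\<phi> (\<rho> p) = \<phi> p"
    and pres_carrier: "\<phi> p \<in> carrier M"
    and pres_add: "\<phi> (p + q) = \<phi> p \<oplus>\<^bsub>M\<^esub> \<phi> q" and pres_scl: "\<phi> (scl c p) = c \<odot>\<^bsub>M\<^esub> \<phi> p"
    and pres_zero: "\<phi> 0 = \<zero>\<^bsub>M\<^esub>"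
  using assms pmapto_zero[of M \<phi>] by (auto simp: pres_def pmapto_def)

lemma pres_eq_iff:
  assumes "pres M \<phi> \<rho>"
  shows "\<phi> p = \<phi> q \<longleftrightarrow> \<rho> p = \<rho> q"
proof
  assume "\<phi> p = \<phi> q"
  then have "\<phi> (p - q) = \<zero>\<^bsub>M\<^esub>"
    by (simp add: pmapto_diff_eq_zero_iff[OF pres_vsp[OF assms] pres_pmapto[OF assms]])
  then have "\<rho> (p - q) = 0" using assms by (simp add: pres_def)
  then show "\<rho> p = \<rho> q" by (simp add: plin_diff[OF pres_plin[OF assms]])
next
  assume "\<rho> p = \<rho> q"
  then show "\<phi> p = \<phi> q" by (metis assms pres_phi_rho)
qed

lemma pres_eq_zero_iff: "pres M \<phi> \<rho> \<Longrightarrow> \<phi> p = \<zero>\<^bsub>M\<^esub> \<longleftrightarrow> \<rho> p = 0"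
  by (metis plin_zero pres_eq_iff pres_plin pres_zero)

lemma pres_idem: "pres M \<phi> \<rho> \<Longrightarrow> \<rho> (\<rho> p) = \<rho> p"
  by (metis pres_eq_iff pres_phi_rho)

text \<open>The preimage is chosen arbitrarily, but by \<open>pres_eq_iff\<close> the normal form
  does not depend on it.\<close>

definition nf :: "(('a \<Rightarrow>\<^sub>0 'k) \<Rightarrow> 'b) \<Rightarrow> (('a \<Rightarrow>\<^sub>0 'k) \<Rightarrow> ('a \<Rightarrow>\<^sub>0 'k)) \<Rightarrow> 'b \<Rightarrow> ('a \<Rightarrow>\<^sub>0 'k::field)" where
  "nf \<phi> \<rho> x = \<rho> (SOME p. \<phi> p = x)"

lemma nf_pres: "pres M \<phi> \<rho> \<Longrightarrow> nf \<phi> \<rho> (\<phi> p) = \<rho> p"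
  unfolding nf_def by (subst pres_eq_iff[symmetric], assumption) (rule someI, rule refl)

text \<open>Evaluates the operators that are defined by definite description. Existence:
  \<open>b\<close> induces a map because it is compatible with \<rho>. Uniqueness: \<phi> is
  surjective and members of \<open>linear_maps\<close> are extensional.\<close>

lemma THE_linear_maps:
  assumes P: "pres M \<phi> \<rho>" and b: "plin b" "\<And>p. \<phi> (b (\<rho> p)) = \<phi> (b p)"
    and Q: "\<And>f. f \<in> linear_maps M M \<Longrightarrow> Q f \<longleftrightarrow> (\<forall>p. f (\<phi> p) = \<phi> (b p))"
  shows "(THE f. f \<in> linear_maps M M \<and> Q f) (\<phi> p) = \<phi> (b p)"
    and "lhom M M (THE f. f \<in> linear_maps M M \<and> Q f)"
proof -
  define F where "F = (\<lambda>x\<in>carrier M. \<phi> (b (nf \<phi> \<rho> x)))"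
  interpret abelian_group M using vsp_abelian_group[OF pres_vsp[OF P]] .
  have F: "F (\<phi> p) = \<phi> (b p)" for p
    using pres_carrier[OF P, of p] by (simp add: F_def nf_pres[OF P] b(2))
  have FM: "F \<in> linear_maps M M"
    unfolding linear_maps_def
  proof (intro CollectI conjI ballI allI)
    show "F \<in> carrier M \<rightarrow>\<^sub>E carrier M" by (auto simp: F_def pres_carrier[OF P])
    fix x c assume "x \<in> carrier M"
    then obtain p where p: "x = \<phi> p" using pres_surj[OF P] by blast
    show "F (c \<odot>\<^bsub>M\<^esub> x) = c \<odot>\<^bsub>M\<^esub> F x"
      unfolding p F pres_scl[OF P, symmetric] plin_scl[OF b(1), symmetric] ..
    fix y assume "y \<in> carrier M"
    then obtain q where q: "y = \<phi> q" using pres_surj[OF P] by blast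
    show "F (x \<oplus>\<^bsub>M\<^esub> y) = F x \<oplus>\<^bsub>M\<^esub> F y"
      unfolding p q F pres_add[OF P, symmetric] plin_add[OF b(1), symmetric] ..
  qed
  have "(THE f. f \<in> linear_maps M M \<and> Q f) = F"
  proof (rule the_equality)
    show "F \<in> linear_maps M M \<and> Q F" using FM F by (simp add: Q)
    fix f assume f: "f \<in> linear_maps M M \<and> Q f"
    then have "\<forall>p. f (\<phi> p) = \<phi> (b p)" using Q[of f] by blast
    then have "f (\<phi> p) = F (\<phi> p)" for p by (simp only: F)
    moreover have "f \<in> extensional (carrier M)" "F \<in> extensional (carrier M)"
      using f FM by (auto simp: linear_maps_def PiE_def)
    ultimately show "f = F" using pres_surj[OF P] by (metis extensionalityI)
  qed
  then show "(THE f. f \<in> linear_maps M M \<and> Q f) (\<phi> p) = \<phi> (b p)" "lhom M M (THE f. f \<in> linear_maps M M \<and> Q f)"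
    using F FM linear_maps_lhom by simp_all
qed

subsection \<open>Tensor products\<close>

lemma free_space_simps [simp]:
  "carrier (free_space B) = {p. keys p \<subseteq> B}" "\<zero>\<^bsub>free_space B\<^esub> = 0"
  "p \<oplus>\<^bsub>free_space B\<^esub> q = p + q" "c \<odot>\<^bsub>free_space B\<^esub> p = scl c p"
  by (simp_all add: free_space_def scl_def)

lemma vsp_free_space: "vsp (free_space B :: ('k::field, 'x \<Rightarrow>\<^sub>0 'k) module)"
proof (rule vspI)
  have "keys (p + q) \<subseteq> B" if "keys p \<subseteq> B" "keys q \<subseteq> B" for p q :: "'x \<Rightarrow>\<^sub>0 'k"
    using keys_add[of p q] that by blast
  moreover have "\<exists>q. keys q \<subseteq> B \<and> p + q = 0" if "keys p \<subseteq> B" for p :: "'x \<Rightarrow>\<^sub>0 'k"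
    using that by (intro exI[of _ "- p"]) simp
  ultimately show "abelian_group (free_space B :: ('k, 'x \<Rightarrow>\<^sub>0 'k) module)"
    by (intro abelian_groupI) (auto simp: add_ac)
qed (use keys_scl in \<open>fastforce simp: pm.scale_left_distrib pm.scale_right_distrib\<close>)+

lemma submodule_free_space:
  "submodule H scalars (free_space B :: ('k::field, 'x \<Rightarrow>\<^sub>0 'k) module) \<longleftrightarrow> pm.subspace H \<and> H \<subseteq> {p. keys p \<subseteq> B}"
  by (auto simp: submodule_iff[OF vsp_free_space] pm.subspace_def)

lemma linear_span_free_space:
  assumes "S \<subseteq> {p. keys p \<subseteq> B}"
  shows "linear_span (free_space B :: ('k::field, 'x \<Rightarrow>\<^sub>0 'k) module) S = pm.span S"
proof
  have "pm.span S \<subseteq> {p. keys p \<subseteq> B}" by (rule pm.span_minimal[OF assms subspace_keys])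
  then show "linear_span (free_space B) S \<subseteq> pm.span S"
    unfolding linear_span_def submodule_free_space using pm.span_superset[of S] by blast
  show "pm.span S \<subseteq> linear_span (free_space B) S"
    unfolding linear_span_def submodule_free_space by (auto dest: pm.span_minimal)
qed

lemma tensor_relations_keys:
  fixes M :: "('k::field, 'a) module" and N :: "('k, 'b) module"
  assumes "vsp M" "vsp N"
  shows "tensor_relations M N \<subseteq> {p. keys p \<subseteq> carrier M \<times> carrier N}"
proof -
  interpret M: abelian_group M using vsp_abelian_group[OF assms(1)] .
  interpret N: abelian_group N using vsp_abelian_group[OF assms(2)] .
  have d: "keys (a - b) \<subseteq> S" if "keys a \<subseteq> S" "keys b \<subseteq> S" for a b :: "'a \<times> 'b \<Rightarrow>\<^sub>0 'k" and S
    using keys_diff[of a b] that by blast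
  have s: "keys (single k c) \<subseteq> S" if "k \<in> S" for k :: "'a \<times> 'b" and c :: 'k and S
    using that by auto
  show ?thesis
    unfolding tensor_relations_def
    by (intro Un_least subsetI; elim CollectE exE conjE; simp only:; intro CollectI d s SigmaI)
      (simp_all add: vsp_smult_closed[OF assms(1)] vsp_smult_closed[OF assms(2)])
qed

text \<open>The presentation of a tensor product from presentations of its factors: pairs of basis
  elements go to pure tensors.\<close>

definition tphi :: "('k::field, 'a) module \<Rightarrow> ('k, 'b) module \<Rightarrow> (('x \<Rightarrow>\<^sub>0 'k) \<Rightarrow> 'a) \<Rightarrow> (('y \<Rightarrow>\<^sub>0 'k) \<Rightarrow> 'b) \<Rightarrow>
    ('x \<times> 'y \<Rightarrow>\<^sub>0 'k) \<Rightarrow> ('a \<times> 'b \<Rightarrow>\<^sub>0 'k) set" where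
  "tphi M N \<phi> \<psi> p = tensor_null M N +>\<^bsub>free_space (carrier M \<times> carrier N)\<^esub>
     lin (\<lambda>(u, v). delta (\<phi> (delta u), \<psi> (delta v))) p"

context
  fixes M :: "('k::field, 'a) module" and N :: "('k, 'b) module"
    and \<phi> :: "('x \<Rightarrow>\<^sub>0 'k) \<Rightarrow> 'a" and \<psi> :: "('y \<Rightarrow>\<^sub>0 'k) \<Rightarrow> 'b"
    and \<rho> :: "('x \<Rightarrow>\<^sub>0 'k) \<Rightarrow> ('x \<Rightarrow>\<^sub>0 'k)" and \<sigma> :: "('y \<Rightarrow>\<^sub>0 'k) \<Rightarrow> ('y \<Rightarrow>\<^sub>0 'k)"
  assumes M: "pres M \<phi> \<rho>" and N: "pres N \<psi> \<sigma>"
begin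

abbreviation (input) FS :: "('k, 'a \<times> 'b \<Rightarrow>\<^sub>0 'k) module" where
  "FS \<equiv> free_space (carrier M \<times> carrier N)"

lemma tensor_null_span: "tensor_null M N = pm.span (tensor_relations M N)"
  unfolding tensor_null_def
  by (rule linear_span_free_space[OF tensor_relations_keys[OF pres_vsp[OF M] pres_vsp[OF N]]])

lemma tensor_null_submodule: "submodule (tensor_null M N) scalars FS"
  unfolding tensor_null_span submodule_free_space
  using tensor_relations_keys[OF pres_vsp[OF M] pres_vsp[OF N]]
  by (intro conjI pm.subspace_span pm.span_minimal subspace_keys)

lemma vsp_tensor: "vsp (tensor_product M N)"
  unfolding tensor_product_def by (rule vsp_quotient[OF vsp_free_space tensor_null_submodule])

lemma tensor_coset_eqI:
  assumes "keys p \<subseteq> carrier M \<times> carrier N" "keys q \<subseteq> carrier M \<times> carrier N" "p - q \<in> tensor_relations M N"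
  shows "tensor_null M N +>\<^bsub>FS\<^esub> p = tensor_null M N +>\<^bsub>FS\<^esub> q"
proof -
  have "p - q \<in> tensor_null M N" unfolding tensor_null_span using assms(3) by (rule pm.span_base)
  then show ?thesis
    using assms(1,2)
    by (subst coset_eq_iff[OF vsp_free_space tensor_null_submodule]) (auto intro!: bexI[of _ "p - q"])
qed

lemma tensor_coset_add: "keys p \<subseteq> carrier M \<times> carrier N \<Longrightarrow> keys q \<subseteq> carrier M \<times> carrier N \<Longrightarrow>
   (tensor_null M N +>\<^bsub>FS\<^esub> p) \<oplus>\<^bsub>tensor_product M N\<^esub> (tensor_null M N +>\<^bsub>FS\<^esub> q) = tensor_null M N +>\<^bsub>FS\<^esub> (p + q)"
  unfolding tensor_product_def using coset_add[OF vsp_free_space tensor_null_submodule] by simp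

lemma tensor_coset_smult: "keys p \<subseteq> carrier M \<times> carrier N \<Longrightarrow>
   c \<odot>\<^bsub>tensor_product M N\<^esub> (tensor_null M N +>\<^bsub>FS\<^esub> p) = tensor_null M N +>\<^bsub>FS\<^esub> (scl c p)"
  unfolding tensor_product_def using coset_smult[OF vsp_free_space tensor_null_submodule] by simp

lemma pure_tensor_carrier: "x \<in> carrier M \<Longrightarrow> y \<in> carrier N \<Longrightarrow> pure_tensor M N x y \<in> carrier (tensor_product M N)"
  by (simp add: tensor_product_def pure_tensor_def quotient_simps)

lemma keys_sum2: "keys p \<subseteq> S \<Longrightarrow> keys q \<subseteq> S \<Longrightarrow> keys (p + q) \<subseteq> S" for p q :: "'a \<times> 'b \<Rightarrow>\<^sub>0 'k"
  using keys_add[of p q] by blast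

lemma pure_tensor_add_left:
  assumes "x \<in> carrier M" "x' \<in> carrier M" "y \<in> carrier N"
  shows "pure_tensor M N (x \<oplus>\<^bsub>M\<^esub> x') y = pure_tensor M N x y \<oplus>\<^bsub>tensor_product M N\<^esub> pure_tensor M N x' y"
proof -
  interpret abelian_group M using vsp_abelian_group[OF pres_vsp[OF M]] .
  have "pure_tensor M N (x \<oplus>\<^bsub>M\<^esub> x') y = tensor_null M N +>\<^bsub>FS\<^esub> (delta (x, y) + delta (x', y))"
    unfolding pure_tensor_def
  proof (rule tensor_coset_eqI)
    show "delta (x \<oplus>\<^bsub>M\<^esub> x', y) - (delta (x, y) + delta (x', y)) \<in> tensor_relations M N"
      unfolding tensor_relations_def diff_diff_eq[symmetric] using assms by blast
  qed (simp add: assms, intro keys_sum2, simp_all add: assms)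
  then show ?thesis using assms by (simp add: pure_tensor_def tensor_coset_add)
qed

lemma pure_tensor_add_right:
  assumes "x \<in> carrier M" "y \<in> carrier N" "y' \<in> carrier N"
  shows "pure_tensor M N x (y \<oplus>\<^bsub>N\<^esub> y') = pure_tensor M N x y \<oplus>\<^bsub>tensor_product M N\<^esub> pure_tensor M N x y'"
proof -
  interpret abelian_group N using vsp_abelian_group[OF pres_vsp[OF N]] .
  have "pure_tensor M N x (y \<oplus>\<^bsub>N\<^esub> y') = tensor_null M N +>\<^bsub>FS\<^esub> (delta (x, y) + delta (x, y'))"
    unfolding pure_tensor_def
  proof (rule tensor_coset_eqI)
    show "delta (x, y \<oplus>\<^bsub>N\<^esub> y') - (delta (x, y) + delta (x, y')) \<in> tensor_relations M N"
      unfolding tensor_relations_def diff_diff_eq[symmetric] using assms by blast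
  qed (simp add: assms, intro keys_sum2, simp_all add: assms)
  then show ?thesis using assms by (simp add: pure_tensor_def tensor_coset_add)
qed

lemma pure_tensor_smult:
  assumes "x \<in> carrier M" "y \<in> carrier N"
  shows "pure_tensor M N (c \<odot>\<^bsub>M\<^esub> x) y = c \<odot>\<^bsub>tensor_product M N\<^esub> pure_tensor M N x y"
    and "pure_tensor M N x (c \<odot>\<^bsub>N\<^esub> y) = c \<odot>\<^bsub>tensor_product M N\<^esub> pure_tensor M N x y"
proof -
  have "pure_tensor M N (c \<odot>\<^bsub>M\<^esub> x) y = tensor_null M N +>\<^bsub>FS\<^esub> scl c (delta (x, y))"
    unfolding pure_tensor_def
  proof (rule tensor_coset_eqI)
    show "delta (c \<odot>\<^bsub>M\<^esub> x, y) - scl c (delta (x, y)) \<in> tensor_relations M N"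
      unfolding tensor_relations_def scl_single mult_1_right using assms by blast
  qed (use assms vsp_smult_closed[OF pres_vsp[OF M]] in auto)
  then show "pure_tensor M N (c \<odot>\<^bsub>M\<^esub> x) y = c \<odot>\<^bsub>tensor_product M N\<^esub> pure_tensor M N x y"
    using assms by (simp add: pure_tensor_def tensor_coset_smult)
  have "pure_tensor M N x (c \<odot>\<^bsub>N\<^esub> y) = tensor_null M N +>\<^bsub>FS\<^esub> scl c (delta (x, y))"
    unfolding pure_tensor_def
  proof (rule tensor_coset_eqI)
    show "delta (x, c \<odot>\<^bsub>N\<^esub> y) - scl c (delta (x, y)) \<in> tensor_relations M N"
      unfolding tensor_relations_def scl_single mult_1_right using assms by blast
  qed (use assms vsp_smult_closed[OF pres_vsp[OF N]] in auto)
  then show "pure_tensor M N x (c \<odot>\<^bsub>N\<^esub> y) = c \<odot>\<^bsub>tensor_product M N\<^esub> pure_tensor M N x y"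
    using assms by (simp add: pure_tensor_def tensor_coset_smult)
qed

lemma tphi_keys: "keys (lin (\<lambda>(u, v). delta (\<phi> (delta u), \<psi> (delta v)) :: _ \<Rightarrow>\<^sub>0 'k) p) \<subseteq> carrier M \<times> carrier N"
  by (rule order_trans[OF keys_lin]) (auto simp: pres_carrier[OF M] pres_carrier[OF N] split: prod.splits)

lemma pmapto_tphi: "pmapto (tensor_product M N) (tphi M N \<phi> \<psi>)"
  unfolding pmapto_def tphi_def
  using tphi_keys
  by (simp add: lin_add lin_scl tensor_coset_add tensor_coset_smult) (simp add: tensor_product_def quotient_simps)

lemma tphi_tens: "tphi M N \<phi> \<psi> (tens p q) = pure_tensor M N (\<phi> p) (\<psi> q)"
proof (rule pmapto_eqI[where f = "\<lambda>p. tphi M N \<phi> \<psi> (tens p q)" and g = "\<lambda>p. pure_tensor M N (\<phi> p) (\<psi> q)", OF vsp_tensor])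
  show "pmapto (tensor_product M N) (\<lambda>p. tphi M N \<phi> \<psi> (tens p q))"
    by (rule pmapto_comp[OF pmapto_tphi plin_tens_left])
  show "pmapto (tensor_product M N) (\<lambda>p. pure_tensor M N (\<phi> p) (\<psi> q))"
    by (simp add: pmapto_def pure_tensor_carrier pure_tensor_add_left pure_tensor_smult
        pres_carrier[OF M] pres_carrier[OF N] pres_add[OF M] pres_scl[OF M])
  fix x
  show "tphi M N \<phi> \<psi> (tens (delta x) q) = pure_tensor M N (\<phi> (delta x)) (\<psi> q)"
  proof (rule pmapto_eqI[where f = "\<lambda>q. tphi M N \<phi> \<psi> (tens (delta x) q)"
        and g = "\<lambda>q. pure_tensor M N (\<phi> (delta x)) (\<psi> q)", OF vsp_tensor])
    show "pmapto (tensor_product M N) (\<lambda>q. tphi M N \<phi> \<psi> (tens (delta x) q))"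
      by (rule pmapto_comp[OF pmapto_tphi plin_tens_right])
    show "pmapto (tensor_product M N) (\<lambda>q. pure_tensor M N (\<phi> (delta x)) (\<psi> q))"
      by (simp add: pmapto_def pure_tensor_carrier pure_tensor_add_right pure_tensor_smult
          pres_carrier[OF M] pres_carrier[OF N] pres_add[OF N] pres_scl[OF N])
  qed (simp add: tphi_def pure_tensor_def)
qed

lemma tphi_surj:
  assumes "x \<in> carrier (tensor_product M N)"
  shows "\<exists>p. tphi M N \<phi> \<psi> p = x"
proof -
  obtain r where r: "keys r \<subseteq> carrier M \<times> carrier N" "x = tensor_null M N +>\<^bsub>FS\<^esub> r"
    using assms by (auto simp: tensor_product_def quotient_simps)
  define T where "T = range (tphi M N \<phi> \<psi>)"
  define S where "S = {r. keys r \<subseteq> carrier M \<times> carrier N \<and> tensor_null M N +>\<^bsub>FS\<^esub> r \<in> T}"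
  have range: "submodule T scalars (tensor_product M N)"
    unfolding T_def by (rule pmapto_image_submodule[OF vsp_tensor pmapto_tphi]) (simp add: pm.subspace_UNIV)
  have "pm.subspace S"
  proof (rule pm.subspaceI)
    have "tensor_null M N +>\<^bsub>FS\<^esub> 0 = tphi M N \<phi> \<psi> 0" by (simp add: tphi_def)
    then show "0 \<in> S" by (simp add: S_def T_def)
    show "p + q \<in> S" if "p \<in> S" "q \<in> S" for p q
      using that range by (simp add: S_def submodule_iff[OF vsp_tensor] keys_sum2 tensor_coset_add[symmetric])
    show "scl c p \<in> S" if "p \<in> S" for c p
      using that range order_trans[OF keys_scl[of c p]]
      by (simp add: S_def submodule_iff[OF vsp_tensor] tensor_coset_smult[symmetric])
  qed
  then have "lin delta r \<in> S"
  proof (rule lin_in_subspace)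
    fix k assume "k \<in> keys r"
    then obtain x y where k: "k = (x, y)" "x \<in> carrier M" "y \<in> carrier N" using r(1) by auto
    then obtain p q where "\<phi> p = x" "\<psi> q = y" using pres_surj[OF M] pres_surj[OF N] by blast
    then have "tensor_null M N +>\<^bsub>FS\<^esub> delta k = tphi M N \<phi> \<psi> (tens p q)"
      by (simp add: tphi_tens pure_tensor_def k)
    then show "delta k \<in> S" using k by (auto simp: S_def T_def)
  qed
  then show ?thesis using r(2) by (auto simp: S_def T_def)
qed

text \<open>The point is that the normal form vanishes on the kernel. This is the universal
  property: the pair of normal forms is bilinear in its arguments and therefore kills the tensor
  relations.\<close>

lemma pres_tensor: "pres (tensor_product M N) (tphi M N \<phi> \<psi>) (tmap \<rho> \<sigma>)"
  unfolding pres_def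
proof (intro conjI allI ballI impI vsp_tensor pmapto_tphi plin_tmap tphi_surj)
  show "tphi M N \<phi> \<psi> (tmap \<rho> \<sigma> p) = tphi M N \<phi> \<psi> p" for p
  proof (rule pmapto_eqI[where f = "\<lambda>p. tphi M N \<phi> \<psi> (tmap \<rho> \<sigma> p)" and g = "tphi M N \<phi> \<psi>", OF vsp_tensor])
    show "pmapto (tensor_product M N) (\<lambda>p. tphi M N \<phi> \<psi> (tmap \<rho> \<sigma> p))"
      by (rule pmapto_comp[OF pmapto_tphi plin_tmap])
    fix k :: "'x \<times> 'y"
    obtain u v where "k = (u, v)" by (metis surj_pair)
    then have k: "delta k = tens (delta u) (delta v :: _ \<Rightarrow>\<^sub>0 'k)" by simp
    show "tphi M N \<phi> \<psi> (tmap \<rho> \<sigma> (delta k)) = tphi M N \<phi> \<psi> (delta k)"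
      unfolding k tmap_tens[OF pres_plin[OF M] pres_plin[OF N]] tphi_tens pres_phi_rho[OF M] pres_phi_rho[OF N] ..
  qed (rule pmapto_tphi)
next
  fix p assume "tphi M N \<phi> \<psi> p = \<zero>\<^bsub>tensor_product M N\<^esub>"
  then have "lin (\<lambda>(u, v). delta (\<phi> (delta u), \<psi> (delta v))) p \<in> tensor_null M N"
    using tphi_keys[of p] unfolding tphi_def
    by (subst coset_eq_self_iff[OF vsp_free_space tensor_null_submodule, symmetric])
      (simp_all add: tensor_product_def quotient_simps)
  \<comment> \<open>The linear map on the free space over all pairs that tensors the normal forms of
    the two entries; on representatives it computes \<open>tmap \<rho> \<sigma>\<close>.\<close>
  moreover define G where "G = lin (\<lambda>(x, y). tens (nf \<phi> \<rho> x) (nf \<psi> \<sigma> y))"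
  have "tensor_relations M N \<subseteq> {r. G r \<in> {0}}"
  proof -
    have G: "G (single (\<phi> p, \<psi> q) c) = scl c (tens (\<rho> p) (\<sigma> q))" for p q c
      by (simp add: G_def nf_pres[OF M] nf_pres[OF N])
    have "G (delta (x \<oplus>\<^bsub>M\<^esub> x', y) - delta (x, y) - delta (x', y)) = 0" if "x \<in> carrier M" "x' \<in> carrier M" "y \<in> carrier N" for x x' y
    proof -
      obtain p where p: "x = \<phi> p" using pres_surj[OF M \<open>x \<in> carrier M\<close>] by blast
      obtain p' where p': "x' = \<phi> p'" using pres_surj[OF M \<open>x' \<in> carrier M\<close>] by blast
      obtain q where q: "y = \<psi> q" using pres_surj[OF N \<open>y \<in> carrier N\<close>] by blast
      note * = p p' q
      have G': "G (a - b) = G a - G b" for a b unfolding G_def by (rule lin_diff)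
      show ?thesis
        unfolding * pres_add[OF M, symmetric] G' G by (simp add: plin_add[OF pres_plin[OF M]] tens_add_left)
    qed
    moreover have "G (delta (x, y \<oplus>\<^bsub>N\<^esub> y') - delta (x, y) - delta (x, y')) = 0" if "x \<in> carrier M" "y \<in> carrier N" "y' \<in> carrier N" for x y y'
    proof -
      obtain p where p: "x = \<phi> p" using pres_surj[OF M \<open>x \<in> carrier M\<close>] by blast
      obtain q where q: "y = \<psi> q" using pres_surj[OF N \<open>y \<in> carrier N\<close>] by blast
      obtain q' where q': "y' = \<psi> q'" using pres_surj[OF N \<open>y' \<in> carrier N\<close>] by blast
      note * = p q q'
      have G': "G (a - b) = G a - G b" for a b unfolding G_def by (rule lin_diff)
      show ?thesis
        unfolding * pres_add[OF N, symmetric] G' G by (simp add: plin_add[OF pres_plin[OF N]] tens_add_right)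
    qed
    moreover have "G (delta (c \<odot>\<^bsub>M\<^esub> x, y) - single (x, y) c) = 0"
        "G (delta (x, c \<odot>\<^bsub>N\<^esub> y) - single (x, y) c) = 0" if "x \<in> carrier M" "y \<in> carrier N" for c x y
    proof -
      obtain p where p: "x = \<phi> p" using pres_surj[OF M \<open>x \<in> carrier M\<close>] by blast
      obtain q where q: "y = \<psi> q" using pres_surj[OF N \<open>y \<in> carrier N\<close>] by blast
      note * = p q
      have G': "G (a - b) = G a - G b" for a b unfolding G_def by (rule lin_diff)
      show "G (delta (c \<odot>\<^bsub>M\<^esub> x, y) - single (x, y) c) = 0"
        unfolding * pres_scl[OF M, symmetric] G' G by (simp add: plin_scl[OF pres_plin[OF M]] tens_scl_left)
      show "G (delta (x, c \<odot>\<^bsub>N\<^esub> y) - single (x, y) c) = 0"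
        unfolding * pres_scl[OF N, symmetric] G' G by (simp add: plin_scl[OF pres_plin[OF N]] tens_scl_right)
    qed
    ultimately show ?thesis unfolding tensor_relations_def by blast
  qed
  then have "tensor_null M N \<subseteq> {r. G r \<in> {0}}"
    unfolding tensor_null_span G_def
    by (intro pm.span_minimal subspace_plin_vimage plin_lin pm.subspace_single_0)
  ultimately have "G (lin (\<lambda>(u, v). delta (\<phi> (delta u), \<psi> (delta v))) p) = 0" by blast
  also have "G (lin (\<lambda>(u, v). delta (\<phi> (delta u), \<psi> (delta v))) p) = tmap \<rho> \<sigma> p"
    unfolding tmap_def G_def lin_lin by (rule lin_cong) (auto simp: nf_pres[OF M] nf_pres[OF N])
  finally show "tmap \<rho> \<sigma> p = 0" .
qed

end

section \<open>Algebras and their quotients\<close>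

text \<open>The condition on scalars makes every ring-theoretic ideal a subspace, so that
  \<open>quotient\<close> by a generated ideal is a vector space.\<close>

definition alg :: "('k::field, 'a) module \<Rightarrow> bool" where
  "alg M \<longleftrightarrow> ring M \<and> vsp M \<and> (\<forall>c. \<forall>x\<in>carrier M. c \<odot>\<^bsub>M\<^esub> x = (c \<odot>\<^bsub>M\<^esub> \<one>\<^bsub>M\<^esub>) \<otimes>\<^bsub>M\<^esub> x)"

lemma ideal_submodule:
  assumes "alg M" "ideal S M"
  shows "submodule S scalars M"
proof -
  interpret ideal S M by fact
  have M: "vsp M" using assms(1) by (simp add: alg_def)
  have "c \<odot>\<^bsub>M\<^esub> x \<in> S" if "x \<in> S" for c x
  proof -
    have "c \<odot>\<^bsub>M\<^esub> x = (c \<odot>\<^bsub>M\<^esub> \<one>\<^bsub>M\<^esub>) \<otimes>\<^bsub>M\<^esub> x"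
      using assms(1) a_Hcarr[OF that] unfolding alg_def by blast
    then show ?thesis using I_l_closed[OF that vsp_smult_closed[OF M one_closed]] by simp
  qed
  then show ?thesis
    unfolding submodule_iff[OF M] using a_subset a_closed additive_subgroup.zero_closed[OF is_additive_subgroup]
      additive_subgroup.a_closed[OF is_additive_subgroup]
    by blast
qed

lemma quotient_mult:
  assumes "ideal S M" "x \<in> carrier M" "y \<in> carrier M"
  shows "(S +>\<^bsub>M\<^esub> x) \<otimes>\<^bsub>quotient M S\<^esub> (S +>\<^bsub>M\<^esub> y) = S +>\<^bsub>M\<^esub> (x \<otimes>\<^bsub>M\<^esub> y)"
  by (simp add: quotient_simps ideal.rcoset_mult_add[OF assms])

lemma alg_quotient:
  assumes "alg M" "ideal S M"
  shows "alg (quotient M S)"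
proof -
  interpret ideal S M by fact
  have M: "vsp M" using assms(1) by (simp add: alg_def)
  note N = ideal_submodule[OF assms]
  have key: "c \<odot>\<^bsub>M\<^esub> x = (c \<odot>\<^bsub>M\<^esub> \<one>\<^bsub>M\<^esub>) \<otimes>\<^bsub>M\<^esub> x" if "x \<in> carrier M" for c x
    using assms(1) that unfolding alg_def by blast
  have cos: "\<exists>x\<in>carrier M. C = S +>\<^bsub>M\<^esub> x" if "C \<in> carrier (quotient M S)" for C
    using that unfolding quotient_simps(1) by blast
  have cl: "S +>\<^bsub>M\<^esub> x \<in> carrier (quotient M S)" if "x \<in> carrier M" for x
    unfolding quotient_simps(1) using that by (rule imageI)
  note mult = quotient_mult[OF assms(2)] and add = coset_add[OF M N]
  have "ring (quotient M S)"
  proof (rule ringI)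
    show "abelian_group (quotient M S)" by (rule vsp_abelian_group[OF vsp_quotient[OF M N]])
    show "Group.monoid (quotient M S)"
    proof (rule monoidI)
      show "\<one>\<^bsub>quotient M S\<^esub> \<in> carrier (quotient M S)" unfolding quotient_simps(6) by (rule cl) simp
      fix C assume C: "C \<in> carrier (quotient M S)"
      obtain x where x: "x \<in> carrier M" "C = S +>\<^bsub>M\<^esub> x" using cos[OF C] by blast
      show "\<one>\<^bsub>quotient M S\<^esub> \<otimes>\<^bsub>quotient M S\<^esub> C = C" "C \<otimes>\<^bsub>quotient M S\<^esub> \<one>\<^bsub>quotient M S\<^esub> = C"
        unfolding quotient_simps(6) x(2) mult[OF one_closed x(1)] mult[OF x(1) one_closed]
        using x(1) by simp_all
      fix D assume D: "D \<in> carrier (quotient M S)"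
      obtain y where y: "y \<in> carrier M" "D = S +>\<^bsub>M\<^esub> y" using cos[OF D] by blast
      show "C \<otimes>\<^bsub>quotient M S\<^esub> D \<in> carrier (quotient M S)"
        unfolding x(2) y(2) mult[OF x(1) y(1)] by (intro cl m_closed x y)
      fix F assume F: "F \<in> carrier (quotient M S)"
      obtain z where z: "z \<in> carrier M" "F = S +>\<^bsub>M\<^esub> z" using cos[OF F] by blast
      show "C \<otimes>\<^bsub>quotient M S\<^esub> D \<otimes>\<^bsub>quotient M S\<^esub> F = C \<otimes>\<^bsub>quotient M S\<^esub> (D \<otimes>\<^bsub>quotient M S\<^esub> F)"
        unfolding x(2) y(2) z(2) mult[OF x(1) y(1)] mult[OF y(1) z(1)] mult[OF m_closed[OF x(1) y(1)] z(1)]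
          mult[OF x(1) m_closed[OF y(1) z(1)]] m_assoc[OF x(1) y(1) z(1)] ..
    qed
  next
    fix C D F assume C: "C \<in> carrier (quotient M S)" and D: "D \<in> carrier (quotient M S)" and F: "F \<in> carrier (quotient M S)"
    obtain x where x: "x \<in> carrier M" "C = S +>\<^bsub>M\<^esub> x" using cos[OF C] by blast
    obtain y where y: "y \<in> carrier M" "D = S +>\<^bsub>M\<^esub> y" using cos[OF D] by blast
    obtain z where z: "z \<in> carrier M" "F = S +>\<^bsub>M\<^esub> z" using cos[OF F] by blast
    show "(C \<oplus>\<^bsub>quotient M S\<^esub> D) \<otimes>\<^bsub>quotient M S\<^esub> F = C \<otimes>\<^bsub>quotient M S\<^esub> F \<oplus>\<^bsub>quotient M S\<^esub> D \<otimes>\<^bsub>quotient M S\<^esub> F"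
      unfolding x(2) y(2) z(2) add[OF x(1) y(1)] mult[OF a_closed[OF x(1) y(1)] z(1)] mult[OF x(1) z(1)] mult[OF y(1) z(1)]
        add[OF m_closed[OF x(1) z(1)] m_closed[OF y(1) z(1)]] l_distr[OF x(1) y(1) z(1)] ..
    show "F \<otimes>\<^bsub>quotient M S\<^esub> (C \<oplus>\<^bsub>quotient M S\<^esub> D) = F \<otimes>\<^bsub>quotient M S\<^esub> C \<oplus>\<^bsub>quotient M S\<^esub> F \<otimes>\<^bsub>quotient M S\<^esub> D"
      unfolding x(2) y(2) z(2) add[OF x(1) y(1)] mult[OF z(1) a_closed[OF x(1) y(1)]] mult[OF z(1) x(1)] mult[OF z(1) y(1)]
        add[OF m_closed[OF z(1) x(1)] m_closed[OF z(1) y(1)]] r_distr[OF x(1) y(1) z(1)] ..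
  qed
  moreover have "c \<odot>\<^bsub>quotient M S\<^esub> C = (c \<odot>\<^bsub>quotient M S\<^esub> \<one>\<^bsub>quotient M S\<^esub>) \<otimes>\<^bsub>quotient M S\<^esub> C"
    if C: "C \<in> carrier (quotient M S)" for c C
  proof -
    obtain x where x: "x \<in> carrier M" "C = S +>\<^bsub>M\<^esub> x" using cos[OF C] by blast
    show ?thesis
      unfolding x(2) quotient_simps(6) coset_smult[OF M N x(1)] coset_smult[OF M N one_closed]
        quotient_mult[OF assms(2) vsp_smult_closed[OF M one_closed] x(1)]
      using key[OF x(1)] by (rule arg_cong)
  qed
  ultimately show ?thesis using vsp_quotient[OF M N] unfolding alg_def by blast
qed

section \<open>The word algebra, its ideals and its grading\<close>

lemma word_algebra_simps [simp]:
  "carrier (word_algebra :: ('k::field, 'v list \<Rightarrow>\<^sub>0 'k) module) = UNIV"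
  "\<zero>\<^bsub>(word_algebra :: ('k, 'v list \<Rightarrow>\<^sub>0 'k) module)\<^esub> = 0"
  "p \<oplus>\<^bsub>(word_algebra :: ('k, 'v list \<Rightarrow>\<^sub>0 'k) module)\<^esub> q = p + q"
  "c \<odot>\<^bsub>(word_algebra :: ('k, 'v list \<Rightarrow>\<^sub>0 'k) module)\<^esub> p = scl c p"
  "\<one>\<^bsub>(word_algebra :: ('k, 'v list \<Rightarrow>\<^sub>0 'k) module)\<^esub> = delta []"
  "p \<otimes>\<^bsub>(word_algebra :: ('k, 'v list \<Rightarrow>\<^sub>0 'k) module)\<^esub> q = mul p q"
proof -
  have "mul p q = lin (\<lambda>u. lin (\<lambda>v. delta (u @ v)) q) p" by (simp add: mul_def tens_def lin_lin)
  then show "p \<otimes>\<^bsub>(word_algebra :: ('k, 'v list \<Rightarrow>\<^sub>0 'k) module)\<^esub> q = mul p q"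
    by (simp add: word_algebra_def lin_def pm.scale_sum_right)
qed (simp_all add: word_algebra_def free_space_def scl_def)

lemma mul_add: "mul (p + q) r = mul p r + mul q r" "mul r (p + q) = mul r p + mul r q"
  by (simp_all add: plin_add[OF plin_mul_left] plin_add[OF plin_mul_right])

lemma alg_word_algebra: "alg (word_algebra :: ('k::field, 'v list \<Rightarrow>\<^sub>0 'k) module)"
proof -
  have ag: "abelian_group (word_algebra :: ('k, 'v list \<Rightarrow>\<^sub>0 'k) module)"
  proof (rule abelian_groupI)
    show "\<exists>q\<in>carrier word_algebra. q \<oplus>\<^bsub>word_algebra\<^esub> p = \<zero>\<^bsub>word_algebra\<^esub>" for p :: "'v list \<Rightarrow>\<^sub>0 'k"
      by (intro bexI[of _ "- p"]) simp_all
  qed (auto simp: add_ac)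
  moreover have "vsp (word_algebra :: ('k, 'v list \<Rightarrow>\<^sub>0 'k) module)"
    by (rule vspI[OF ag]) (simp_all add: pm.scale_left_distrib pm.scale_right_distrib)
  moreover have "ring (word_algebra :: ('k, 'v list \<Rightarrow>\<^sub>0 'k) module)"
    by (rule ringI[OF ag]) (auto simp: mul_assoc mul_add intro!: monoidI)
  ultimately show ?thesis
    by (simp add: alg_def plin_scl[OF plin_mul_left, of c "delta []" for c, simplified, symmetric] del: scl_single)
qed

lemma vsp_word_algebra: "vsp (word_algebra :: ('k::field, 'v list \<Rightarrow>\<^sub>0 'k) module)"
  and ring_word_algebra: "ring (word_algebra :: ('k::field, 'v list \<Rightarrow>\<^sub>0 'k) module)"
  using alg_word_algebra unfolding alg_def by blast+

definition wideal :: "('v list \<Rightarrow>\<^sub>0 'k::field) set \<Rightarrow> bool" where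
  "wideal S \<longleftrightarrow> pm.subspace S \<and> (\<forall>p\<in>S. \<forall>q. mul p q \<in> S \<and> mul q p \<in> S)"

lemma widealI:
  assumes "pm.subspace S" "\<And>p u. p \<in> S \<Longrightarrow> mul (delta u) p \<in> S" "\<And>p u. p \<in> S \<Longrightarrow> mul p (delta u) \<in> S"
  shows "wideal S"
  unfolding wideal_def
proof (intro conjI ballI allI assms(1))
  fix p q assume "p \<in> S"
  have "mul p (lin delta q) \<in> S" unfolding mul_lin_right
    by (rule lin_in_subspace[OF assms(1) assms(3)]) (use \<open>p \<in> S\<close> in simp)
  moreover have "mul (lin delta q) p \<in> S" unfolding mul_lin_left
    by (rule lin_in_subspace[OF assms(1) assms(2)]) (use \<open>p \<in> S\<close> in simp)
  ultimately show "mul p q \<in> S" "mul q p \<in> S" by simp_all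
qed

lemma wideal_ideal: "wideal S \<longleftrightarrow> ideal S (word_algebra :: ('k::field, 'v list \<Rightarrow>\<^sub>0 'k) module)"
proof
  assume S: "wideal S"
  then have "submodule S scalars (word_algebra :: ('k, 'v list \<Rightarrow>\<^sub>0 'k) module)"
    by (auto simp: wideal_def submodule_iff[OF vsp_word_algebra] pm.subspace_def)
  then have "subgroup S (add_monoid (word_algebra :: ('k, 'v list \<Rightarrow>\<^sub>0 'k) module))"
    by (rule submodule.axioms)
  then show "ideal S (word_algebra :: ('k, 'v list \<Rightarrow>\<^sub>0 'k) module)"
    using S ring_word_algebra by (intro idealI) (auto simp: wideal_def)
next
  assume S: "ideal S (word_algebra :: ('k, 'v list \<Rightarrow>\<^sub>0 'k) module)"
  interpret ideal S "word_algebra :: ('k, 'v list \<Rightarrow>\<^sub>0 'k) module" by fact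
  have "pm.subspace S"
    using ideal_submodule[OF alg_word_algebra S]
    by (auto simp: submodule_iff[OF vsp_word_algebra] pm.subspace_def)
  moreover have "mul p q \<in> S \<and> mul q p \<in> S" if "p \<in> S" for p q
    using I_l_closed[OF that, of q] I_r_closed[OF that, of q] by simp
  ultimately show "wideal S" by (simp add: wideal_def)
qed

definition weight_part :: "nat \<Rightarrow> ('v list \<Rightarrow>\<^sub>0 'k::field) \<Rightarrow> ('v list \<Rightarrow>\<^sub>0 'k)" where
  "weight_part n = lin (\<lambda>u. if length u = n then delta u else 0)"

lemma plin_weight_part: "plin (weight_part n)"
  unfolding weight_part_def by (rule plin_lin)

lemma weight_part_single [simp]: "weight_part n (single u c) = (if length u = n then single u c else 0)"
  by (simp add: weight_part_def)

lemma lookup_weight_part: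
  fixes p :: "'v list \<Rightarrow>\<^sub>0 'k::field"
  shows "lookup (weight_part n p) u = (if length u = n then lookup p u else 0)"
proof -
  have "lookup (weight_part n p) u = (\<Sum>x\<in>keys p. lookup p x * lookup (if length x = n then delta x else (0 :: _ \<Rightarrow>\<^sub>0 'k)) u)"
    by (simp add: weight_part_def lin_def lookup_sum)
  also have "\<dots> = (\<Sum>x\<in>keys p. if x = u then (if length u = n then lookup p u else 0) else 0)"
    by (intro sum.cong refl) (auto simp: lookup_single)
  also have "\<dots> = (if length u = n then lookup p u else 0)"
    by (auto simp: in_keys_iff)
  finally show ?thesis .
qed

lemma weight_part_mul_delta:
  "weight_part n (mul (delta u) p) = (if length u \<le> n then mul (delta u) (weight_part (n - length u) p) else 0)"
  "weight_part n (mul p (delta u)) = (if length u \<le> n then mul (weight_part (n - length u) p) (delta u) else 0)"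
proof -
  note intros = plin_comp[OF plin_mul_right plin_weight_part] plin_comp[OF plin_weight_part plin_mul_right]
    plin_comp[OF plin_mul_left plin_weight_part] plin_comp[OF plin_weight_part plin_mul_left] pmp.linear_zero
  have 0: "mul q (0 :: 'a list \<Rightarrow>\<^sub>0 'b) = 0" "mul (0 :: 'a list \<Rightarrow>\<^sub>0 'b) q = 0" for q
    using plin_zero[OF plin_mul_right] plin_zero[OF plin_mul_left] by fast+
  show "weight_part n (mul (delta u) p) = (if length u \<le> n then mul (delta u) (weight_part (n - length u) p) else 0)"
  proof (cases "length u \<le> n")
    case True
    have "weight_part n (mul (delta u) p) = mul (delta u) (weight_part (n - length u) p)"
      by (rule plin_eqI[where f = "\<lambda>p. weight_part n (mul (delta u) p)" and g = "\<lambda>p. mul (delta u) (weight_part (n - length u) p)", OF intros(1,2)])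
        (use True in \<open>auto simp: 0\<close>)
    then show ?thesis using True by simp
  next
    case False
    have "weight_part n (mul (delta u) p) = 0"
      by (rule plin_eqI[where f = "\<lambda>p. weight_part n (mul (delta u) p)" and g = "\<lambda>p. 0", OF intros(1,5)])
        (use False in auto)
    then show ?thesis using False by simp
  qed
  show "weight_part n (mul p (delta u)) = (if length u \<le> n then mul (weight_part (n - length u) p) (delta u) else 0)"
  proof (cases "length u \<le> n")
    case True
    have "weight_part n (mul p (delta u)) = mul (weight_part (n - length u) p) (delta u)"
      by (rule plin_eqI[where f = "\<lambda>p. weight_part n (mul p (delta u))" and g = "\<lambda>p. mul (weight_part (n - length u) p) (delta u)", OF intros(3,4)])
        (use True in \<open>auto simp: 0\<close>)
    then show ?thesis using True by simp
  next
    case False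
    have "weight_part n (mul p (delta u)) = 0"
      by (rule plin_eqI[where f = "\<lambda>p. weight_part n (mul p (delta u))" and g = "\<lambda>p. 0", OF intros(3,5)])
        (use False in auto)
    then show ?thesis using False by simp
  qed
qed

lemma sum_weight_part: "p = (\<Sum>n\<in>length ` keys p. weight_part n p)"
proof (rule poly_mapping_eqI)
  fix u
  show "lookup p u = lookup (\<Sum>n\<in>length ` keys p. weight_part n p) u"
    by (auto simp: lookup_sum lookup_weight_part in_keys_iff image_iff)
qed

lemma lookup_mul_delta_Nil:
  fixes p :: "'v list \<Rightarrow>\<^sub>0 'k::field"
  shows "lookup (mul (delta u) p) [] = (if u = [] then lookup p [] else 0)"
  "lookup (mul p (delta u)) [] = (if u = [] then lookup p [] else 0)"
proof -
  have "lookup (mul p q) [] = 0" if "[] \<notin> keys p \<or> [] \<notin> keys q" for p q :: "'v list \<Rightarrow>\<^sub>0 'k"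
    using keys_mul[of p q] that by (auto simp: in_keys_iff)
  from this[of "delta u" p] this[of p "delta u"]
  show "lookup (mul (delta u) p) [] = (if u = [] then lookup p [] else 0)"
    "lookup (mul p (delta u)) [] = (if u = [] then lookup p [] else 0)" by auto
qed

text \<open>The largest homogeneous part of an ideal, without constant terms, is again an ideal. By
  minimality, an ideal generated by homogeneous elements of positive weight is homogeneous.\<close>

lemma wideal_homogeneous:
  assumes "wideal S"
  shows "wideal {p. (\<forall>n. weight_part n p \<in> S) \<and> lookup p [] = 0}"
proof (rule widealI)
  have S: "pm.subspace S" using assms by (simp add: wideal_def)
  show "pm.subspace {p. (\<forall>n. weight_part n p \<in> S) \<and> lookup p [] = 0}"
    using S by (auto simp: pm.subspace_def plin_zero[OF plin_weight_part] plin_add[OF plin_weight_part] plin_scl[OF plin_weight_part] lookup_add)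
  fix p u assume "p \<in> {p. (\<forall>n. weight_part n p \<in> S) \<and> lookup p [] = 0}"
  then show "mul (delta u) p \<in> {p. (\<forall>n. weight_part n p \<in> S) \<and> lookup p [] = 0}"
    "mul p (delta u) \<in> {p. (\<forall>n. weight_part n p \<in> S) \<and> lookup p [] = 0}"
    using assms pm.subspace_0[OF S] by (auto simp: weight_part_mul_delta lookup_mul_delta_Nil wideal_def)
qed

lemma weight_part_homogeneous: "keys p \<subseteq> {u. length u = m} \<Longrightarrow> weight_part n p = (if n = m then p else 0)"
  by (intro poly_mapping_eqI) (auto simp: lookup_weight_part in_keys_iff subset_iff)

section \<open>The tensor algebra and the quadratic algebra\<close>

locale quad =
  fixes sc :: "'k::field_char_0 \<Rightarrow> 'v::ab_group_add \<Rightarrow> 'v" and R :: "('k, 'v) tens set"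
  assumes vs: "vector_space sc" and R: "quadratic_relations sc R"
begin

interpretation vs: vector_space sc by (rule vs)

abbreviation "WA \<equiv> word_algebra :: ('k, 'v list \<Rightarrow>\<^sub>0 'k) module"
abbreviation "T \<equiv> tensor_algebra sc"
abbreviation "A \<equiv> quadratic_algebra sc R"

definition J where "J = linearity_ideal sc"
definition gens where "gens =
     range (\<lambda>(x, y). single [x + y] 1 - single [x] 1 - single [y] (1 :: 'k)) \<union>
      range (\<lambda>(c, x). single [sc c x] 1 - single [x] c)"

lemma J_eq: "J = Idl\<^bsub>WA\<^esub> gens"
  by (simp add: J_def linearity_ideal_def gens_def)

lemma J_ideal: "ideal J WA"
  unfolding J_eq by (rule ring.genideal_ideal[OF ring_word_algebra]) simp

lemma J_wideal: "wideal J"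
  using J_ideal by (simp add: wideal_ideal)

lemma gens_J: "gens \<subseteq> J"
  unfolding J_eq genideal_def by blast

lemma J_minimal: "wideal S \<Longrightarrow> gens \<subseteq> S \<Longrightarrow> J \<subseteq> S"
  unfolding J_eq genideal_def wideal_ideal by blast

definition \<beta> :: "('v list \<Rightarrow>\<^sub>0 'k) \<Rightarrow> ('k, 'v) tens" where
  "\<beta> p = J +>\<^bsub>WA\<^esub> p"

lemma alg_T: "alg T"
  unfolding tensor_algebra_def J_def[symmetric] by (rule alg_quotient[OF alg_word_algebra J_ideal])

lemma vsp_T: "vsp T" and ring_T: "ring T"
  using alg_T unfolding alg_def by blast+

lemma J_submodule: "submodule J scalars WA"
  by (rule ideal_submodule[OF alg_word_algebra J_ideal])

lemma pmapto_beta: "pmapto T \<beta>"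
  using lhom_coset[OF vsp_word_algebra J_submodule]
  by (simp add: pmapto_def lhom_def \<beta>_def[abs_def] tensor_algebra_def J_def[symmetric])

lemma beta_carrier: "\<beta> p \<in> carrier T"
  using pmapto_beta by (simp add: pmapto_def)

lemma beta_surj: "x \<in> carrier T \<Longrightarrow> \<exists>p. \<beta> p = x"
  by (auto simp: tensor_algebra_def J_def[symmetric] quotient_simps \<beta>_def)

lemma beta_mul: "\<beta> (mul p q) = \<beta> p \<otimes>\<^bsub>T\<^esub> \<beta> q"
  using quotient_mult[OF J_ideal, of p q] by (simp add: \<beta>_def tensor_algebra_def J_def[symmetric])

lemma beta_eq_zero: "\<beta> p = \<zero>\<^bsub>T\<^esub> \<longleftrightarrow> p \<in> J"
  using coset_eq_self_iff[OF vsp_word_algebra J_submodule, of p]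
  by (simp add: \<beta>_def tensor_algebra_def J_def[symmetric] quotient_simps)

lemma beta_eq: "\<beta> p = \<beta> q \<longleftrightarrow> p - q \<in> J"
  using pmapto_diff_eq_zero_iff[OF vsp_T pmapto_beta] beta_eq_zero by blast

lemma tensor_word_beta: "tensor_word sc xs = \<beta> (delta xs)"
  by (simp add: tensor_word_def \<beta>_def J_def)

section \<open>Expansion in a basis as the normal form of the tensor algebra\<close>

definition E :: "'v set" where "E = vs.extend_basis {}"

lemma E: "vs.independent E" "vs.span E = UNIV"
  unfolding E_def by (simp_all add: vs.independent_extend_basis vs.independent_empty vs.span_extend_basis)

definition ex :: "'v \<Rightarrow> ('v list \<Rightarrow>\<^sub>0 'k)" where
  "ex x = (\<Sum>b\<in>{b. vs.representation E x b \<noteq> 0}. single [b] (vs.representation E x b))"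

lemma lookup_ex: "lookup (ex x) u = (case u of [b] \<Rightarrow> vs.representation E x b | _ \<Rightarrow> 0)"
proof -
  have f: "finite {b. vs.representation E x b \<noteq> 0}" by (rule vs.finite_representation)
  show ?thesis
  proof (cases "length u = 1")
    case True
    then obtain b where u: "u = [b]" by (auto simp: length_Suc_conv)
    show ?thesis using f by (simp add: u ex_def lookup_sum lookup_single when_def)
  next
    case False
    then have "lookup (single [b] c) u = 0" for b and c :: 'k by (auto simp: lookup_single when_def)
    then show ?thesis using False by (auto simp: ex_def lookup_sum split: list.splits)
  qed
qed

lemma ex_add: "ex (x + y) = ex x + ex y" and ex_scale: "ex (sc c x) = scl c (ex x)"
  by (auto intro!: poly_mapping_eqI simp: lookup_ex lookup_add vs.representation_add[OF E(1)]
      vs.representation_scale[OF E(1)] E(2) split: list.splits)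

lemma ex_basis: "b \<in> E \<Longrightarrow> ex b = delta [b]"
  by (auto intro!: poly_mapping_eqI simp: lookup_ex vs.representation_basis[OF E(1)] lookup_single when_def split: list.splits)

lemma ex_FE: "ex x \<in> FE E 1"
proof -
  have "u \<in> words E 1" if "lookup (ex x) u \<noteq> 0" for u
    using that vs.representation_ne_zero[of E x] by (auto simp: lookup_ex words_def split: list.splits)
  then show ?thesis by (auto simp: FE_def in_keys_iff)
qed

text \<open>The vectors that agree with their expansion modulo \<open>J\<close> form a subspace
  containing the basis.\<close>

lemma beta_ex: "\<beta> (ex x) = \<beta> (delta [x])"
proof -
  have J: "pm.subspace J" using J_wideal by (simp add: wideal_def)
  have S: "vs.subspace {x. delta [x] - ex x \<in> J}"
  proof (rule vs.subspaceI)
    have sc: "delta [sc c x] - ex (sc c x) \<in> J" if "delta [x] - ex x \<in> J" for c x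
    proof -
      have "(delta [sc c x] - single [x] c) + scl c (delta [x] - ex x) \<in> J"
        using gens_J that by (intro pm.subspace_add[OF J] pm.subspace_scale[OF J]) (auto simp: gens_def)
      then show ?thesis by (simp add: ex_scale pm.scale_right_diff_distrib)
    qed
    then show "sc c x \<in> {x. delta [x] - ex x \<in> J}" if "x \<in> {x. delta [x] - ex x \<in> J}" for c x using that by simp
    fix x y assume x: "x \<in> {x. delta [x] - ex x \<in> J}" and y: "y \<in> {x. delta [x] - ex x \<in> J}"
    have "(delta [x + y] - delta [x] - delta [y]) + (delta [x] - ex x) + (delta [y] - ex y) \<in> J"
      using gens_J x y by (intro pm.subspace_add[OF J]) (auto simp: gens_def)
    then show "x + y \<in> {x. delta [x] - ex x \<in> J}" by (simp add: ex_add algebra_simps)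
  next
    \<comment> \<open>With c = 0 and x = 0 this generator is the one-letter word consisting of the
      zero vector.\<close>
    have "delta [sc 0 0] - single [0] 0 \<in> gens"
      unfolding gens_def by (rule UnI2, rule range_eqI[of _ _ "(0, 0)"]) simp
    moreover have "ex 0 = 0" using ex_scale[of 0 0] by simp
    ultimately show "0 \<in> {x. delta [x] - ex x \<in> J}" using gens_J by auto
  qed
  have "E \<subseteq> {x. delta [x] - ex x \<in> J}" using pm.subspace_0[OF J] by (auto simp: ex_basis)
  then have "vs.span E \<subseteq> {x. delta [x] - ex x \<in> J}" by (rule vs.span_minimal[OF _ S])
  then have "delta [x] - ex x \<in> J" using E(2) by auto
  then show ?thesis by (metis beta_eq)
qed

definition ew :: "'v list \<Rightarrow> ('v list \<Rightarrow>\<^sub>0 'k)" where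
  "ew xs = foldr (\<lambda>x p. mul (ex x) p) xs (delta [])"

lemma ew_simps [simp]: "ew [] = delta []" "ew (x # xs) = mul (ex x) (ew xs)"
  by (simp_all add: ew_def)

lemma ew_append: "ew (xs @ ys) = mul (ew xs) (ew ys)"
  by (induction xs) (simp_all add: mul_assoc)

text \<open>Every letter is replaced by its basis expansion. This is an algebra endomorphism of the
  word algebra with kernel \<open>J\<close>, which identifies the tensor algebra with words over
  \<open>E\<close>.\<close>

definition rT :: "('v list \<Rightarrow>\<^sub>0 'k) \<Rightarrow> ('v list \<Rightarrow>\<^sub>0 'k)" where
  "rT = lin ew"

lemma plin_rT: "plin rT"
  unfolding rT_def by (rule plin_lin)

lemma rT_delta [simp]: "rT (delta xs) = ew xs"
  by (simp add: rT_def)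

lemma rT_mul: "rT (mul p q) = mul (rT p) (rT q)"
  by (rule bilinear_eqI[where f = "\<lambda>p q. rT (mul p q)" and g = "\<lambda>p q. mul (rT p) (rT q)"])
    ((intro plin_intros4 plin_comp[OF _ plin_rT] plin_comp[OF plin_rT] plin_mul_left plin_mul_right plin_rT)+, simp add: ew_append)

lemma ew_FE: "ew xs \<in> FE E (length xs)"
proof (induction xs)
  case (Cons x xs)
  then show ?case using mul_FE[OF ex_FE Cons] by simp
qed (simp add: delta_FE)

lemma ew_basis: "set xs \<subseteq> E \<Longrightarrow> ew xs = delta xs"
  by (induction xs) (simp_all add: ex_basis)

lemma rT_id: "p \<in> FL E \<Longrightarrow> rT p = p"
  by (rule plin_eqI[OF plin_rT plin_ident]) (auto simp: FL_def intro!: ew_basis)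

lemma rT_FL: "rT p \<in> FL E"
  unfolding rT_def by (rule lin_in_subspace[OF subspace_FL]) (use ew_FE FE_subset_FL in blast)

lemma beta_rT: "\<beta> (rT p) = \<beta> p"
proof (rule pmapto_eqI[where f = "\<lambda>p. \<beta> (rT p)", OF vsp_T pmapto_comp[OF pmapto_beta plin_rT] pmapto_beta])
  fix xs show "\<beta> (rT (delta xs)) = \<beta> (delta xs)"
  proof (induction xs)
    case (Cons x xs)
    have "\<beta> (rT (delta (x # xs))) = \<beta> (delta [x]) \<otimes>\<^bsub>T\<^esub> \<beta> (delta xs)"
      using Cons by (simp add: beta_mul beta_ex)
    also have "\<dots> = \<beta> (delta (x # xs))" by (simp add: beta_mul[symmetric])
    finally show ?case .
  qed simp
qed

lemma rT_J: "p \<in> J \<Longrightarrow> rT p = 0"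
proof -
  have "J \<subseteq> {p. rT p \<in> {0}}"
  proof (rule J_minimal)
    show "wideal {p. rT p \<in> {0}}"
      unfolding wideal_def
      by (intro conjI subspace_plin_vimage plin_rT pm.subspace_single_0)
        (auto simp: rT_mul plin_zero[OF plin_mul_left] plin_zero[OF plin_mul_right])
    show "gens \<subseteq> {p. rT p \<in> {0}}"
      by (auto simp: gens_def plin_diff[OF plin_rT] ex_add ex_scale)
        (simp add: rT_def)
  qed
  then show "p \<in> J \<Longrightarrow> rT p = 0" by blast
qed

lemma pres_T: "pres T \<beta> rT"
  unfolding pres_def
  using vsp_T pmapto_beta beta_surj plin_rT beta_rT rT_J by (auto simp: beta_eq_zero)

end

section \<open>Relations, the quadratic algebra and a homogeneous normal form\<close>

context quad begin

lemma tensor_power_eq: "tensor_power sc n = \<beta> ` FE E n"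
proof -
  have "tensor_power sc n = \<beta> ` pm.span (delta ` {xs. length xs = n})"
    unfolding tensor_power_def linear_span_image[OF vsp_T pmapto_beta, symmetric]
    by (simp add: image_image tensor_word_beta)
  also have "\<dots> = \<beta> ` FE E n"
  proof (intro equalityI image_subsetI)
    fix p :: "'v list \<Rightarrow>\<^sub>0 'k" assume "p \<in> pm.span (delta ` {xs. length xs = n})"
    then have "rT p \<in> pm.span (FE E n)"
      by (rule plin_span_subset[OF plin_rT]) (use ew_FE in \<open>auto intro!: pm.span_base\<close>)
    then have "rT p \<in> FE E n" by (simp add: pm.span_eq_iff[THEN iffD2, OF subspace_FE])
    then show "\<beta> p \<in> \<beta> ` FE E n" by (metis beta_rT imageI)
  next
    fix p :: "'v list \<Rightarrow>\<^sub>0 'k" assume p: "p \<in> FE E n"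
    have "lin delta p \<in> pm.span (delta ` {xs. length xs = n})"
      by (rule lin_in_subspace[OF pm.subspace_span]) (use p in \<open>auto simp: FE_def words_def intro!: pm.span_base\<close>)
    then show "\<beta> p \<in> \<beta> ` pm.span (delta ` {xs. length xs = n})" by simp
  qed
  finally show ?thesis .
qed

lemma beta_inj: "p \<in> FL E \<Longrightarrow> q \<in> FL E \<Longrightarrow> \<beta> p = \<beta> q \<longleftrightarrow> p = q"
  using pres_eq_iff[OF pres_T, of p q] by (simp add: rT_id)

definition Rm :: "('v list \<Rightarrow>\<^sub>0 'k) set" where
  "Rm = {r \<in> FE E 2. \<beta> r \<in> R}"

lemma R_submodule: "submodule R scalars T" and R_power: "R \<subseteq> tensor_power sc 2"
  using R by (simp_all add: quadratic_relations_def)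

lemma Rm_subspace: "pm.subspace Rm"
proof -
  have "Rm = FE E 2 \<inter> {r. \<beta> r \<in> R}" by (auto simp: Rm_def)
  then show ?thesis
    using pmapto_vimage_subspace[OF vsp_T pmapto_beta R_submodule]
    by (simp add: pm.subspace_inter subspace_FE)
qed

lemma R_eq: "R = \<beta> ` Rm"
  using R_power by (auto simp: Rm_def tensor_power_eq)

definition IT where "IT = Idl\<^bsub>T\<^esub> R"

lemma R_carrier: "R \<subseteq> carrier T"
  using R_submodule by (simp add: submodule_iff[OF vsp_T])

lemma IT_ideal: "ideal IT T"
  unfolding IT_def by (rule ring.genideal_ideal[OF ring_T R_carrier])

lemma R_IT: "R \<subseteq> IT"
  unfolding IT_def genideal_def by blast

lemma IT_minimal: "ideal S T \<Longrightarrow> R \<subseteq> S \<Longrightarrow> IT \<subseteq> S"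
  unfolding IT_def genideal_def by blast

lemma IT_submodule: "submodule IT scalars T"
  by (rule ideal_submodule[OF alg_T IT_ideal])

lemma A_eq: "A = quotient T IT"
  by (simp add: quadratic_algebra_def IT_def)

lemma alg_A: "alg A"
  unfolding A_eq by (rule alg_quotient[OF alg_T IT_ideal])

lemma vsp_A: "vsp A"
  using alg_A unfolding alg_def by blast

definition \<alpha> :: "('v list \<Rightarrow>\<^sub>0 'k) \<Rightarrow> ('k, 'v) qalg" where
  "\<alpha> p = IT +>\<^bsub>T\<^esub> \<beta> p"

lemma pmapto_alpha: "pmapto A \<alpha>"
  unfolding \<alpha>_def[abs_def] A_eq by (rule lhom_pmapto[OF pmapto_beta lhom_coset[OF vsp_T IT_submodule]])

lemma alpha_surj:
  assumes "x \<in> carrier A"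
  shows "\<exists>p. \<alpha> p = x"
proof -
  obtain t where "t \<in> carrier T" "x = IT +>\<^bsub>T\<^esub> t" using assms unfolding A_eq quotient_simps(1) by blast
  then show ?thesis using beta_surj unfolding \<alpha>_def by metis
qed

lemma alpha_mul: "\<alpha> (mul p q) = \<alpha> p \<otimes>\<^bsub>A\<^esub> \<alpha> q"
  unfolding \<alpha>_def A_eq beta_mul quotient_mult[OF IT_ideal beta_carrier beta_carrier] ..

lemma e_A_alpha: "e_A sc R x = \<alpha> (delta [x])"
  by (simp add: e_A_def \<alpha>_def IT_def tensor_word_beta)

text \<open>The ideal of A pulled back to the word algebra; it contains the linearity ideal
  \<open>J\<close>.\<close>

definition I :: "('v list \<Rightarrow>\<^sub>0 'k) set" where "I = {p. \<beta> p \<in> IT}"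

lemma alpha_eq_zero: "\<alpha> p = \<zero>\<^bsub>A\<^esub> \<longleftrightarrow> p \<in> I"
  unfolding \<alpha>_def A_eq quotient_simps(2) coset_eq_self_iff[OF vsp_T IT_submodule beta_carrier] I_def by simp

lemma I_wideal: "wideal I"
proof -
  interpret ideal IT T by (rule IT_ideal)
  have "pm.subspace I" unfolding I_def by (rule pmapto_vimage_subspace[OF vsp_T pmapto_beta IT_submodule])
  moreover have "mul p q \<in> I \<and> mul q p \<in> I" if "p \<in> I" for p q
    using that I_r_closed[OF _ beta_carrier, of "\<beta> p" q] I_l_closed[OF _ beta_carrier, of "\<beta> p" q]
    by (simp add: I_def beta_mul)
  ultimately show ?thesis unfolding wideal_def by blast
qed

lemma I_subspace: "pm.subspace I"
  using I_wideal by (simp add: wideal_def)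

lemma J_I: "J \<subseteq> I"
proof
  fix p assume "p \<in> J"
  then have "\<beta> p = \<zero>\<^bsub>T\<^esub>" by (simp only: beta_eq_zero)
  then show "p \<in> I" using IT_submodule by (simp add: I_def submodule_iff[OF vsp_T])
qed

lemma J_homogeneous: "p \<in> J \<Longrightarrow> weight_part n p \<in> J" "p \<in> J \<Longrightarrow> lookup p [] = 0"
proof -
  have "J \<subseteq> {p. (\<forall>n. weight_part n p \<in> J) \<and> lookup p [] = 0}"
  proof (rule J_minimal[OF wideal_homogeneous[OF J_wideal]], rule subsetI)
    fix g assume g: "g \<in> gens"
    have d: "keys (a - b) \<subseteq> S" if "keys a \<subseteq> S" "keys b \<subseteq> S" for a b :: "'v list \<Rightarrow>\<^sub>0 'k" and S
      using keys_diff[of a b] that by blast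
    from g have "(\<exists>x y. g = delta [x + y] - delta [x] - delta [y]) \<or>
        (\<exists>c x. g = delta [sc c x] - single [x] c)"
      by (auto simp: gens_def)
    then have k: "keys g \<subseteq> {u. length u = 1}"
      by (elim disjE exE; simp only:; intro d; simp)
    have "0 \<in> J" using J_wideal by (simp add: wideal_def pm.subspace_0)
    then show "g \<in> {p. (\<forall>n. weight_part n p \<in> J) \<and> lookup p [] = 0}"
      using g gens_J k by (auto simp: weight_part_homogeneous[OF k] in_keys_iff)
  qed
  then show "p \<in> J \<Longrightarrow> weight_part n p \<in> J" "p \<in> J \<Longrightarrow> lookup p [] = 0" by blast+
qed

text \<open>The homogeneous part of \<open>I\<close> is an ideal; its image in the tensor algebra
  contains the relations, which have weight 2, and so contains \<open>IT\<close>.\<close>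

lemma I_homogeneous: "p \<in> I \<Longrightarrow> weight_part n p \<in> I" "p \<in> I \<Longrightarrow> lookup p [] = 0"
proof -
  define S where "S = {p. (\<forall>n. weight_part n p \<in> I) \<and> lookup p [] = 0}"
  have wS: "wideal S" unfolding S_def by (rule wideal_homogeneous[OF I_wideal])
  then have S: "pm.subspace S" "\<And>p q. p \<in> S \<Longrightarrow> mul q p \<in> S" "\<And>p q. p \<in> S \<Longrightarrow> mul p q \<in> S"
    by (simp_all add: wideal_def)
  have sub: "submodule (\<beta> ` S) scalars T"
    by (rule pmapto_image_submodule[OF vsp_T pmapto_beta S(1)])
  have "ideal (\<beta> ` S) T"
  proof (rule idealI[OF ring_T])
    show "subgroup (\<beta> ` S) (add_monoid T)" using sub by (rule submodule.axioms)
    fix a x assume "a \<in> \<beta> ` S" "x \<in> carrier T"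
    then obtain p q where pq: "a = \<beta> p" "p \<in> S" "x = \<beta> q" using beta_surj by blast
    note m = S(2,3)[OF pq(2), of q]
    show "x \<otimes>\<^bsub>T\<^esub> a \<in> \<beta> ` S" "a \<otimes>\<^bsub>T\<^esub> x \<in> \<beta> ` S"
      unfolding pq(1,3) beta_mul[symmetric] by (rule imageI[OF m(1)], rule imageI[OF m(2)])
  qed
  moreover have "\<beta> ` Rm \<subseteq> \<beta> ` S"
  proof (rule image_mono, rule subsetI)
    fix r assume r: "r \<in> Rm"
    then have k: "keys r \<subseteq> {u. length u = 2}" by (auto simp: Rm_def FE_def words_def)
    have "r \<in> I" using r R_IT by (auto simp: Rm_def I_def)
    then show "r \<in> S"
      using k pm.subspace_0[OF I_subspace] by (auto simp: S_def weight_part_homogeneous[OF k] in_keys_iff)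
  qed
  ultimately have IT: "IT \<subseteq> \<beta> ` S" unfolding R_eq[symmetric] by (rule IT_minimal)
  have "p \<in> S" if p: "p \<in> I" for p
  proof -
    obtain s where s: "s \<in> S" "\<beta> p = \<beta> s" using IT p by (auto simp: I_def)
    \<comment> \<open>The inclusion in the tensor algebra determines \<open>p\<close> only up to
      \<open>J\<close>, which is homogeneous by itself.\<close>
    then have "p - s \<in> J" by (simp add: beta_eq)
    then have "p - s \<in> S" using J_homogeneous[of "p - s"] J_I by (auto simp: S_def)
    from pm.subspace_add[OF S(1) this s(1)] show ?thesis by simp
  qed
  then show "p \<in> I \<Longrightarrow> weight_part n p \<in> I" "p \<in> I \<Longrightarrow> lookup p [] = 0" by (simp_all add: S_def)
qed

text \<open>A projection onto \<open>I\<close> may mix weights. Keeping only its length-preserving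
  part still gives the identity on \<open>I\<close>, because \<open>I\<close> is homogeneous, and
  still maps into \<open>I\<close>; the normal form is its complement.\<close>

lemma obtain_normal_form:
  obtains rA where "plin rA" "\<And>p. rA p = 0 \<longleftrightarrow> p \<in> I" "\<And>p. p - rA p \<in> I"
    "\<And>u. keys (rA (delta u)) \<subseteq> {v. length v = length u}" "rA (delta []) = delta []"
proof -
  obtain f where f: "plin f" "\<And>p. f p \<in> I" "\<And>p. p \<in> I \<Longrightarrow> f p = p"
    using obtain_linear_projection[OF I_subspace] by blast
  define \<pi> where "\<pi> = lin (\<lambda>u. weight_part (length u) (f (delta u)))"
  have pI: "\<pi> p \<in> I" for p
    unfolding \<pi>_def by (rule lin_in_subspace[OF I_subspace]) (intro I_homogeneous f)
  have hom: "\<pi> (weight_part n p) = weight_part n p" if "p \<in> I" for n p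
  proof -
    have "\<pi> (weight_part n p) = lin (\<lambda>u. weight_part n (f (delta u))) (weight_part n p)"
      unfolding \<pi>_def by (rule lin_cong) (auto simp: in_keys_iff lookup_weight_part split: if_splits)
    also have "\<dots> = weight_part n (f (weight_part n p))"
      by (rule lin_eqI[symmetric, OF plin_comp[OF f(1) plin_weight_part]]) simp
    also have "\<dots> = weight_part n p"
      using f(3)[OF I_homogeneous(1)[OF that]] by (auto intro!: poly_mapping_eqI simp: lookup_weight_part)
    finally show ?thesis .
  qed
  have plin: "plin \<pi>" unfolding \<pi>_def by (rule plin_lin)
  have fixI: "\<pi> p = p" if "p \<in> I" for p
    by (subst (1 2) sum_weight_part) (simp add: plin_sum[OF plin] hom[OF that])
  show thesis
  proof (rule that[of "\<lambda>p. p - \<pi> p"])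
    show "plin (\<lambda>p. p - \<pi> p)" by (intro plin_minus plin_ident plin)
    show "p - \<pi> p = 0 \<longleftrightarrow> p \<in> I" for p using pI[of p] fixI[of p] by auto
    show "p - (p - \<pi> p) \<in> I" for p using pI by simp
    show "keys (delta u - \<pi> (delta u)) \<subseteq> {v. length v = length u}" for u
    proof -
      have "keys (weight_part (length u) (f (delta u))) \<subseteq> {v. length v = length u}"
        by (auto simp: in_keys_iff lookup_weight_part split: if_splits)
      then show ?thesis using keys_diff[of "delta u" "\<pi> (delta u)"] by (auto simp: \<pi>_def)
    qed
    \<comment> \<open>Elements of \<open>I\<close> have no constant term, so the normal form fixes
      the unit.\<close>
    have "weight_part 0 (f (delta [])) = 0"
      by (rule poly_mapping_eqI) (auto simp: lookup_weight_part I_homogeneous(2)[OF f(2)])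
    then show "delta [] - \<pi> (delta []) = delta []" by (simp add: \<pi>_def)
  qed
qed

end

locale quad_nf = quad sc R
  for sc :: "'k::field_char_0 \<Rightarrow> 'v::ab_group_add \<Rightarrow> 'v" and R :: "('k, 'v) tens set" +
  fixes rA :: "('v list \<Rightarrow>\<^sub>0 'k) \<Rightarrow> ('v list \<Rightarrow>\<^sub>0 'k)"
  assumes rA: "plin rA" "\<And>p. rA p = 0 \<longleftrightarrow> p \<in> I" "\<And>p. p - rA p \<in> I"
    "\<And>u. keys (rA (delta u)) \<subseteq> {v. length v = length u}" "rA (delta []) = delta []"
begin

lemma pres_A: "pres A \<alpha> rA"
  unfolding pres_def
proof (intro conjI allI ballI impI vsp_A pmapto_alpha alpha_surj rA(1))
  show "\<alpha> (rA p) = \<alpha> p" for p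
    using rA(3)[of p] pmapto_diff_eq_zero_iff[OF vsp_A pmapto_alpha, of p "rA p"] by (simp add: alpha_eq_zero)
  show "rA p = 0" if "\<alpha> p = \<zero>\<^bsub>A\<^esub>" for p using that by (simp add: alpha_eq_zero rA(2))
qed

sublocale koszul_model E Rm rA
proof (rule koszul_model.intro)
  show "plin rA" by (rule rA(1))
  show "rA (rA p) = rA p" for p by (rule pres_idem[OF pres_A])
  show "rA (mul q p) = 0" if "rA p = 0" for p q
    using that I_wideal by (simp add: rA(2) wideal_def)
  show "rA (mul p q) = 0" if "rA p = 0" for p q
    using that I_wideal by (simp add: rA(2) wideal_def)
  show "keys (rA (delta u)) \<subseteq> {v. length v = length u}" for u by (rule rA(4))
  show "rA (delta []) = delta []" by (rule rA(5))
  show "pm.subspace Rm" by (rule Rm_subspace)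
  show "rA r = 0" if "r \<in> Rm" for r
    using that R_IT by (auto simp: rA(2) I_def Rm_def)
qed

text \<open>Stripping \<open>u\<close> and \<open>v\<close> from a product of a prefix, a relation
  and a suffix leaves a multiple of the relation. Conversely \<open>in_span_sl\<close> reassembles
  \<open>w\<close> from its slices.\<close>

lemma relation_span:
  assumes w: "w \<in> FE E (i + 2 + j)"
  shows "\<beta> w \<in> linear_span T {u \<otimes>\<^bsub>T\<^esub> r \<otimes>\<^bsub>T\<^esub> v | u r v. u \<in> tensor_power sc i \<and> r \<in> R \<and> v \<in> tensor_power sc j}
    \<longleftrightarrow> (\<forall>u v. length u = i \<longrightarrow> length v = j \<longrightarrow> sl u v w \<in> Rm)" (is "?L \<longleftrightarrow> ?Q")
proof -
  let ?G = "{mul (mul u r) v | u r v. u \<in> FE E i \<and> r \<in> Rm \<and> v \<in> FE E j}"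
  have "{u \<otimes>\<^bsub>T\<^esub> r \<otimes>\<^bsub>T\<^esub> v | u r v. u \<in> tensor_power sc i \<and> r \<in> R \<and> v \<in> tensor_power sc j} = \<beta> ` ?G"
  proof (intro equalityI subsetI)
    fix x assume "x \<in> {u \<otimes>\<^bsub>T\<^esub> r \<otimes>\<^bsub>T\<^esub> v | u r v. u \<in> tensor_power sc i \<and> r \<in> R \<and> v \<in> tensor_power sc j}"
    then obtain u r v where x: "x = u \<otimes>\<^bsub>T\<^esub> r \<otimes>\<^bsub>T\<^esub> v" "u \<in> \<beta> ` FE E i" "r \<in> R" "v \<in> \<beta> ` FE E j"
      unfolding tensor_power_eq by blast
    have "r \<in> \<beta> ` Rm" using x(3) by (subst R_eq[symmetric])
    with x(2,4) obtain u' r' v' where y: "u = \<beta> u'" "u' \<in> FE E i" "r = \<beta> r'" "r' \<in> Rm" "v = \<beta> v'" "v' \<in> FE E j"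
      by blast
    have "x = \<beta> (mul (mul u' r') v')" by (simp only: x(1) y beta_mul)
    with y show "x \<in> \<beta> ` ?G" by blast
  next
    fix x assume "x \<in> \<beta> ` ?G"
    then obtain u r v where x: "x = \<beta> (mul (mul u r) v)" "u \<in> FE E i" "r \<in> Rm" "v \<in> FE E j" by blast
    have "x = \<beta> u \<otimes>\<^bsub>T\<^esub> \<beta> r \<otimes>\<^bsub>T\<^esub> \<beta> v" by (simp only: x beta_mul)
    moreover have "\<beta> r \<in> R" using x(3) by (simp add: Rm_def)
    ultimately show "x \<in> {u \<otimes>\<^bsub>T\<^esub> r \<otimes>\<^bsub>T\<^esub> v | u r v. u \<in> tensor_power sc i \<and> r \<in> R \<and> v \<in> tensor_power sc j}"
      unfolding tensor_power_eq using x(2,4) by blast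
  qed
  then have "?L \<longleftrightarrow> \<beta> w \<in> \<beta> ` pm.span ?G"
    by (simp only: linear_span_image[OF vsp_T pmapto_beta])
  also have "\<dots> \<longleftrightarrow> w \<in> pm.span ?G"
  proof -
    have "?G \<subseteq> FL E"
    proof
      fix x assume "x \<in> ?G"
      then obtain u r v where x: "x = mul (mul u r) v" "u \<in> FE E i" "r \<in> FE E 2" "v \<in> FE E j"
        unfolding Rm_def by blast
      then show "x \<in> FL E" using FE_subset_FL by (auto intro!: mul_FL)
    qed
    then have sub: "pm.span ?G \<subseteq> FL E" by (rule pm.span_minimal[OF _ subspace_FL])
    show ?thesis
    proof
      assume "\<beta> w \<in> \<beta> ` pm.span ?G"
      then obtain q where q: "q \<in> pm.span ?G" "\<beta> w = \<beta> q" by blast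
      moreover have "w \<in> FL E" "q \<in> FL E" using w FE_subset_FL sub q(1) by blast+
      ultimately have "w = q" using beta_inj by blast
      then show "w \<in> pm.span ?G" using q(1) by simp
    qed (rule imageI)
  qed
  also have "\<dots> \<longleftrightarrow> ?Q"
  proof (intro iffI allI impI)
    fix u v :: "'v list" assume wG: "w \<in> pm.span ?G" and uv: "length u = i" "length v = j"
    have "sl u v w \<in> pm.span Rm"
    proof (rule plin_span_subset[OF plin_sl wG])
      fix g assume "g \<in> ?G"
      then obtain a r b where g: "g = mul (mul a r) b" "a \<in> FE E i" "r \<in> Rm" "b \<in> FE E j" by blast
      have r: "r \<in> FE E 2" using g(3) by (simp add: Rm_def)
      have "sl u v (mul (mul a r) b) = scl (lookup a u * lookup b v) r"
      proof (rule bilinear_eqI[where f = "\<lambda>a b. sl u v (mul (mul a r) b)" and g = "\<lambda>a b. scl (lookup a u * lookup b v) r"])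
        fix x y assume "x \<in> keys a" "y \<in> keys b"
        then have "length x = i" "length y = j" using g(2,4) by (auto simp: FE_def words_def)
        then show "sl u v (mul (mul (delta x) r) (delta y)) = scl (lookup (delta x) u * lookup (delta y) v) r"
          using sl_mul_mul[OF r, of u x v y] uv by (auto simp: mul_assoc lookup_single)
      next
        show "plin (\<lambda>p. sl u v (mul (mul p r) q))" for q
          by (rule plin_comp[OF plin_comp[OF plin_mul_left plin_mul_left] plin_sl])
        show "plin (\<lambda>q. sl u v (mul (mul p r) q))" for p
          by (rule plin_comp[OF plin_mul_right plin_sl])
        show "plin (\<lambda>p. scl (lookup p u * lookup q v) r)" "plin (\<lambda>p. scl (lookup q u * lookup p v) r)" for q
          by (rule plinI; simp add: lookup_add distrib_left distrib_right pm.scale_left_distrib mult_ac)+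
      qed
      then show "sl u v g \<in> pm.span Rm" by (simp add: g pm.span_base pm.span_scale)
    qed
    then show "sl u v w \<in> Rm" by (simp add: pm.span_eq_iff[THEN iffD2, OF Rm_subspace])
  next
    assume Q: ?Q
    have "w \<in> pm.span {mul (delta u) (mul (sl u v w) (delta v)) | u v. u \<in> words E i \<and> v \<in> words E j}"
      by (rule in_span_sl[OF w])
    also have "\<dots> \<subseteq> pm.span ?G"
    proof (rule pm.span_mono, rule subsetI)
      fix x assume "x \<in> {mul (delta u) (mul (sl u v w) (delta v)) | u v. u \<in> words E i \<and> v \<in> words E j}"
      then obtain u v where x: "x = mul (mul (delta u) (sl u v w)) (delta v)" "u \<in> words E i" "v \<in> words E j"
        by (auto simp: mul_assoc)
      have "delta u \<in> FE E i" "delta v \<in> FE E j" "sl u v w \<in> Rm"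
        using x(2,3) Q by (auto simp: words_def delta_FE)
      then show "x \<in> ?G" unfolding x(1) by blast
    qed
    finally show "w \<in> pm.span ?G" .
  qed
  finally show ?thesis .
qed

lemma W_space_eq: "W_space sc R p = \<beta> ` W p"
proof -
  have "\<beta> w \<in> W_space sc R p \<longleftrightarrow> w \<in> W p" if w: "w \<in> FE E p" for w
  proof -
    have "\<beta> w \<in> tensor_power sc p" using w by (simp add: tensor_power_eq)
    then have "\<beta> w \<in> W_space sc R p \<longleftrightarrow> (\<forall>i j. i + 2 + j = p \<longrightarrow> (\<forall>u v. length u = i \<longrightarrow> length v = j \<longrightarrow> sl u v w \<in> Rm))"
      unfolding W_space_def using relation_span w by auto
    also have "\<dots> \<longleftrightarrow> w \<in> W p" using w by (auto simp: W_def)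
    finally show ?thesis .
  qed
  moreover have "W_space sc R p \<subseteq> \<beta> ` FE E p" by (auto simp: W_space_def tensor_power_eq)
  moreover have "W p \<subseteq> FE E p" using W_FE by blast
  ultimately show ?thesis by blast
qed

end

section \<open>Koszul homology in terms of words\<close>

text \<open>The formulas for the differentials with an arbitrary linear combination \<open>l\<close>
  of letters, as needed for basis expansions.\<close>

lemma lin_gens:
  "dl (tens a (mul l q)) = tens (mul a l) q" if "l \<in> FE E 1"
  by (rule trilinear_eqI[where f = "\<lambda>a l q. dl (tens a (mul l q))" and g = "\<lambda>a l q. tens (mul a l) q"])
    ((intro plin_intros3)+, use that in \<open>auto simp: FE_def words_def length_Suc_conv\<close>)

lemma eX_gens:
  assumes "l \<in> FE E 1" "q \<in> FE E n"
  shows "eX (tens a (mul q l)) = scl ((- 1) ^ Suc n) (tens (mul l a) q)"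
proof (rule trilinear_eqI[where f = "\<lambda>a l q. eX (tens a (mul q l))" and g = "\<lambda>a l q. scl ((- 1) ^ Suc n) (tens (mul l a) q)"])
  fix u x y assume x: "x \<in> keys l" and y: "y \<in> keys q"
  from x obtain b where "x = [b]" using assms(1) by (auto simp: FE_def words_def length_Suc_conv)
  moreover have "length y = n" using y assms(2) by (auto simp: FE_def words_def)
  ultimately show "eX (tens (delta u) (mul (delta y) (delta x))) = scl ((- 1) ^ Suc n) (tens (mul (delta x) (delta u)) (delta y :: _ \<Rightarrow>\<^sub>0 'b))"
    by simp
qed (intro plin_intros3)+

lemma dm_gens:
  assumes "l \<in> FE E 1" "q \<in> FE E n"
  shows "dm (tens (tens a (mul q l)) b) = scl ((- 1) ^ Suc n) (tens (tens a q) (mul l b))"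
proof (rule quadrilinear_eqI[where f = "\<lambda>a l q b. dm (tens (tens a (mul q l)) b)" and
      g = "\<lambda>a l q b. scl ((- 1) ^ Suc n) (tens (tens a q) (mul l b))"])
  fix u x y v assume x: "x \<in> keys l" and y: "y \<in> keys q"
  from x obtain c where "x = [c]" using assms(1) by (auto simp: FE_def words_def length_Suc_conv)
  moreover have "length y = n" using y assms(2) by (auto simp: FE_def words_def)
  ultimately show "dm (tens (tens (delta u) (mul (delta y) (delta x))) (delta v)) =
      scl ((- 1) ^ Suc n) (tens (tens (delta u) (delta y)) (mul (delta x) (delta v :: _ \<Rightarrow>\<^sub>0 'b)))"
    by simp
qed (intro plin_intros3)+

context quad_nf begin

abbreviation "C \<equiv> chain_space sc R"
abbreviation "BC \<equiv> bichain_space sc R"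

definition \<gamma> :: "('v key2 \<Rightarrow>\<^sub>0 'k) \<Rightarrow> ('k, 'v) kchain" where "\<gamma> = tphi A T \<alpha> \<beta>"
definition \<gamma>3 :: "('v key3 \<Rightarrow>\<^sub>0 'k) \<Rightarrow> ('k, 'v) bichain" where "\<gamma>3 = tphi C A \<gamma> \<alpha>"

lemma pres_C: "pres C \<gamma> (tmap rA rT)"
  unfolding \<gamma>_def by (rule pres_tensor[OF pres_A pres_T])

lemma pres_BC: "pres BC \<gamma>3 (tmap (tmap rA rT) rA)"
  unfolding \<gamma>3_def by (rule pres_tensor[OF pres_C pres_A])

lemma gamma_tens: "\<gamma> (tens p q) = chain_tensor sc R (\<alpha> p) (\<beta> q)"
  unfolding \<gamma>_def by (rule tphi_tens[OF pres_A pres_T])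

lemma gamma3_tens: "\<gamma>3 (tens t q) = pure_tensor C A (\<gamma> t) (\<alpha> q)"
  unfolding \<gamma>3_def by (rule tphi_tens[OF pres_C pres_A])

lemma alpha_rT: "\<alpha> (rT p) = \<alpha> p"
  by (simp add: \<alpha>_def beta_rT)

lemma alpha_surj_FL:
  assumes "a \<in> carrier A"
  shows "\<exists>p\<in>FL E. \<alpha> p = a"
  using alpha_surj[OF assms] alpha_rT rT_FL by metis

text \<open>Chains whose second word is written in basis letters: there \<open>rT\<close> acts as
  the identity, so the normal form from the presentation is \<open>nX\<close>.\<close>

definition S2 :: "('v key2 \<Rightarrow>\<^sub>0 'k) set" where
  "S2 = {z. keys z \<subseteq> {(u, xs). set xs \<subseteq> E}}"

definition S3 :: "('v key3 \<Rightarrow>\<^sub>0 'k) set" where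
  "S3 = {k. keys k \<subseteq> {((u, xs), v). set xs \<subseteq> E}}"

lemma S_subspace: "pm.subspace S2" "pm.subspace S3"
  unfolding S2_def S3_def by (rule subspace_keys)+

lemma S2_tens: "q \<in> FL E \<Longrightarrow> tens p q \<in> S2"
  using keys_tens[of p q] by (auto simp: S2_def FL_def)

lemma S3_tens: "t \<in> S2 \<Longrightarrow> tens t q \<in> S3"
  using keys_tens[of t q] by (auto simp: S2_def S3_def)

lemma rho_S2: "z \<in> S2 \<Longrightarrow> tmap rA rT z = nX z"
  by (rule plin_eqI[OF plin_tmap plin_n(1)]) (auto simp: S2_def nX_def ew_basis)

lemma rho_S3: "k \<in> S3 \<Longrightarrow> tmap (tmap rA rT) rA k = nK k"
  by (rule plin_eqI[OF plin_tmap plin_n(2)]) (auto simp: S3_def nK_def nX_def ew_basis)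

lemma lin_S2: "z \<in> S2 \<Longrightarrow> (\<And>u xs. set xs \<subseteq> E \<Longrightarrow> g (u, xs) \<in> S2) \<Longrightarrow> lin g z \<in> S2"
proof (rule lin_in_subspace[OF S_subspace(1)])
  fix k assume "z \<in> S2" "k \<in> keys z" and g: "\<And>u xs. set xs \<subseteq> E \<Longrightarrow> g (u, xs) \<in> S2"
  then obtain u xs where "k = (u, xs)" "set xs \<subseteq> E" unfolding S2_def by blast
  then show "g k \<in> S2" using g by simp
qed

lemma lin_S3: "k \<in> S3 \<Longrightarrow> (\<And>u xs v. set xs \<subseteq> E \<Longrightarrow> g ((u, xs), v) \<in> S3) \<Longrightarrow> lin g k \<in> S3"
proof (rule lin_in_subspace[OF S_subspace(2)])
  fix q assume "k \<in> S3" "q \<in> keys k" and g: "\<And>u xs v. set xs \<subseteq> E \<Longrightarrow> g ((u, xs), v) \<in> S3"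
  then obtain u xs v where "q = ((u, xs), v)" "set xs \<subseteq> E" unfolding S3_def by blast
  then show "g q \<in> S3" using g by simp
qed

lemma single_S2: "set xs \<subseteq> E \<Longrightarrow> single (u, xs) c \<in> S2"
  and single_S3: "set xs \<subseteq> E \<Longrightarrow> single ((u, xs), v) c \<in> S3"
  by (auto simp: S2_def S3_def)

lemma set_tl_butlast: "set xs \<subseteq> E \<Longrightarrow> set (tl xs) \<subseteq> E" "set xs \<subseteq> E \<Longrightarrow> set (butlast xs) \<subseteq> E"
  using list.set_sel(2)[of xs] in_set_butlastD[of _ xs] by (cases xs; auto)+

lemma ops_S2:
  assumes "z \<in> S2"
  shows "nX z \<in> S2" "eX z \<in> S2" "bX z \<in> S2"
proof -
  show "nX z \<in> S2"
    unfolding nX_def tmap_def by (rule lin_S2[OF assms]) (auto intro!: S2_tens simp: delta_FL)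
  show e: "eX z \<in> S2"
    unfolding eX_def using pm.subspace_0[OF S_subspace(1)]
    by (intro lin_S2[OF assms]) (auto intro!: single_S2 set_tl_butlast)
  have "dl z \<in> S2"
    unfolding dl_def using pm.subspace_0[OF S_subspace(1)]
    by (intro lin_S2[OF assms]) (auto intro!: single_S2 set_tl_butlast)
  then show "bX z \<in> S2" unfolding bX_def using e by (rule pm.subspace_add[OF S_subspace(1)])
qed

lemma ops_S3:
  assumes "k \<in> S3"
  shows "nK k \<in> S3" "dK k \<in> S3"
proof -
  show "nK k \<in> S3"
    unfolding nK_def tmap_def[of nX]
    by (rule lin_S3[OF assms]) (auto intro!: S3_tens ops_S2 single_S2)
  show "dK k \<in> S3"
    unfolding dK_def using pm.subspace_0[OF S_subspace(2)]
    by (intro lin_S3[OF assms]) (auto intro!: single_S3 set_tl_butlast pm.subspace_add[OF S_subspace(2)])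
qed

lemma W_FL: "w \<in> W n \<Longrightarrow> w \<in> FL E"
  using W_FE FE_subset_FL by blast

lemma AW_S2: "z \<in> AW n \<Longrightarrow> z \<in> S2"
proof -
  have "AW n \<subseteq> S2"
    unfolding AW_def by (intro pm.span_minimal S_subspace) (auto intro!: S2_tens W_FL)
  then show "z \<in> AW n \<Longrightarrow> z \<in> S2" by blast
qed

lemma AWA_S3: "k \<in> AWA n \<Longrightarrow> k \<in> S3"
proof -
  have "AWA n \<subseteq> S3"
    unfolding AWA_def by (intro pm.span_minimal S_subspace) (auto intro!: S2_tens S3_tens W_FL)
  then show "k \<in> AWA n \<Longrightarrow> k \<in> S3" by blast
qed

lemma gamma_eq_iff: "z \<in> S2 \<Longrightarrow> z' \<in> S2 \<Longrightarrow> \<gamma> z = \<gamma> z' \<longleftrightarrow> nX z = nX z'"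
  using pres_eq_iff[OF pres_C, of z z'] by (simp add: rho_S2)

lemma gamma3_eq_iff: "z \<in> S3 \<Longrightarrow> z' \<in> S3 \<Longrightarrow> \<gamma>3 z = \<gamma>3 z' \<longleftrightarrow> nK z = nK z'"
  using pres_eq_iff[OF pres_BC, of z z'] by (simp add: rho_S3)

lemma gamma_eq_zero_iff: "z \<in> S2 \<Longrightarrow> \<gamma> z = \<zero>\<^bsub>C\<^esub> \<longleftrightarrow> nX z = 0"
  using pres_eq_zero_iff[OF pres_C, of z] by (simp add: rho_S2)

lemma gamma3_eq_zero_iff: "z \<in> S3 \<Longrightarrow> \<gamma>3 z = \<zero>\<^bsub>BC\<^esub> \<longleftrightarrow> nK z = 0"
  using pres_eq_zero_iff[OF pres_BC, of z] by (simp add: rho_S3)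

subsection \<open>The differentials\<close>

lemma ew_snoc: "ew (xs @ [x]) = mul (ew xs) (ex x)"
  by (simp add: ew_append)

lemma gamma_dl: "\<gamma> (dl (tens (rA p) (ew xs))) =
    (if xs = [] then \<zero>\<^bsub>C\<^esub> else chain_tensor sc R (\<alpha> p \<otimes>\<^bsub>A\<^esub> e_A sc R (hd xs)) (tensor_word sc (tl xs)))"
proof (cases xs)
  case Nil
  have "dl (tens (rA p) (delta [])) = 0"
    by (rule plin_eqI[where f = "\<lambda>a. dl (tens a (delta []))" and g = "\<lambda>a. 0"])
      ((intro plin_intros3 pmp.linear_zero)+, simp)
  then show ?thesis by (simp add: Nil pres_zero[OF pres_C])
next
  case (Cons x ws)
  have "\<gamma> (dl (tens (rA p) (ew xs))) = \<gamma> (tens (mul (rA p) (ex x)) (ew ws))"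
    by (simp add: Cons lin_gens[OF ex_FE])
  also have "\<dots> = chain_tensor sc R (\<alpha> p \<otimes>\<^bsub>A\<^esub> e_A sc R x) (tensor_word sc ws)"
    using beta_rT[of "delta ws"]
    by (simp add: gamma_tens alpha_mul pres_phi_rho[OF pres_A] e_A_alpha tensor_word_beta \<alpha>_def[of "ex x"] beta_ex \<alpha>_def[symmetric])
  finally show ?thesis by (simp add: Cons)
qed

lemma gamma_eX: "\<gamma> (eX (tens (rA p) (ew xs))) =
    (if xs = [] then \<zero>\<^bsub>C\<^esub> else (- 1) ^ length xs \<odot>\<^bsub>C\<^esub>
      chain_tensor sc R (e_A sc R (last xs) \<otimes>\<^bsub>A\<^esub> \<alpha> p) (tensor_word sc (butlast xs)))"
proof (cases xs rule: rev_cases)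
  case Nil
  have "eX (tens (rA p) (delta [])) = 0"
    by (rule plin_eqI[where f = "\<lambda>a. eX (tens a (delta []))" and g = "\<lambda>a. 0"])
      ((intro plin_intros3 pmp.linear_zero)+, simp)
  then show ?thesis by (simp add: Nil pres_zero[OF pres_C])
next
  case (snoc ws x)
  have "\<gamma> (eX (tens (rA p) (ew xs))) = (- 1) ^ length xs \<odot>\<^bsub>C\<^esub> \<gamma> (tens (mul (ex x) (rA p)) (ew ws))"
    unfolding snoc ew_snoc eX_gens[OF ex_FE ew_FE] pres_scl[OF pres_C] by simp
  also have "\<gamma> (tens (mul (ex x) (rA p)) (ew ws)) = chain_tensor sc R (e_A sc R x \<otimes>\<^bsub>A\<^esub> \<alpha> p) (tensor_word sc ws)"
    using beta_rT[of "delta ws"]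
    by (simp add: gamma_tens alpha_mul pres_phi_rho[OF pres_A] e_A_alpha tensor_word_beta \<alpha>_def[of "ex x"] beta_ex \<alpha>_def[symmetric])
  finally show ?thesis by (simp add: snoc)
qed

text \<open>Translates a specification by values on a tensored with a word into one over the whole
  presentation, the form that \<open>THE_linear_maps\<close> takes.\<close>

lemma chain_spec:
  assumes g: "plin g" and f: "f \<in> linear_maps C C"
    and h: "\<And>p xs. h (\<alpha> p) xs = \<gamma> (g (tens (rA p) (ew xs)))"
  shows "(\<forall>a\<in>carrier A. \<forall>xs. f (chain_tensor sc R a (tensor_word sc xs)) = h a xs)
    \<longleftrightarrow> (\<forall>p. f (\<gamma> p) = \<gamma> (g (tmap rA rT p)))" (is "?L \<longleftrightarrow> ?Q")
proof
  assume L: ?L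
  show ?Q
  proof
    fix p
    show "f (\<gamma> p) = \<gamma> (g (tmap rA rT p))"
    proof (rule pmapto_eqI[where f = "\<lambda>p. f (\<gamma> p)" and g = "\<lambda>p. \<gamma> (g (tmap rA rT p))", OF pres_vsp[OF pres_C]])
      show "pmapto C (\<lambda>p. f (\<gamma> p))"
        by (rule lhom_pmapto[OF pres_pmapto[OF pres_C] linear_maps_lhom[OF f]])
      show "pmapto C (\<lambda>p. \<gamma> (g (tmap rA rT p)))"
        by (rule pmapto_comp[OF pres_pmapto[OF pres_C] plin_comp[OF plin_tmap g]])
      fix k :: "'v key2"
      obtain u xs where "k = (u, xs)" by (metis surj_pair)
      then have k: "delta k = tens (delta u) (delta xs :: _ \<Rightarrow>\<^sub>0 'k)" by simp
      have "f (\<gamma> (delta k)) = h (\<alpha> (delta u)) xs"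
        unfolding k gamma_tens tensor_word_beta[symmetric] using L pres_carrier[OF pres_A] by blast
      then show "f (\<gamma> (delta k)) = \<gamma> (g (tmap rA rT (delta k)))"
        unfolding h k by (simp add: tmap_tens plin_rA plin_rT del: tens_single)
    qed
  qed
next
  assume Q: ?Q
  show ?L
  proof (intro ballI allI)
    fix a xs assume "a \<in> carrier A"
    then obtain p where p: "a = \<alpha> p" using alpha_surj by blast
    have "f (\<gamma> (tens p (delta xs))) = \<gamma> (g (tmap rA rT (tens p (delta xs))))" using Q by blast
    then show "f (chain_tensor sc R a (tensor_word sc xs)) = h a xs"
      by (simp add: p h gamma_tens tensor_word_beta tmap_tens plin_rA plin_rT)
  qed
qed

lemma rho_idem: "tmap rA rT (tmap rA rT z) = tmap rA rT z"
  by (rule pres_idem[OF pres_C])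

lemma koszul_b_general: "koszul_b sc R (\<gamma> p) = \<gamma> (bX (tmap rA rT p))" "lhom C C (koszul_b sc R)"
proof -
  have h: "(if xs = [] then \<zero>\<^bsub>C\<^esub>
         else chain_tensor sc R (\<alpha> p \<otimes>\<^bsub>A\<^esub> e_A sc R (hd xs)) (tensor_word sc (tl xs)) \<oplus>\<^bsub>C\<^esub>
           (- 1) ^ length xs \<odot>\<^bsub>C\<^esub> chain_tensor sc R (e_A sc R (last xs) \<otimes>\<^bsub>A\<^esub> \<alpha> p) (tensor_word sc (butlast xs)))
    = \<gamma> (bX (tens (rA p) (ew xs)))" for p xs
  proof -
    interpret abelian_group C by (rule vsp_abelian_group[OF pres_vsp[OF pres_C]])
    show ?thesis unfolding bX_def pres_add[OF pres_C] gamma_dl gamma_eX by simp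
  qed
  note T = THE_linear_maps[OF pres_C plin_comp[OF plin_tmap plin_ops(3)] _ chain_spec[OF plin_ops(3) _ h]]
  show "koszul_b sc R (\<gamma> p) = \<gamma> (bX (tmap rA rT p))" "lhom C C (koszul_b sc R)"
    unfolding koszul_b_def by (rule T; simp add: rho_idem)+
qed

lemma cap_general: "cap_e_A sc R (\<gamma> p) = \<gamma> (- eX (tmap rA rT p))" "lhom C C (cap_e_A sc R)"
proof -
  have neg: "plin (\<lambda>z. - eX z)" using plin_scl_fun[OF plin_ops(2), of "- 1"] by simp
  have h: "(if xs = [] then \<zero>\<^bsub>C\<^esub>
         else (- 1) ^ (length xs - 1) \<odot>\<^bsub>C\<^esub> chain_tensor sc R (e_A sc R (last xs) \<otimes>\<^bsub>A\<^esub> \<alpha> p) (tensor_word sc (butlast xs)))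
    = \<gamma> (- eX (tens (rA p) (ew xs)))" for p xs
  proof -
    have "\<gamma> (- eX (tens (rA p) (ew xs))) = (- 1) \<odot>\<^bsub>C\<^esub> \<gamma> (eX (tens (rA p) (ew xs)))"
      using pres_scl[OF pres_C, of "- 1"] by simp
    \<comment> \<open>The cap product is minus \<open>eX\<close>; the truncated exponent is used for
      nonempty words only.\<close>
    moreover have "(- 1 :: 'k) * (- 1) ^ length xs = (- 1) ^ (length xs - 1)" if "xs \<noteq> []"
      using that by (cases "length xs") simp_all
    moreover have "chain_tensor sc R (e_A sc R (last xs) \<otimes>\<^bsub>A\<^esub> \<alpha> p) (tensor_word sc (butlast xs)) \<in> carrier C"
      unfolding e_A_alpha tensor_word_beta alpha_mul[symmetric] gamma_tens[symmetric] by (rule pres_carrier[OF pres_C])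
    ultimately show ?thesis
      by (simp add: gamma_eX vsp_smult_zero[OF pres_vsp[OF pres_C]] vsp_smult_assoc[OF pres_vsp[OF pres_C], symmetric])
  qed
  note T = THE_linear_maps[OF pres_C plin_comp[OF plin_tmap neg] _ chain_spec[OF neg _ h]]
  show "cap_e_A sc R (\<gamma> p) = \<gamma> (- eX (tmap rA rT p))" "lhom C C (cap_e_A sc R)"
    unfolding cap_e_A_def by (rule T; simp add: rho_idem)+
qed

lemma koszul_b_gamma: "z \<in> S2 \<Longrightarrow> koszul_b sc R (\<gamma> z) = \<gamma> (bX z)"
  using nX_cong(1)[OF n_idem(1), of z]
  by (simp add: koszul_b_general rho_S2 gamma_eq_iff ops_S2)

lemma cap_gamma: "z \<in> S2 \<Longrightarrow> cap_e_A sc R (\<gamma> z) = \<gamma> (- eX z)"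
  using nX_cong(2)[OF n_idem(1), of z] pm.subspace_neg[OF S_subspace(1)]
  by (simp add: cap_general rho_S2 gamma_eq_iff ops_S2 plin_uminus[OF plin_n(1)])

end

section \<open>The bimodule complex and the spaces of chains\<close>

context quad_nf begin

lemma gamma3_dK: "\<gamma>3 (dK (tens (tens (rA p) (ew xs)) (rA q))) =
    (if xs = [] then \<zero>\<^bsub>BC\<^esub>
     else bichain_tensor sc R (\<alpha> p \<otimes>\<^bsub>A\<^esub> e_A sc R (hd xs)) (tensor_word sc (tl xs)) (\<alpha> q)
       \<oplus>\<^bsub>BC\<^esub> (- 1) ^ length xs \<odot>\<^bsub>BC\<^esub>
         bichain_tensor sc R (\<alpha> p) (tensor_word sc (butlast xs)) (e_A sc R (last xs) \<otimes>\<^bsub>A\<^esub> \<alpha> q))"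
proof -
  interpret BC: abelian_group BC by (rule vsp_abelian_group[OF pres_vsp[OF pres_BC]])
  show ?thesis
  proof (cases "xs = []")
    case True
    have "dK (tens (tens (rA p) (delta [])) (rA q)) = 0"
      by (rule bilinear_eqI[where f = "\<lambda>a b. dK (tens (tens a (delta [])) b)" and g = "\<lambda>a b. 0"])
        ((intro plin_intros3 pmp.linear_zero)+, simp)
    then show ?thesis by (simp add: True pres_zero[OF pres_BC])
  next
    case False
    have "\<gamma>3 (tmap dl (\<lambda>p. p) (tens (tens (rA p) (ew xs)) (rA q))) =
        bichain_tensor sc R (\<alpha> p \<otimes>\<^bsub>A\<^esub> e_A sc R (hd xs)) (tensor_word sc (tl xs)) (\<alpha> q)"
      using False
      by (simp add: tmap_tens plin_ops plin_ident gamma3_tens gamma_dl pres_phi_rho[OF pres_A])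
    moreover have "\<gamma>3 (dm (tens (tens (rA p) (ew xs)) (rA q))) = (- 1) ^ length xs \<odot>\<^bsub>BC\<^esub>
         bichain_tensor sc R (\<alpha> p) (tensor_word sc (butlast xs)) (e_A sc R (last xs) \<otimes>\<^bsub>A\<^esub> \<alpha> q)"
    proof -
      obtain ws x where xs: "xs = ws @ [x]" using False by (cases xs rule: rev_cases) auto
      have "\<gamma>3 (dm (tens (tens (rA p) (ew xs)) (rA q))) =
          (- 1) ^ length xs \<odot>\<^bsub>BC\<^esub> \<gamma>3 (tens (tens (rA p) (ew ws)) (mul (ex x) (rA q)))"
        unfolding xs ew_snoc dm_gens[OF ex_FE ew_FE] pres_scl[OF pres_BC] by simp
      also have "\<gamma>3 (tens (tens (rA p) (ew ws)) (mul (ex x) (rA q))) =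
          bichain_tensor sc R (\<alpha> p) (tensor_word sc ws) (e_A sc R x \<otimes>\<^bsub>A\<^esub> \<alpha> q)"
        using beta_rT[of "delta ws"]
        by (simp add: gamma3_tens gamma_tens alpha_mul pres_phi_rho[OF pres_A] e_A_alpha tensor_word_beta \<alpha>_def[of "ex x"] beta_ex \<alpha>_def[symmetric])
      finally show ?thesis by (simp add: xs)
    qed
    ultimately show ?thesis using False by (simp add: dK_eq pres_add[OF pres_BC])
  qed
qed

lemma bichain_spec:
  assumes f: "f \<in> linear_maps BC BC"
    and h: "\<And>p xs q. h (\<alpha> p) xs (\<alpha> q) = \<gamma>3 (dK (tens (tens (rA p) (ew xs)) (rA q)))"
  shows "(\<forall>a\<in>carrier A. \<forall>a'\<in>carrier A. \<forall>xs. f (bichain_tensor sc R a (tensor_word sc xs) a') = h a xs a')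
    \<longleftrightarrow> (\<forall>k. f (\<gamma>3 k) = \<gamma>3 (dK (tmap (tmap rA rT) rA k)))" (is "?L \<longleftrightarrow> ?Q")
proof
  assume L: ?L
  show ?Q
  proof
    fix k
    show "f (\<gamma>3 k) = \<gamma>3 (dK (tmap (tmap rA rT) rA k))"
    proof (rule pmapto_eqI[where f = "\<lambda>k. f (\<gamma>3 k)" and g = "\<lambda>k. \<gamma>3 (dK (tmap (tmap rA rT) rA k))", OF pres_vsp[OF pres_BC]])
      show "pmapto BC (\<lambda>k. f (\<gamma>3 k))"
        by (rule lhom_pmapto[OF pres_pmapto[OF pres_BC] linear_maps_lhom[OF f]])
      show "pmapto BC (\<lambda>k. \<gamma>3 (dK (tmap (tmap rA rT) rA k)))"
        by (rule pmapto_comp[OF pres_pmapto[OF pres_BC] plin_comp[OF plin_tmap plin_ops(4)]])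
      fix k :: "'v key3"
      obtain u xs v where "k = ((u, xs), v)" by (metis surj_pair)
      then have k: "delta k = tens (tens (delta u) (delta xs)) (delta v :: _ \<Rightarrow>\<^sub>0 'k)" by simp
      have "f (\<gamma>3 (delta k)) = h (\<alpha> (delta u)) xs (\<alpha> (delta v))"
        unfolding k gamma3_tens gamma_tens tensor_word_beta[symmetric] using L pres_carrier[OF pres_A] by blast
      then show "f (\<gamma>3 (delta k)) = \<gamma>3 (dK (tmap (tmap rA rT) rA (delta k)))"
        unfolding h k by (simp add: tmap_tens plin_rA plin_rT plin_tmap del: tens_single)
    qed
  qed
next
  assume Q: ?Q
  show ?L
  proof (intro ballI allI)
    fix a a' xs assume "a \<in> carrier A" "a' \<in> carrier A"
    then obtain p q where p: "a = \<alpha> p" "a' = \<alpha> q" using alpha_surj by metis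
    have "f (\<gamma>3 (tens (tens p (delta xs)) q)) = \<gamma>3 (dK (tmap (tmap rA rT) rA (tens (tens p (delta xs)) q)))" using Q by blast
    then show "f (bichain_tensor sc R a (tensor_word sc xs) a') = h a xs a'"
      by (simp add: p h gamma3_tens gamma_tens tensor_word_beta tmap_tens plin_rA plin_rT plin_tmap)
  qed
qed

lemma bimodule_d_general:
  "bimodule_d sc R (\<gamma>3 k) = \<gamma>3 (dK (tmap (tmap rA rT) rA k))" "lhom BC BC (bimodule_d sc R)"
proof -
  note T = THE_linear_maps[OF pres_BC plin_comp[OF plin_tmap plin_ops(4)] _ bichain_spec[OF _ gamma3_dK[symmetric]]]
  show "bimodule_d sc R (\<gamma>3 k) = \<gamma>3 (dK (tmap (tmap rA rT) rA k))" "lhom BC BC (bimodule_d sc R)"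
    unfolding bimodule_d_def by (rule T; simp add: pres_idem[OF pres_BC])+
qed

lemma bimodule_d_gamma3: "k \<in> S3 \<Longrightarrow> bimodule_d sc R (\<gamma>3 k) = \<gamma>3 (dK k)"
  using nK_dK[of k] by (simp add: bimodule_d_general rho_S3 gamma3_eq_iff ops_S3)

lemma carrier_koszul_chains: "carrier (koszul_chains sc R p) = \<gamma> ` AW p"
proof -
  have "{chain_tensor sc R a w | a w. a \<in> carrier A \<and> w \<in> W_space sc R p} = \<gamma> ` {tens a w | a w. a \<in> FL E \<and> w \<in> W p}"
  proof (intro equalityI subsetI)
    fix x assume "x \<in> {chain_tensor sc R a w | a w. a \<in> carrier A \<and> w \<in> W_space sc R p}"
    then obtain a w where x: "x = chain_tensor sc R a w" "a \<in> carrier A" "w \<in> \<beta> ` W p"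
      unfolding W_space_eq by blast
    obtain r where p: "r \<in> FL E" "\<alpha> r = a" using alpha_surj_FL[OF x(2)] by blast
    obtain w' where w: "w' \<in> W p" "w = \<beta> w'" using x(3) by blast
    have "x = \<gamma> (tens r w')" by (simp add: x p w gamma_tens)
    then show "x \<in> \<gamma> ` {tens a w | a w. a \<in> FL E \<and> w \<in> W p}" using p w by blast
  next
    fix x assume "x \<in> \<gamma> ` {tens a w | a w. a \<in> FL E \<and> w \<in> W p}"
    then obtain a w where x: "x = \<gamma> (tens a w)" "w \<in> W p" by blast
    then show "x \<in> {chain_tensor sc R a w | a w. a \<in> carrier A \<and> w \<in> W_space sc R p}"
      unfolding W_space_eq x(1) gamma_tens using pres_carrier[OF pres_A] by blast
  qed
  then show ?thesis
    unfolding koszul_chains_def AW_def linear_span_image[OF pres_vsp[OF pres_C] pres_pmapto[OF pres_C], symmetric]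
    by simp
qed

lemma carrier_bimodule_complex: "carrier (bimodule_complex sc R p) = \<gamma>3 ` AWA p"
proof -
  have "{bichain_tensor sc R a w a' | a w a'. a \<in> carrier A \<and> w \<in> W_space sc R p \<and> a' \<in> carrier A}
      = \<gamma>3 ` {tens (tens a w) b | a w b. a \<in> FL E \<and> w \<in> W p \<and> b \<in> FL E}"
  proof (intro equalityI subsetI)
    fix x assume "x \<in> {bichain_tensor sc R a w a' | a w a'. a \<in> carrier A \<and> w \<in> W_space sc R p \<and> a' \<in> carrier A}"
    then obtain a w a' where x: "x = bichain_tensor sc R a w a'" "a \<in> carrier A" "w \<in> \<beta> ` W p" "a' \<in> carrier A"
      unfolding W_space_eq by blast
    obtain r where p: "r \<in> FL E" "\<alpha> r = a" using alpha_surj_FL[OF x(2)] by blast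
    obtain q where q: "q \<in> FL E" "\<alpha> q = a'" using alpha_surj_FL[OF x(4)] by blast
    obtain w' where w: "w' \<in> W p" "w = \<beta> w'" using x(3) by blast
    have "x = \<gamma>3 (tens (tens r w') q)" by (simp add: x p q w gamma_tens gamma3_tens)
    then show "x \<in> \<gamma>3 ` {tens (tens a w) b | a w b. a \<in> FL E \<and> w \<in> W p \<and> b \<in> FL E}" using p q w by blast
  next
    fix x assume "x \<in> \<gamma>3 ` {tens (tens a w) b | a w b. a \<in> FL E \<and> w \<in> W p \<and> b \<in> FL E}"
    then obtain a w b where x: "x = \<gamma>3 (tens (tens a w) b)" "w \<in> W p" by blast
    then show "x \<in> {bichain_tensor sc R a w a' | a w a'. a \<in> carrier A \<and> w \<in> W_space sc R p \<and> a' \<in> carrier A}"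
      unfolding W_space_eq x(1) gamma3_tens gamma_tens using pres_carrier[OF pres_A] by blast
  qed
  then show ?thesis
    unfolding bimodule_complex_def AWA_def linear_span_image[OF pres_vsp[OF pres_BC] pres_pmapto[OF pres_BC], symmetric]
    by simp
qed

text \<open>An isomorphism with the zero space leaves only one class, and equality of chains
  translates into equality after \<open>nK\<close>.\<close>

lemma koszul_imp_exact:
  assumes "koszul sc R"
  shows koszul_exact
  unfolding koszul_exact_def
proof (intro allI impI ballI)
  fix n k assume n: "0 < n" and k: "k \<in> AWA n" and dk: "nK (dK k) = 0"
  interpret BC: abelian_group BC by (rule vsp_abelian_group[OF pres_vsp[OF pres_BC]])
  let ?d = "bimodule_d sc R" and ?K = "bimodule_complex sc R"
  let ?M = "(?K n)\<lparr>carrier := {z \<in> carrier (?K n). ?d z = \<zero>\<^bsub>?K (n - 1)\<^esub>}\<rparr>"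
  let ?N = "?d ` carrier (?K (Suc n))"
  have K: "\<zero>\<^bsub>?K m\<^esub> = \<zero>\<^bsub>BC\<^esub>" "x +>\<^bsub>?K m\<^esub> y = x +>\<^bsub>BC\<^esub> y" for m x y
    by (simp_all add: bimodule_complex_def)
  have "linearly_isomorphic (homology ?K (\<lambda>_. ?d) n) (zero_space :: ('k, 'k) module)"
    using assms n unfolding koszul_def by blast
  then have iso: "linearly_isomorphic (quotient ?M ?N) (zero_space :: ('k, 'k) module)"
    unfolding homology_def .
  have mem: "\<gamma>3 k' \<in> carrier ?M" if "k' \<in> AWA n" "nK (dK k') = 0" for k'
    using that AWA_S3[OF that(1)]
    by (auto simp: carrier_bimodule_complex K bimodule_d_gamma3 gamma3_eq_zero_iff ops_S3)
  have "0 \<in> AWA n" by (rule pm.subspace_0[OF subspaces(2)])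
  then have "\<gamma>3 0 \<in> carrier ?M" by (rule mem) (simp add: plin_zero[OF plin_ops(4)] plin_zero[OF plin_n(2)])
  \<comment> \<open>The class of the cycle equals the class of 0, so the cycle lies in the coset of
    boundaries.\<close>
  from quotient_zero_spaceD[OF iso this mem[OF k dk]]
  have "?N +>\<^bsub>BC\<^esub> \<zero>\<^bsub>BC\<^esub> = ?N +>\<^bsub>BC\<^esub> \<gamma>3 k"
    by (simp add: K pres_zero[OF pres_BC])
  moreover have "\<zero>\<^bsub>BC\<^esub> \<in> ?N"
  proof -
    have "0 \<in> AWA (Suc n)" by (rule pm.subspace_0[OF subspaces(2)])
    moreover have "?d (\<gamma>3 0) = \<zero>\<^bsub>BC\<^esub>"
      using bimodule_d_gamma3[OF pm.subspace_0[OF S_subspace(2)]]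
      by (simp add: plin_zero[OF plin_ops(4)] pres_zero[OF pres_BC])
    ultimately show ?thesis unfolding carrier_bimodule_complex by (metis imageI)
  qed
  ultimately have "\<zero>\<^bsub>BC\<^esub> \<oplus>\<^bsub>BC\<^esub> \<gamma>3 k \<in> ?N +>\<^bsub>BC\<^esub> \<zero>\<^bsub>BC\<^esub>" by (auto simp: a_r_coset_def')
  then obtain x where "x \<in> ?N" "\<gamma>3 k = x \<oplus>\<^bsub>BC\<^esub> \<zero>\<^bsub>BC\<^esub>"
    using pres_carrier[OF pres_BC, of k] by (auto simp: a_r_coset_def')
  then obtain k' where k': "k' \<in> AWA (Suc n)" "\<gamma>3 k = ?d (\<gamma>3 k') \<oplus>\<^bsub>BC\<^esub> \<zero>\<^bsub>BC\<^esub>"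
    unfolding carrier_bimodule_complex by blast
  then have "\<gamma>3 k = \<gamma>3 (dK k')"
    using pres_carrier[OF pres_BC, of "dK k'"] by (simp add: bimodule_d_gamma3[OF AWA_S3])
  then have "nK (dK k') = nK k"
    using k k'(1) by (simp add: gamma3_eq_iff AWA_S3 ops_S3)
  then show "\<exists>k'\<in>AWA (Suc n). nK (dK k') = nK k" using k'(1) by blast
qed

subsection \<open>Koszul homology\<close>

abbreviation "KC \<equiv> koszul_chains sc R"
abbreviation "kb \<equiv> koszul_b sc R"
abbreviation "cap \<equiv> cap_e_A sc R"
abbreviation "KH \<equiv> koszul_homology sc R"

lemma KC_eq: "KC p = C\<lparr>carrier := \<gamma> ` AW p\<rparr>"
  using carrier_koszul_chains[of p] by (simp add: koszul_chains_def)

lemma vsp_C: "vsp C" by (rule pres_vsp[OF pres_C])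

lemma vsp_KC: "vsp (KC p)"
  unfolding KC_eq
  by (rule vsp_restrict[OF vsp_C pmapto_image_submodule[OF vsp_C pres_pmapto[OF pres_C] subspaces(1)]])

lemma lhom_KC:
  assumes "lhom C C f" "\<And>z. z \<in> AW p \<Longrightarrow> f (\<gamma> z) \<in> \<gamma> ` AW q"
  shows "lhom (KC p) (KC q) f"
  using assms pres_carrier[OF pres_C] unfolding KC_eq by (auto simp: lhom_def)

lemma kb_gamma: "z \<in> AW p \<Longrightarrow> kb (\<gamma> z) = \<gamma> (bX z)" and cap_gamma': "z \<in> AW p \<Longrightarrow> cap (\<gamma> z) = \<gamma> (- eX z)"
  using koszul_b_gamma cap_gamma AW_S2 by blast+

lemma gamma_eq: "z \<in> AW p \<Longrightarrow> z' \<in> AW q \<Longrightarrow> \<gamma> z = \<gamma> z' \<longleftrightarrow> nX z = nX z'"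
  using gamma_eq_iff AW_S2 by blast

lemma gamma_eq_0: "z \<in> AW p \<Longrightarrow> \<gamma> z = \<zero>\<^bsub>C\<^esub> \<longleftrightarrow> nX z = 0"
  using gamma_eq_zero_iff AW_S2 by blast

lemma AW_neg: "z \<in> AW p \<Longrightarrow> - z \<in> AW p"
  by (rule pm.subspace_neg[OF subspaces(1)])

lemma KC_complex: "complex_at KC (\<lambda>_. kb) p"
proof
  show "lhom (KC p) (KC (p - 1)) kb"
    by (rule lhom_KC[OF koszul_b_general(2)]) (use bX_X[of _ p] in \<open>auto simp: kb_gamma\<close>)
  show "lhom (KC (Suc p)) (KC p) kb"
    by (rule lhom_KC[OF koszul_b_general(2)]) (use bX_X[of _ "Suc p"] in \<open>auto simp: kb_gamma\<close>)
  fix x assume "x \<in> carrier (KC (Suc p))"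
  then obtain z where z: "z \<in> AW (Suc p)" "x = \<gamma> z" by (auto simp: KC_eq)
  have "bX z \<in> AW p" using bX_X[OF z(1)] by simp
  then show "kb (kb x) = \<zero>\<^bsub>KC (p - 1)\<^esub>"
    using bX_X[of "bX z" p] by (simp add: z kb_gamma[OF z(1)] kb_gamma[of "bX z" p] gamma_eq_0[of "bX (bX z)" "p - 1"] nX_squares(1)[OF z(1)] KC_eq)
qed (rule vsp_KC)+

interpretation KC: complex_at KC "\<lambda>_. kb" p for p
  by (rule KC_complex)

lemma KH_eq: "KH = homology KC (\<lambda>_. kb)"
  by (simp add: koszul_homology_def fun_eq_iff)

lemma Z_eq: "KC.Z p = \<gamma> ` {z \<in> AW p. nX (bX z) = 0}"
proof -
  have "kb (\<gamma> z) = \<zero>\<^bsub>KC (p - 1)\<^esub> \<longleftrightarrow> nX (bX z) = 0" if "z \<in> AW p" for z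
    using that gamma_eq_0[OF bX_X[OF that]] by (simp add: kb_gamma[OF that] KC_eq)
  then show ?thesis unfolding KC.Z_def by (auto simp: KC_eq)
qed

lemma B_eq: "KC.B p = \<gamma> ` (bX ` AW (Suc p))"
  unfolding KC.B_def KC_eq by (auto simp: kb_gamma image_iff)

abbreviation cls :: "nat \<Rightarrow> ('v key2 \<Rightarrow>\<^sub>0 'k) \<Rightarrow> ('k, 'v) kchain set" where
  "cls p z \<equiv> KC.B p +>\<^bsub>C\<^esub> \<gamma> z"

lemma KC_coset: "N +>\<^bsub>KC p\<^esub> x = N +>\<^bsub>C\<^esub> x"
  by (simp add: KC_eq)

lemma carrier_KH: "carrier (KH p) = cls p ` {z \<in> AW p. nX (bX z) = 0}"
  unfolding KH_eq KC.carrier_homology Z_eq KC_coset by (simp add: image_image)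

lemma zero_KH: "\<zero>\<^bsub>KH p\<^esub> = KC.B p"
  unfolding KH_eq KC.zero_homology ..

lemma in_Z: "z \<in> AW p \<Longrightarrow> nX (bX z) = 0 \<Longrightarrow> \<gamma> z \<in> KC.Z p"
  by (simp add: Z_eq)

lemma cls_eq_iff:
  assumes "z \<in> AW p" "nX (bX z) = 0" "z' \<in> AW p" "nX (bX z') = 0"
  shows "cls p z = cls p z' \<longleftrightarrow> (\<exists>y\<in>AW (Suc p). nX z = nX (bX y + z'))"
proof -
  have "cls p z = cls p z' \<longleftrightarrow> (\<exists>n\<in>KC.B p. \<gamma> z = n \<oplus>\<^bsub>C\<^esub> \<gamma> z')"
    using KC.homology_coset_eq_iff[OF in_Z[OF assms(1,2)] in_Z[OF assms(3,4)]]
    by (simp add: KC_eq)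
  also have "\<dots> \<longleftrightarrow> (\<exists>y\<in>AW (Suc p). \<gamma> z = \<gamma> (bX y + z'))"
    unfolding B_eq by (simp add: pres_add[OF pres_C])
  also have "\<dots> \<longleftrightarrow> (\<exists>y\<in>AW (Suc p). nX z = nX (bX y + z'))"
  proof (intro bex_cong refl)
    fix y assume "y \<in> AW (Suc p)"
    then have "bX y + z' \<in> AW p" using bX_X[of y "Suc p"] assms(3) by (intro pm.subspace_add[OF subspaces(1)]) simp_all
    then show "\<gamma> z = \<gamma> (bX y + z') \<longleftrightarrow> nX z = nX (bX y + z')" by (rule gamma_eq[OF assms(1)])
  qed
  finally show ?thesis .
qed

lemma cls_eq_zero_iff:
  assumes "z \<in> AW p" "nX (bX z) = 0"
  shows "cls p z = \<zero>\<^bsub>KH p\<^esub> \<longleftrightarrow> (\<exists>y\<in>AW (Suc p). nX z = nX (bX y))"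
proof -
  have "cls p z = \<zero>\<^bsub>KH p\<^esub> \<longleftrightarrow> \<gamma> z \<in> KC.B p"
    using KC.homology_coset_eq_zero_iff[OF in_Z[OF assms]] by (simp add: zero_KH KC_eq)
  also have "\<dots> \<longleftrightarrow> (\<exists>y\<in>AW (Suc p). nX z = nX (bX y))"
    unfolding B_eq image_image using gamma_eq[OF assms(1) bX_X, of _ "Suc p"] by auto
  finally show ?thesis .
qed

lemma cls_add: "z \<in> AW p \<Longrightarrow> nX (bX z) = 0 \<Longrightarrow> z' \<in> AW p \<Longrightarrow> nX (bX z') = 0 \<Longrightarrow>
    cls p z \<oplus>\<^bsub>KH p\<^esub> cls p z' = cls p (z + z')"
  and cls_scl: "z \<in> AW p \<Longrightarrow> nX (bX z) = 0 \<Longrightarrow> c \<odot>\<^bsub>KH p\<^esub> cls p z = cls p (scl c z)"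
  using KC.homology_add[OF in_Z in_Z, of z p z'] KC.homology_smult[OF in_Z, of z p c]
  by (simp_all add: KH_eq KC_eq pres_add[OF pres_C] pres_scl[OF pres_C])

lemma cycle_add: "nX (bX z) = 0 \<Longrightarrow> nX (bX z') = 0 \<Longrightarrow> nX (bX (z + z')) = 0"
  and cycle_scl: "nX (bX z) = 0 \<Longrightarrow> nX (bX (scl c z)) = 0"
  and cycle_neg: "nX (bX z) = 0 \<Longrightarrow> nX (bX (- z)) = 0"
  by (simp_all add: plin_ops(3)[THEN plin_add] plin_ops(3)[THEN plin_scl] plin_ops(3)[THEN plin_uminus]
      plin_n(1)[THEN plin_add] plin_n(1)[THEN plin_scl] plin_n(1)[THEN plin_uminus])

section \<open>The differential induced by the cap product\<close>

lemma eX_AW0: "z \<in> AW 0 \<Longrightarrow> eX z = 0"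
  by (rule plin_eqI[OF plin_ops(2) pmp.linear_zero]) (auto dest: X0_keys)

lemma eX_cycle: "z \<in> AW p \<Longrightarrow> nX (bX z) = 0 \<Longrightarrow> nX (bX (- eX z)) = 0"
  by (simp add: plin_ops(3)[THEN plin_uminus] plin_n(1)[THEN plin_uminus] nX_squares(2) nX_0(2))

lemma minus_eX_AW: "z \<in> AW p \<Longrightarrow> - eX z \<in> AW (p - 1)"
  by (intro AW_neg eX_X)

text \<open>\<open>cap_differential\<close> takes the union over all representatives of a class; all
  of them yield the same coset.\<close>

lemma cap_differential_cls:
  assumes z: "z \<in> AW p" "nX (bX z) = 0"
  shows "cap_differential sc R p (cls p z) = cls (p - 1) (- eX z)"
proof -
  have eq: "KC.B (p - 1) +>\<^bsub>C\<^esub> cap x = cls (p - 1) (- eX z)" if x: "x \<in> cls p z" for x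
  proof -
    obtain y where y: "y \<in> AW (Suc p)" "x = \<gamma> (bX y) \<oplus>\<^bsub>C\<^esub> \<gamma> z"
      using x unfolding B_eq by (auto simp: a_r_coset_def')
    have bXy: "bX y \<in> AW p" using bX_X[OF y(1)] by simp
    then have m: "bX y + z \<in> AW p" by (rule pm.subspace_add[OF subspaces(1) _ z(1)])
    have mc: "nX (bX (bX y + z)) = 0" by (rule cycle_add[OF nX_squares(1)[OF y(1)] z(2)])
    have xeq: "x = \<gamma> (bX y + z)" by (simp add: y pres_add[OF pres_C])
    \<comment> \<open>Adding \<open>bX y\<close> to the representative changes the image by the
      boundary of \<open>eX y\<close>, since \<open>bX\<close> and \<open>eX\<close> anticommute
      modulo relations. In degree 0 both images vanish.\<close>
    have "\<exists>w\<in>AW (Suc (p - 1)). nX (- eX (bX y + z)) = nX (bX w + - eX z)"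
    proof (cases p)
      case 0
      then show ?thesis using m z(1) pm.subspace_0[OF subspaces(1)]
        by (intro bexI[of _ 0]) (simp_all add: eX_AW0 plin_zero[OF plin_ops(3)])
    next
      case (Suc p')
      have "nX (eX (bX y)) = - nX (bX (eX y))" using nX_squares(2)[OF y(1)] by simp
      then show ?thesis using eX_X[OF y(1)] Suc
        by (intro bexI[of _ "eX y"])
          (simp_all add: plin_ops(2)[THEN plin_add] plin_n(1)[THEN plin_add] plin_n(1)[THEN plin_uminus] plin_n(1)[THEN plin_diff])
    qed
    then have "cls (p - 1) (- eX (bX y + z)) = cls (p - 1) (- eX z)"
      unfolding cls_eq_iff[OF minus_eX_AW[OF m] eX_cycle[OF m mc] minus_eX_AW[OF z(1)] eX_cycle[OF z]]
      by simp
    then show ?thesis by (simp only: xeq cap_gamma'[OF m])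
  qed
  have "\<gamma> z \<in> cls p z"
    using KC.homology_coset_self[OF in_Z[OF z]] by (simp add: KC_eq)
  then show ?thesis unfolding cap_differential_def zero_KH using eq by blast
qed

lemma KH_complex: "complex_at KH (cap_differential sc R) p"
proof
  have vsp: "vsp (KH p)" for p unfolding KH_eq by (rule KC.vsp_homology)
  then show "vsp (KH p)" "vsp (KH (Suc p))" "vsp (KH (p - 1))" by blast+
  have "lhom (KH p) (KH (p - 1)) (cap_differential sc R p)" for p
    unfolding lhom_def carrier_KH
  proof (intro conjI ballI allI)
    fix x c assume "x \<in> cls p ` {z \<in> AW p. nX (bX z) = 0}"
    then obtain z where z: "x = cls p z" "z \<in> AW p" "nX (bX z) = 0" by blast
    note e = minus_eX_AW[OF z(2)] eX_cycle[OF z(2,3)]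
    show "cap_differential sc R p x \<in> cls (p - 1) ` {z \<in> AW (p - 1). nX (bX z) = 0}"
      unfolding z(1) cap_differential_cls[OF z(2,3)] using e by blast
    show "cap_differential sc R p (c \<odot>\<^bsub>KH p\<^esub> x) = c \<odot>\<^bsub>KH (p - 1)\<^esub> cap_differential sc R p x"
      unfolding z(1) cls_scl[OF z(2,3)] cap_differential_cls[OF z(2,3)] cls_scl[OF e]
        cap_differential_cls[OF pm.subspace_scale[OF subspaces(1) z(2)] cycle_scl[OF z(3)]]
      by (simp add: plin_ops(2)[THEN plin_scl])
    fix y assume "y \<in> cls p ` {z \<in> AW p. nX (bX z) = 0}"
    then obtain w where w: "y = cls p w" "w \<in> AW p" "nX (bX w) = 0" by blast
    note e' = minus_eX_AW[OF w(2)] eX_cycle[OF w(2,3)]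
    show "cap_differential sc R p (x \<oplus>\<^bsub>KH p\<^esub> y) = cap_differential sc R p x \<oplus>\<^bsub>KH (p - 1)\<^esub> cap_differential sc R p y"
      unfolding z(1) w(1) cls_add[OF z(2,3) w(2,3)] cap_differential_cls[OF z(2,3)] cap_differential_cls[OF w(2,3)] cls_add[OF e e']
        cap_differential_cls[OF pm.subspace_add[OF subspaces(1) z(2) w(2)] cycle_add[OF z(3) w(3)]]
      by (simp add: plin_ops(2)[THEN plin_add])
  qed
  from this[of p] this[of "Suc p"]
  show "lhom (KH p) (KH (p - 1)) (cap_differential sc R p)" "lhom (KH (Suc p)) (KH p) (cap_differential sc R (Suc p))"
    by simp_all
  fix x assume "x \<in> carrier (KH (Suc p))"
  then obtain z where z: "x = cls (Suc p) z" "z \<in> AW (Suc p)" "nX (bX z) = 0" unfolding carrier_KH by blast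
  have e: "- eX z \<in> AW p" "nX (bX (- eX z)) = 0" using minus_eX_AW[OF z(2)] eX_cycle[OF z(2,3)] by simp_all
  have "cap_differential sc R p (cap_differential sc R (Suc p) x) = cls (p - 1) (- eX (- eX z))"
    using cap_differential_cls[OF e] unfolding z(1) cap_differential_cls[OF z(2,3)] by simp
  also have "\<dots> = \<zero>\<^bsub>KH (p - 1)\<^esub>"
    by (subst cls_eq_zero_iff[OF minus_eX_AW[OF e(1)] eX_cycle[OF e]])
      (use nX_squares(3)[OF z(2)] pm.subspace_0[OF subspaces(1)] in
        \<open>auto simp: plin_ops[THEN plin_uminus] plin_ops[THEN plin_zero] plin_n[THEN plin_zero] intro!: bexI[of _ 0]\<close>)
  finally show "cap_differential sc R p (cap_differential sc R (Suc p) x) = \<zero>\<^bsub>KH (p - 1)\<^esub>" .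
qed

section \<open>Higher Koszul homology in positive degree and in degree 0\<close>

interpretation KH: complex_at KH "cap_differential sc R" p for p
  by (rule KH_complex)

lemma higher_eq: "higher_koszul_homology sc R p = homology KH (cap_differential sc R) p"
  by (simp add: higher_koszul_homology_def)

text \<open>\<open>cap_exact\<close> read on classes: a class killed by the cap differential is,
  modulo boundaries, the cap product with a cycle.\<close>

lemma higher_trivial:
  assumes "koszul sc R" "p > 0"
  shows "linearly_isomorphic (higher_koszul_homology sc R p) (zero_space :: ('k, 'k) module)"
  unfolding higher_eq
proof (rule linearly_isomorphic_zero_spaceI[OF KH.vsp_homology], rule subsetI)
  fix D assume "D \<in> carrier (homology KH (cap_differential sc R) p)"
  then obtain c where c: "c \<in> KH.Z p" "D = KH.B p +>\<^bsub>KH p\<^esub> c" unfolding KH.carrier_homology by blast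
  have "c \<in> KH.B p"
  proof -
    have cZ: "c \<in> carrier (KH p)" "cap_differential sc R p c = \<zero>\<^bsub>KH (p - 1)\<^esub>"
      using c(1) by (simp_all only: KH.Z_def mem_Collect_eq)
    obtain z where z: "c = cls p z" "z \<in> AW p" "nX (bX z) = 0"
      using cZ(1) unfolding carrier_KH by blast
    have "cls (p - 1) (- eX z) = \<zero>\<^bsub>KH (p - 1)\<^esub>"
      using cZ(2) unfolding z(1) cap_differential_cls[OF z(2,3)] .
    then have "\<exists>y\<in>AW (Suc (p - 1)). nX (- eX z) = nX (bX y)"
      unfolding cls_eq_zero_iff[OF minus_eX_AW[OF z(2)] eX_cycle[OF z(2,3)]] .
    moreover have "Suc (p - 1) = p" using assms(2) by simp
    ultimately obtain y where y: "y \<in> AW p" "nX (- eX z) = nX (bX y)" by (metis (no_types))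
    \<comment> \<open>The cap product is minus \<open>eX\<close>, so the witnesses y and v enter
      with a minus sign.\<close>
    have "nX (eX z) = - nX (- eX z)" by (simp add: plin_n(1)[THEN plin_uminus])
    also have "\<dots> = nX (bX (- y))"
      unfolding y(2) by (simp add: plin_ops(3)[THEN plin_uminus] plin_n(1)[THEN plin_uminus])
    finally have ez: "nX (eX z) = nX (bX (- y))" .
    obtain u v where uv: "u \<in> AW (Suc p)" "v \<in> AW (Suc p)" "nX (bX v) = 0" "nX z = nX (bX u + eX v)"
      using cap_exact[OF koszul_imp_exact[OF assms(1)] assms(2) z(2) AW_neg[OF y(1)] z(3) ez] by blast
    note v = AW_neg[OF uv(2)] cycle_neg[OF uv(3)]
    have e: "- eX (- v) \<in> AW p" "nX (bX (- eX (- v))) = 0"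
      using minus_eX_AW[OF v(1)] eX_cycle[OF v] by simp_all
    have "cap_differential sc R (Suc p) (cls (Suc p) (- v)) = cls p (- eX (- v))"
      using cap_differential_cls[OF v] by simp
    also have "\<dots> = c"
    proof -
      have "nX z = nX (bX u + - eX (- v))" using uv(4) by (simp add: plin_ops(2)[THEN plin_uminus])
      then have "cls p z = cls p (- eX (- v))" unfolding cls_eq_iff[OF z(2,3) e] using uv(1) by blast
      then show ?thesis by (simp only: z(1))
    qed
    finally have cc: "cap_differential sc R (Suc p) (cls (Suc p) (- v)) = c" .
    have "cls (Suc p) (- v) \<in> carrier (KH (Suc p))" unfolding carrier_KH using v by blast
    then have "cap_differential sc R (Suc p) (cls (Suc p) (- v)) \<in> KH.B p" unfolding KH.B_def by (rule imageI)
    then show ?thesis unfolding cc .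
  qed
  then have "D = KH.B p" unfolding c(2) KH.homology_coset_eq_zero_iff[OF c(1)] .
  then show "D \<in> {\<zero>\<^bsub>homology KH (cap_differential sc R) p\<^esub>}"
    unfolding KH.zero_homology by blast
qed

text \<open>The augmentation of degree 0 Koszul homology onto k. A representative may be chosen, as
  boundaries have no coefficient at the empty word.\<close>

definition \<epsilon> :: "('k, 'v) kchain set \<Rightarrow> 'k" where
  "\<epsilon> D = lookup (nf \<gamma> (tmap rA rT) (SOME x. x \<in> D)) ([], [])"

lemma epsilon_cls:
  assumes z: "z \<in> AW 0" "nX (bX z) = 0"
  shows "\<epsilon> (cls 0 z) = lookup z ([], [])"
proof -
  have "\<gamma> z \<in> cls 0 z"
    using KC.homology_coset_self[OF in_Z[OF z]] by (simp add: KC_eq)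
  then have "(SOME x. x \<in> cls 0 z) \<in> cls 0 z" by (rule someI)
  then obtain y where y: "y \<in> AW 1" "(SOME x. x \<in> cls 0 z) = \<gamma> (bX y + z)"
    unfolding B_eq by (auto simp: a_r_coset_def' pres_add[OF pres_C])
  have "bX y + z \<in> AW 0" using bX_X[OF y(1)] z(1) by (intro pm.subspace_add[OF subspaces(1)]) simp_all
  then show ?thesis
    unfolding \<epsilon>_def y(2) nf_pres[OF pres_C] rho_S2[OF AW_S2] lookup_nX
    by (simp add: lookup_nX rho_S2[OF AW_S2] lookup_add lookup_bX)
qed

lemma bX_AW0: "z \<in> AW 0 \<Longrightarrow> nX (bX z) = 0"
  by (simp add: bX_def dl_X0 eX_AW0 plin_zero[OF plin_n(1)])

text \<open>The first isomorphism theorem for the augmentation. Its kernel lies in the image of the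
  cap differential by \<open>augmentation_exact\<close>; conversely every cap product leaves a
  letter in A.\<close>

lemma higher_0: "linearly_isomorphic (higher_koszul_homology sc R 0) (base_space :: ('k, 'k) module)"
  unfolding higher_eq KH.homology_eq
proof (rule linearly_isomorphic_quotientI[OF KH.vsp_Z vsp_base_space KH.B_submodule_Z])
  have KH0: "carrier (KH 0) = cls 0 ` AW 0"
  proof -
    have "{z \<in> AW 0. nX (bX z) = 0} = AW 0" using bX_AW0 by blast
    then show ?thesis by (simp only: carrier_KH)
  qed
  have Z: "KH.Z 0 = cls 0 ` AW 0"
  proof -
    have cz: "cap_differential sc R 0 (cls 0 z) = \<zero>\<^bsub>KH (0 - 1)\<^esub>" if "z \<in> AW 0" for z
      unfolding cap_differential_cls[OF that bX_AW0[OF that]]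
      by (subst cls_eq_zero_iff[OF minus_eX_AW[OF that] eX_cycle[OF that bX_AW0[OF that]]])
        (use that pm.subspace_0[OF subspaces(1)] in \<open>auto simp: eX_AW0 plin_ops[THEN plin_zero] intro!: bexI[of _ 0]\<close>)
    have "x \<in> KH.Z 0" if "x \<in> cls 0 ` AW 0" for x
    proof -
      obtain z where z: "x = cls 0 z" "z \<in> AW 0" using \<open>x \<in> cls 0 ` AW 0\<close> by (rule imageE)
      have "cap_differential sc R 0 x = \<zero>\<^bsub>KH (0 - 1)\<^esub>" unfolding z(1) by (rule cz[OF z(2)])
      then show ?thesis using that unfolding KH.Z_def KH0 by (intro CollectI conjI)
    qed
    moreover have "KH.Z 0 \<subseteq> cls 0 ` AW 0" unfolding KH.Z_def KH0 by (rule Collect_restrict)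
    ultimately show ?thesis by (intro equalityI subsetI) (erule subsetD, assumption)
  qed
  have \<epsilon>: "\<epsilon> (cls 0 z) = lookup z ([], [])" if "z \<in> AW 0" for z
    by (rule epsilon_cls[OF that bX_AW0[OF that]])
  show "lhom ((KH 0)\<lparr>carrier := KH.Z 0\<rparr>) (base_space :: ('k, 'k) module) \<epsilon>"
    unfolding lhom_def
  proof (intro conjI ballI allI)
    fix x c assume "x \<in> carrier ((KH 0)\<lparr>carrier := KH.Z 0\<rparr>)"
    then have "x \<in> cls 0 ` AW 0" by (simp add: Z)
    then obtain z where z: "x = cls 0 z" "z \<in> AW 0" by (rule imageE)
    show "\<epsilon> x \<in> carrier (base_space :: ('k, 'k) module)" by simp
    show "\<epsilon> (c \<odot>\<^bsub>(KH 0)\<lparr>carrier := KH.Z 0\<rparr>\<^esub> x) = c \<odot>\<^bsub>(base_space :: ('k, 'k) module)\<^esub> \<epsilon> x"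
      using z(2) by (simp add: z(1) cls_scl bX_AW0 \<epsilon> pm.subspace_scale[OF subspaces(1)])
    fix y assume "y \<in> carrier ((KH 0)\<lparr>carrier := KH.Z 0\<rparr>)"
    then have "y \<in> cls 0 ` AW 0" by (simp add: Z)
    then obtain w where w: "y = cls 0 w" "w \<in> AW 0" by (rule imageE)
    show "\<epsilon> (x \<oplus>\<^bsub>(KH 0)\<lparr>carrier := KH.Z 0\<rparr>\<^esub> y) = \<epsilon> x \<oplus>\<^bsub>(base_space :: ('k, 'k) module)\<^esub> \<epsilon> y"
      using z(2) w(2) by (simp add: z(1) w(1) cls_add bX_AW0 \<epsilon> pm.subspace_add[OF subspaces(1)] lookup_add)
  qed
  have unit: "single ([], []) c \<in> AW 0" for c
    using pm.subspace_scale[OF subspaces(1) tens_X[of "delta []" "delta []" 0], of c]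
    by (simp add: delta_FL W_small delta_FE)
  have "c \<in> \<epsilon> ` KH.Z 0" for c
  proof (rule image_eqI)
    show "c = \<epsilon> (cls 0 (single ([], []) c))" by (simp add: \<epsilon>[OF unit])
    show "cls 0 (single ([], []) c) \<in> KH.Z 0" unfolding Z by (rule imageI[OF unit])
  qed
  then have "\<epsilon> ` KH.Z 0 = UNIV" by blast
  then show "\<epsilon> ` carrier ((KH 0)\<lparr>carrier := KH.Z 0\<rparr>) = carrier (base_space :: ('k, 'k) module)"
    by simp
  fix x assume "x \<in> carrier ((KH 0)\<lparr>carrier := KH.Z 0\<rparr>)"
  then have "x \<in> cls 0 ` AW 0" by (simp add: Z)
  then obtain z where z: "x = cls 0 z" "z \<in> AW 0" by (rule imageE)
  show "\<epsilon> x = \<zero>\<^bsub>(base_space :: ('k, 'k) module)\<^esub> \<longleftrightarrow> x \<in> KH.B 0"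
  proof
    assume "\<epsilon> x = \<zero>\<^bsub>(base_space :: ('k, 'k) module)\<^esub>"
    then have "lookup z ([], []) = 0" by (simp add: z \<epsilon>)
    from augmentation_exact[OF z(2) this]
    obtain u v where uv: "u \<in> AW 1" "v \<in> AW 1" "bX v = 0" "z = bX u + eX v" by blast
    have v: "- v \<in> AW (Suc 0)" "nX (bX (- v)) = 0"
      using uv(2,3) AW_neg by (simp_all add: plin_ops(3)[THEN plin_uminus] plin_n(1)[THEN plin_zero])
    have e: "- eX (- v) \<in> AW 0" using minus_eX_AW[OF v(1)] by simp
    have "cap_differential sc R (Suc 0) (cls (Suc 0) (- v)) = cls 0 (- eX (- v))"
      using cap_differential_cls[OF v] by simp
    also have "\<dots> = x"
    proof -
      have "nX z = nX (bX u + - eX (- v))" using uv(4) by (simp add: plin_ops(2)[THEN plin_uminus])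
      moreover have "u \<in> AW (Suc 0)" using uv(1) by simp
      ultimately have "cls 0 z = cls 0 (- eX (- v))"
        unfolding cls_eq_iff[OF z(2) bX_AW0[OF z(2)] e bX_AW0[OF e]] by blast
      then show ?thesis by (simp only: z(1))
    qed
    finally have cc: "cap_differential sc R (Suc 0) (cls (Suc 0) (- v)) = x" .
    have "cls (Suc 0) (- v) \<in> carrier (KH (Suc 0))" unfolding carrier_KH using v by blast
    then have "cap_differential sc R (Suc 0) (cls (Suc 0) (- v)) \<in> KH.B 0" unfolding KH.B_def by (rule imageI)
    then show "x \<in> KH.B 0" unfolding cc .
  next
    assume "x \<in> KH.B 0"
    then obtain v where v: "v \<in> AW (Suc 0)" "nX (bX v) = 0" "x = cap_differential sc R (Suc 0) (cls (Suc 0) v)"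
      unfolding KH.B_def carrier_KH by blast
    have e: "- eX v \<in> AW 0" using minus_eX_AW[OF v(1)] by simp
    have "x = cls 0 (- eX v)" using cap_differential_cls[OF v(1,2)] v(3) by simp
    then show "\<epsilon> x = \<zero>\<^bsub>(base_space :: ('k, 'k) module)\<^esub>" by (simp add: \<epsilon>[OF e] lookup_eX)
  qed
qed

end

theorem theorem6p4:
  fixes sc :: "'k::field_char_0 \<Rightarrow> 'v::ab_group_add \<Rightarrow> 'v"
    and R :: "('k, 'v) tens set"
  assumes "vector_space sc"
    and "quadratic_relations sc R"
  shows "linearly_isomorphic (higher_koszul_homology sc R 0) (base_space :: ('k, 'k) module)
    \<and> (koszul sc R \<longrightarrow>
        (\<forall>p>0. linearly_isomorphic (higher_koszul_homology sc R p) (zero_space :: ('k, 'k) module)))"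
proof -
  interpret quad sc R by (rule quad.intro[OF assms])
  obtain rA where "plin rA" "\<And>p. rA p = 0 \<longleftrightarrow> p \<in> I" "\<And>p. p - rA p \<in> I"
    "\<And>u. keys (rA (delta u)) \<subseteq> {v. length v = length u}" "rA (delta []) = delta []"
    using obtain_normal_form by blast
  then have "quad_nf sc R rA" using quad_axioms by (intro quad_nf.intro quad_nf_axioms.intro)
  then show ?thesis by (simp add: quad_nf.higher_0 quad_nf.higher_trivial)
qed

end
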